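(* Let $\Bbbk$ be a field. For every integer $d$ with $3\leq d\leq 5$, there exists a Cohen-Macaulay homogeneous affine semigroup ring $R=\Bbbk[S]$ over $\Bbbk$ such that $R$ has Cohen-Macaulay type $d$, $R$ is nearly Gorenstein, and $R$ is not level.
   Context: An affine semigroup is a finitely generated additive sub-semigroup $S$ (containing $0$) of $\mathbb{N}^n$ for some $n$, where $\mathbb N$ is the set of nonnegative integers; $\Bbbk[S]$ is the $\Bbbk$-subalgebra of $\Bbbk[x_1,\dots,x_n]$ spanned by the monomials $\mathbf{x}^{\mathbf a}$, $\mathbf a\in S$. $S$ (and $\Bbbk[S]$) is called homogeneous if all minimal generators of $S$ lie on an affine hyperplane not containing the origin; equivalently, $\Bbbk[S]$ is standard graded by assigning degree $1$ to all the monomials corresponding to the minimal generators of $S$. This is the grading used on $R$; its graded maximal ideal is denoted $\mathbf{m}$. Let $\omega_R$ denote the graded canonical module of $R$. The Cohen-Macaulay type of $R$ is the minimal number of generators of $\omega_R$. For an $R$-module $M$, the trace of $M$ is the ideal $\mathrm{tr}(M)=\sum_{\phi\in \mathrm{Hom}_R(M,R)}\phi(M)$ of $R$. The (Cohen-Macaulay) ring $R$ is nearly Gorenstein if $\mathrm{tr}(\omega_R)\supseteq\mathbf{m}$. It is level if all the degrees of the minimal generators of $\omega_R$ are the same. *)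

theory Defs
  imports
    Complex_Main
    "HOL-Library.Poly_Mapping"
    "HOL-Library.Extended_Nat"
    "HOL-Algebra.Ideal"
    "HOL-Algebra.Module"
begin

section \<open>Commutative algebra\<close>

definition prime_chain :: "('a, 'm) ring_scheme \<Rightarrow> nat \<Rightarrow> (nat \<Rightarrow> 'a set) \<Rightarrow> bool" where
  "prime_chain R n p \<longleftrightarrow> (\<forall>i\<le>n. primeideal (p i) R) \<and> (\<forall>i<n. p i \<subset> p (Suc i))"

definition krull_dim :: "('a, 'm) ring_scheme \<Rightarrow> enat" where
  "krull_dim R = Sup {enat n | n. \<exists>p. prime_chain R n p}"

definition height :: "('a, 'm) ring_scheme \<Rightarrow> 'a set \<Rightarrow> enat" where
  "height R P = Sup {enat n | n. \<exists>p. prime_chain R n p \<and> p n = P}"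

definition regular_sequence :: "('a, 'm) ring_scheme \<Rightarrow> 'a list \<Rightarrow> bool" where
  "regular_sequence R xs \<longleftrightarrow>
     set xs \<subseteq> carrier R \<and> Idl\<^bsub>R\<^esub> (set xs) \<noteq> carrier R \<and>
     (\<forall>i<length xs. \<forall>a\<in>carrier R.
        xs ! i \<otimes>\<^bsub>R\<^esub> a \<in> Idl\<^bsub>R\<^esub> (set (take i xs)) \<longrightarrow> a \<in> Idl\<^bsub>R\<^esub> (set (take i xs)))"

definition depth :: "('a, 'm) ring_scheme \<Rightarrow> 'a set \<Rightarrow> enat" where
  "depth R I = Sup {enat (length xs) | xs. regular_sequence R xs \<and> set xs \<subseteq> I}"

text \<open>
  For Noetherian rings, such as all finitely generated algebras over a field. For a maximal ideal
  \<open>P\<close>, the depth of \<open>P\<close> on \<open>R\<close> is the depth of the local ring \<open>R\<^sub>P\<close>, and the height of \<open>P\<close> is its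
  dimension.
\<close>
definition cohen_macaulay :: "('a, 'm) ring_scheme \<Rightarrow> bool" where
  "cohen_macaulay R \<longleftrightarrow> (\<forall>P. maximalideal P R \<longrightarrow> depth R P = height R P)"

definition generates_module ::
    "('a, 'm) ring_scheme \<Rightarrow> ('a, 'b, 'n) module_scheme \<Rightarrow> 'b set \<Rightarrow> bool" where
  "generates_module R M G \<longleftrightarrow>
     G \<subseteq> carrier M \<and> (\<forall>N. submodule N R M \<and> G \<subseteq> N \<longrightarrow> N = carrier M)"

definition min_num_generators :: "('a, 'm) ring_scheme \<Rightarrow> ('a, 'b, 'n) module_scheme \<Rightarrow> enat" where
  "min_num_generators R M = Inf {enat (card G) | G. finite G \<and> generates_module R M G}"

definition linear_forms ::
    "('a, 'm) ring_scheme \<Rightarrow> ('a, 'b, 'n) module_scheme \<Rightarrow> ('b \<Rightarrow> 'a) set" where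
  "linear_forms R M = {\<phi> \<in> carrier M \<rightarrow> carrier R.
     (\<forall>x\<in>carrier M. \<forall>y\<in>carrier M. \<phi> (x \<oplus>\<^bsub>M\<^esub> y) = \<phi> x \<oplus>\<^bsub>R\<^esub> \<phi> y) \<and>
     (\<forall>r\<in>carrier R. \<forall>x\<in>carrier M. \<phi> (r \<odot>\<^bsub>M\<^esub> x) = r \<otimes>\<^bsub>R\<^esub> \<phi> x)}"

definition trace_ideal :: "('a, 'm) ring_scheme \<Rightarrow> ('a, 'b, 'n) module_scheme \<Rightarrow> 'a set" where
  "trace_ideal R M = Idl\<^bsub>R\<^esub> (\<Union>\<phi>\<in>linear_forms R M. \<phi> ` carrier M)"


section \<open>Affine semigroup rings\<close>

text \<open>
  Exponent vectors live in \<open>\<int>\<^sup>n\<close>, represented by finitely supported functions with support in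
  \<open>{..<n}\<close>; affine semigroups consist of vectors with nonnegative entries. In this way a semigroup
  ring and its localizations at monomials are all subrings of one Laurent polynomial ring.
\<close>

type_synonym expo = "nat \<Rightarrow>\<^sub>0 int"
type_synonym 'k laurent = "expo \<Rightarrow>\<^sub>0 'k"

definition nonneg_vectors :: "nat \<Rightarrow> expo set" where
  "nonneg_vectors n = {a. Poly_Mapping.keys a \<subseteq> {..<n} \<and> (\<forall>i. 0 \<le> Poly_Mapping.lookup a i)}"

inductive_set submonoid_span :: "expo set \<Rightarrow> expo set" for A :: "expo set" where
  zero: "0 \<in> submonoid_span A"
| add: "a \<in> A \<Longrightarrow> b \<in> submonoid_span A \<Longrightarrow> a + b \<in> submonoid_span A"

definition affine_semigroup :: "expo set \<Rightarrow> bool" where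
  "affine_semigroup S \<longleftrightarrow> (\<exists>n A. finite A \<and> A \<subseteq> nonneg_vectors n \<and> S = submonoid_span A)"

text \<open>
  As affine semigroups have no nonzero invertible elements, the irreducible elements form the
  unique minimal generating set.
\<close>
definition min_gens :: "expo set \<Rightarrow> expo set" where
  "min_gens S = {a \<in> S - {0}. \<not> (\<exists>b\<in>S - {0}. \<exists>c\<in>S - {0}. a = b + c)}"

text \<open>The linear form \<open>w\<close> is automatically nonzero unless \<open>S = {0}\<close>.\<close>
definition homogeneous_semigroup :: "expo set \<Rightarrow> bool" where
  "homogeneous_semigroup S \<longleftrightarrow>
     (\<exists>(w :: nat \<Rightarrow> real) c. c \<noteq> 0 \<and>
        (\<forall>a\<in>min_gens S. (\<Sum>i\<in>Poly_Mapping.keys a. w i * of_int (Poly_Mapping.lookup a i)) = c))"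

definition semigroup_ring :: "expo set \<Rightarrow> 'k::field laurent ring" where
  "semigroup_ring S =
     \<lparr>carrier = {f. Poly_Mapping.keys f \<subseteq> S}, mult = (*), one = 1, zero = 0, add = (+)\<rparr>"

definition graded_max_ideal :: "expo set \<Rightarrow> 'k::field laurent set" where
  "graded_max_ideal S = {f. Poly_Mapping.keys f \<subseteq> S - {0}}"

text \<open>
  The elements of degree \<open>i\<close> of the group generated by \<open>S\<close>, for the grading in which all minimal
  generators have degree 1.
\<close>
definition degree_part :: "expo set \<Rightarrow> int \<Rightarrow> expo set" where
  "degree_part S i = {a. \<exists>c :: expo \<Rightarrow> int. (\<Sum>g\<in>min_gens S. c g) = i \<and>
     (\<forall>k. Poly_Mapping.lookup a k = (\<Sum>g\<in>min_gens S. c g * Poly_Mapping.lookup g k))}"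


section \<open>Local cohomology\<close>

text \<open>
  Local cohomology with support in the graded maximal ideal is the cohomology of the (alternating)
  Cech complex on the monomials of the minimal generators. A cochain of degree \<open>j\<close> assigns to each
  set \<open>F\<close> of \<open>j\<close> minimal generators an element of the localization of the semigroup ring at the
  product of the monomials in \<open>F\<close>; it is extended by 0 to the other arguments. The linear order
  on exponent vectors only serves to fix the signs.
\<close>

type_synonym 'k cochain = "expo set \<Rightarrow> 'k laurent"

definition localization :: "expo set \<Rightarrow> expo set \<Rightarrow> 'k::field laurent set" where
  "localization S F =
     {f. \<exists>N::nat. (\<Prod>g\<in>F. Poly_Mapping.single g 1) ^ N * f \<in> carrier (semigroup_ring S)}"

definition cochains :: "expo set \<Rightarrow> nat \<Rightarrow> 'k::field cochain set" where
  "cochains S j = {z. \<forall>F. if F \<subseteq> min_gens S \<and> card F = j then z F \<in> localization S F else z F = 0}"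

definition coboundary_map :: "expo set \<Rightarrow> 'k::field cochain \<Rightarrow> 'k cochain" where
  "coboundary_map S z = (\<lambda>F. if F \<subseteq> min_gens S
     then \<Sum>g\<in>F. (-1) ^ card {h \<in> F. h < g} * z (F - {g}) else 0)"

definition cocycles :: "expo set \<Rightarrow> nat \<Rightarrow> 'k::field cochain set" where
  "cocycles S j = {z \<in> cochains S j. coboundary_map S z = (\<lambda>_. 0)}"

definition coboundaries :: "expo set \<Rightarrow> nat \<Rightarrow> 'k::field cochain set" where
  "coboundaries S j =
     (case j of 0 \<Rightarrow> {\<lambda>_. 0} | Suc i \<Rightarrow> coboundary_map S ` cochains S i)"

definition graded_cocycles :: "expo set \<Rightarrow> nat \<Rightarrow> int \<Rightarrow> 'k::field cochain set" where
  "graded_cocycles S j i = {z \<in> cocycles S j. \<forall>F. Poly_Mapping.keys (z F) \<subseteq> degree_part S i}"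


section \<open>The graded canonical module\<close>

text \<open>
  With \<open>d\<close> the dimension of the semigroup ring \<open>R\<close>, the graded canonical module is the graded dual
  of the top local cohomology \<open>H\<^sup>d\<close>: its component in degree \<open>i\<close> is the space of linear functionals
  on \<open>H\<^sup>d\<close> in degree \<open>-i\<close>, and \<open>r \<in> R\<close> acts by \<open>(r \<phi>)(z) = \<phi>(r z)\<close>. Functionals on \<open>H\<^sup>d\<close> are
  represented as functionals on the cocycles that vanish on the coboundaries, with value 0 outside
  the cocycles; an element of the graded dual is nonzero in only finitely many degrees.
\<close>

definition semigroup_dim :: "'k::field itself \<Rightarrow> expo set \<Rightarrow> nat" where
  "semigroup_dim _ S = the_enat (krull_dim (semigroup_ring S :: 'k laurent ring))"

abbreviation top_cocycles :: "expo set \<Rightarrow> 'k::field cochain set" where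
  "top_cocycles S \<equiv> cocycles S (semigroup_dim TYPE('k) S)"

definition cohomology_functionals :: "expo set \<Rightarrow> ('k::field cochain \<Rightarrow> 'k) set" where
  "cohomology_functionals S = {\<phi>.
     (\<forall>y\<in>top_cocycles S. \<forall>z\<in>top_cocycles S. \<phi> (\<lambda>F. y F + z F) = \<phi> y + \<phi> z) \<and>
     (\<forall>c. \<forall>z\<in>top_cocycles S. \<phi> (\<lambda>F. Poly_Mapping.single 0 c * z F) = c * \<phi> z) \<and>
     (\<forall>z\<in>coboundaries S (semigroup_dim TYPE('k) S). \<phi> z = 0) \<and>
     (\<forall>z. z \<notin> top_cocycles S \<longrightarrow> \<phi> z = 0)}"

definition vanishes_in_degree :: "expo set \<Rightarrow> ('k::field cochain \<Rightarrow> 'k) \<Rightarrow> int \<Rightarrow> bool" where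
  "vanishes_in_degree S \<phi> i \<longleftrightarrow>
     (\<forall>z\<in>graded_cocycles S (semigroup_dim TYPE('k) S) i. \<phi> z = 0)"

text \<open>The ring multiplication and unit of the module record play no role.\<close>
definition canonical_module ::
    "expo set \<Rightarrow> ('k::field laurent, 'k cochain \<Rightarrow> 'k) module" where
  "canonical_module S =
     \<lparr>carrier = {\<phi> \<in> cohomology_functionals S. finite {i. \<not> vanishes_in_degree S \<phi> i}},
      mult = undefined, one = undefined,
      zero = (\<lambda>_. 0), add = (\<lambda>\<phi> \<psi> z. \<phi> z + \<psi> z),
      smult = (\<lambda>r \<phi> z. if z \<in> top_cocycles S then \<phi> (\<lambda>F. r * z F) else 0)\<rparr>"

definition canonical_part :: "expo set \<Rightarrow> int \<Rightarrow> ('k::field cochain \<Rightarrow> 'k) set" where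
  "canonical_part S i =
     {\<phi> \<in> carrier (canonical_module S). \<forall>j. j \<noteq> - i \<longrightarrow> vanishes_in_degree S \<phi> j}"


section \<open>Type, near Gorensteinness and levelness\<close>

definition cm_type :: "'k::field itself \<Rightarrow> expo set \<Rightarrow> enat" where
  "cm_type _ S = min_num_generators (semigroup_ring S)
     (canonical_module S :: ('k laurent, 'k cochain \<Rightarrow> 'k) module)"

definition nearly_gorenstein :: "'k::field itself \<Rightarrow> expo set \<Rightarrow> bool" where
  "nearly_gorenstein _ S \<longleftrightarrow> graded_max_ideal S \<subseteq> trace_ideal (semigroup_ring S)
     (canonical_module S :: ('k laurent, 'k cochain \<Rightarrow> 'k) module)"

definition minimal_generating_system :: "expo set \<Rightarrow> ('k::field cochain \<Rightarrow> 'k) set \<Rightarrow> bool" where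
  "minimal_generating_system S G \<longleftrightarrow>
     G \<subseteq> (\<Union>i. canonical_part S i) \<and>
     generates_module (semigroup_ring S) (canonical_module S) G \<and>
     (\<forall>G'. G' \<subset> G \<longrightarrow> \<not> generates_module (semigroup_ring S) (canonical_module S) G')"

definition level :: "'k::field itself \<Rightarrow> expo set \<Rightarrow> bool" where
  "level _ S \<longleftrightarrow> (\<exists>i. \<forall>G :: ('k cochain \<Rightarrow> 'k) set.
     minimal_generating_system S G \<longrightarrow> G \<subseteq> canonical_part S i)"

end

theory Submission
  imports Defs "HOL-Computational_Algebra.Polynomial"
begin

text \<open>
For each of the types 3, 4 and 5 the example is a projective monomial curve: \<open>S\<close> is generated by the
vectors \<open>(a, D - a)\<close> for \<open>a\<close> in a set \<open>A\<close> of integers between \<open>0\<close> and \<open>D\<close> that contains \<open>0\<close> and \<open>D\<close>. As a set, \<open>S\<close> is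
the union of quadrants \<open>(X k, Y k) + D\<nat>\<^sup>2\<close>, one for each residue \<open>k\<close> modulo \<open>D\<close>, so the semigroup ring
\<open>R\<close> is a free module over the polynomial ring in the monomials \<open>u\<close> and \<open>v\<close> with exponents \<open>(D, 0)\<close> and
\<open>(0, D)\<close>.

\<^emph>\<open>Cohen-Macaulayness.\<close> Depth and height have to agree at every maximal ideal, over an arbitrary field.
Depth is at most height in general (\<open>depth_le_height\<close>). Chains of primes have length at most 2,
because three polynomials in two variables are algebraically dependent, by a dimension count
(\<open>prime_chain_length_le_2\<close>). Finally, each maximal ideal contains nonzero polynomials \<open>p(u)\<close> and
\<open>q(v)\<close>, by an elementary version of the Nullstellensatz (\<open>polynomial_in_maximalideal\<close>), and these form
a regular sequence because \<open>R\<close> is free over the polynomials in \<open>u\<close> and \<open>v\<close>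
(\<open>regular_sequence_poly_at\<close>). The same facts give the dimension 2.

\<^emph>\<open>The canonical module.\<close> In the Cech complex on all generators, a 2-cocycle is determined up to
coboundaries by its value on the two extremal generators. So the second local cohomology has
the monomials outside \<open>S_u \<union> S_v\<close> as a basis, where \<open>S_u\<close> and \<open>S_v\<close> are the localizations of \<open>S\<close> at \<open>u\<close> and \<open>v\<close>,
and its graded dual is the monomial module on the set \<open>W\<close> of the negatives of these exponents
(\<open>canonical_module_isomorphism\<close>). This \<open>W\<close> is again a union of quadrants, with the corners
\<open>(D - X k, D - Y k)\<close>.

\<^emph>\<open>Type, trace and levelness.\<close> These are now questions about \<open>W\<close>. The type is the number of corners
of \<open>W\<close> that are minimal for divisibility by elements of \<open>S\<close>, and levelness fails if these corners
have different degrees, since each of the corresponding functionals is homogeneous of one degree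
only. The trace contains the monomial of a generator \<open>(a, D - a)\<close> as soon as some translation maps
\<open>W\<close> into \<open>S\<close> and a point of \<open>W\<close> to \<open>(a, D - a)\<close>. For three explicit curves, of degrees 17, 15 and 19, all
of this is a finite computation with the tables of \<open>X\<close> and \<open>Y\<close> (\<open>curve_check\<close>).
\<close>

section \<open>Prime ideals and regular sequences\<close>

context cring begin

lemma ideal_plus_multiples:
  assumes "ideal Q R" "a \<in> carrier R"
  shows "ideal {q \<oplus> a \<otimes> r | q r. q \<in> Q \<and> r \<in> carrier R} R" (is "ideal ?I R")
proof -
  have eq: "?I = Q <+>\<^bsub>R\<^esub> (PIdl a)"
    using assms(2) m_comm unfolding cgenideal_def set_add_def' by fastforce
  show ?thesis unfolding eq
    by (rule add_ideals[OF assms(1) cgenideal_ideal[OF assms(2)]])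
qed

text \<open>
Krull's lemma: an ideal that is maximal among those avoiding a multiplicatively closed set is
prime.
\<close>

lemma prime_ideal_avoiding:
  assumes J: "ideal J R" and disj: "J \<inter> T = {}"
    and one: "\<one> \<in> T"
    and mult: "\<And>s t. s \<in> T \<Longrightarrow> t \<in> T \<Longrightarrow> s \<otimes> t \<in> T"
  obtains Q where "primeideal Q R" "J \<subseteq> Q" "Q \<inter> T = {}"
proof -
  define C where "C = {I. ideal I R \<and> J \<subseteq> I \<and> I \<inter> T = {}}"
  have "\<exists>Q\<in>C. \<forall>X\<in>C. Q \<subseteq> X \<longrightarrow> X = Q"
  proof (rule subset_Zorn_nonempty)
    show "C \<noteq> {}" using J disj unfolding C_def by auto
    fix K assume K: "K \<noteq> {}" "subset.chain C K"
    then have KC: "\<And>I. I \<in> K \<Longrightarrow> ideal I R \<and> J \<subseteq> I \<and> I \<inter> T = {}"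
      unfolding C_def subset.chain_def by blast
    have lin: "\<And>I I'. I \<in> K \<Longrightarrow> I' \<in> K \<Longrightarrow> I \<subseteq> I' \<or> I' \<subseteq> I"
      using K(2) unfolding subset.chain_def by blast
    have idl: "ideal I R" if "I \<in> K" for I using KC[OF that] by blast
    have sub: "additive_subgroup I R" if "I \<in> K" for I
      using ideal.axioms(1)[OF idl[OF that]] .
    have "ideal (\<Union>K) R"
    proof (rule idealI[OF ring_axioms])
      show "subgroup (\<Union>K) (add_monoid R)"
      proof (rule add.subgroupI)
        show "\<Union>K \<subseteq> carrier R"
          by (rule Union_least) (rule additive_subgroup.a_subset[OF sub])
        show "\<Union>K \<noteq> {}" using K(1) additive_subgroup.zero_closed[OF sub] by blast
        show "\<ominus> a \<in> \<Union>K" if a: "a \<in> \<Union>K" for a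
        proof -
          obtain I where "I \<in> K" "a \<in> I" using a by blast
          then show ?thesis using additive_subgroup.a_inv_closed[OF sub] by blast
        qed
        show "a \<oplus> b \<in> \<Union>K" if ab: "a \<in> \<Union>K" "b \<in> \<Union>K" for a b
        proof -
          obtain I I' where "I \<in> K" "a \<in> I" "I' \<in> K" "b \<in> I'" using ab by blast
          with lin[of I I'] obtain L where "L \<in> K" "a \<in> L" "b \<in> L" by blast
          then show ?thesis using additive_subgroup.a_closed[OF sub] by blast
        qed
      qed
      show "x \<otimes> a \<in> \<Union>K" "a \<otimes> x \<in> \<Union>K" if ax: "a \<in> \<Union>K" "x \<in> carrier R" for a x
      proof -
        obtain I where I: "I \<in> K" "a \<in> I" using ax(1) by blast
        show "x \<otimes> a \<in> \<Union>K" using ideal.I_l_closed[OF idl[OF I(1)] I(2) ax(2)] I(1) by blast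
        show "a \<otimes> x \<in> \<Union>K" using ideal.I_r_closed[OF idl[OF I(1)] I(2) ax(2)] I(1) by blast
      qed
    qed
    moreover have "J \<subseteq> \<Union>K" using K(1) KC by (meson Union_upper all_not_in_conv order_trans)
    moreover have "\<Union>K \<inter> T = {}" using KC by (simp add: Union_disjoint)
    ultimately show "\<Union>K \<in> C" unfolding C_def by simp
  qed
  then obtain Q where "Q \<in> C" and maxC: "\<And>X. X \<in> C \<Longrightarrow> Q \<subseteq> X \<Longrightarrow> X = Q"
    by metis
  then have Q: "ideal Q R" "J \<subseteq> Q" "Q \<inter> T = {}" unfolding C_def by simp_all
  have max: "X = Q" if "ideal X R" "J \<subseteq> X" "X \<inter> T = {}" "Q \<subseteq> X" for X
    using maxC[of X] that unfolding C_def by simp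
  interpret Q: ideal Q R by fact
  \<comment> \<open>Any strictly larger ideal meets \<open>T\<close>.\<close>
  have meet: "\<exists>q\<in>Q. \<exists>r\<in>carrier R. q \<oplus> a \<otimes> r \<in> T" if a: "a \<in> carrier R" "a \<notin> Q" for a
  proof (rule ccontr)
    let ?I = "{q \<oplus> a \<otimes> r | q r. q \<in> Q \<and> r \<in> carrier R}"
    assume "\<not> ?thesis"
    then have "?I \<inter> T = {}" by blast
    moreover have "Q \<subseteq> ?I"
    proof
      fix q assume "q \<in> Q"
      then have "q = q \<oplus> a \<otimes> \<zero>" using a(1) Q.Icarr by simp
      then show "q \<in> ?I" using \<open>q \<in> Q\<close> by blast
    qed
    ultimately have "?I = Q" using max[OF ideal_plus_multiples[OF Q(1) a(1)]] Q(2) by blast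
    moreover have "a \<in> ?I"
    proof -
      have "a = \<zero> \<oplus> a \<otimes> \<one>" using a(1) by simp
      then show ?thesis using Q.zero_closed by blast
    qed
    ultimately show False using a(2) by blast
  qed
  have "primeideal Q R"
  proof (rule primeidealI[OF Q(1) is_cring])
    show "carrier R \<noteq> Q" using Q(3) one by auto
    fix a b assume ab: "a \<in> carrier R" "b \<in> carrier R" "a \<otimes> b \<in> Q"
    show "a \<in> Q \<or> b \<in> Q"
    proof (rule ccontr)
      assume "\<not> ?thesis"
      then have nab: "a \<notin> Q" "b \<notin> Q" by auto
      obtain q r where h1: "q \<in> Q" "r \<in> carrier R" "q \<oplus> a \<otimes> r \<in> T"
        using meet[OF ab(1) nab(1)] by metis
      obtain q' r' where h2: "q' \<in> Q" "r' \<in> carrier R" "q' \<oplus> b \<otimes> r' \<in> T"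
        using meet[OF ab(2) nab(2)] by metis
      note h = h1 h2
      then have c: "q \<in> carrier R" "q' \<in> carrier R" using Q.Icarr by auto
      have "(q \<oplus> a \<otimes> r) \<otimes> (q' \<oplus> b \<otimes> r')
          = (q \<otimes> (q' \<oplus> b \<otimes> r') \<oplus> q' \<otimes> (a \<otimes> r)) \<oplus> (a \<otimes> b) \<otimes> (r \<otimes> r')"
        using c h(2,5) ab(1,2) by algebra
      moreover have "\<dots> \<in> Q"
        using c h(2,5) ab(1,2) by (intro Q.a_closed Q.I_r_closed h(1,4) ab(3)) simp_all
      ultimately show False using mult[OF h(3) h(6)] Q(3) by auto
    qed
  qed
  then show ?thesis using that Q by blast
qed

lemma regular_mod_power:
  assumes "ideal J R" "x \<in> carrier R" "u \<in> carrier R"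
    and reg: "\<And>a. a \<in> carrier R \<Longrightarrow> x \<otimes> a \<in> J \<Longrightarrow> a \<in> J"
    and "u \<otimes> x [^] (n::nat) \<in> J"
  shows "u \<in> J"
  using assms(5)
proof (induction n)
  case 0 then show ?case using assms by simp
next
  case (Suc n)
  have "u \<otimes> x [^] Suc n = x \<otimes> (u \<otimes> x [^] n)"
    using m_lcomm[OF assms(3,2), of "x [^] n"] m_comm[of "x [^] n" x] assms(2,3)
    by simp
  then have "x \<otimes> (u \<otimes> x [^] n) \<in> J" using Suc.prems by simp
  then have "u \<otimes> x [^] n \<in> J" using reg assms(2,3) by simp
  then show ?case by (rule Suc.IH)
qed

text \<open>
This is why the depth of a prime ideal is at most its height. If \<open>x\<close> is the last element of the sequence and \<open>J\<close> is generated by the others, then \<open>x\<close> is regular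
modulo \<open>J\<close>, so \<open>J\<close> contains no product \<open>u x\<^sup>n\<close> with \<open>u \<notin> P\<close>. A prime ideal that contains \<open>J\<close> and avoids
all these products lies strictly below \<open>P\<close>, as it omits \<open>x\<close>, and the shorter sequence is still
regular inside it.
\<close>

lemma regular_sequence_imp_prime_chain:
  assumes "regular_sequence R xs" "primeideal P R" "set xs \<subseteq> P"
  shows "\<exists>p. prime_chain R (length xs) p \<and> p (length xs) = P"
  using assms
proof (induction xs arbitrary: P rule: rev_induct)
  case Nil
  then show ?case by (auto simp: prime_chain_def intro!: exI[of _ "\<lambda>_. P"])
next
  case (snoc x xs)
  interpret P: primeideal P R by (fact snoc.prems(2))
  let ?J = "Idl (set xs)"
  define T where "T = {u \<otimes> x [^] (n::nat) | u n. u \<in> carrier R - P}"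
  have xs: "set xs \<subseteq> carrier R" "x \<in> carrier R" "set xs \<subseteq> P" "x \<in> P"
    using snoc.prems unfolding regular_sequence_def by auto
  have J: "ideal ?J R" using genideal_ideal xs by blast
  have JP: "?J \<subseteq> P" by (rule genideal_minimal[OF P.is_ideal xs(3)])
  have reg: "a \<in> ?J" if "a \<in> carrier R" "x \<otimes> a \<in> ?J" for a
    using snoc.prems(1) that unfolding regular_sequence_def
    by (auto dest!: spec[of _ "length xs"] conjunct2)
  have "?J \<inter> T = {}"
  proof (rule equals0I)
    fix t assume "t \<in> ?J \<inter> T"
    then obtain u n where u: "u \<in> carrier R - P" "u \<otimes> x [^] (n::nat) \<in> ?J"
      unfolding T_def by blast
    have "u \<in> ?J" by (rule regular_mod_power[OF J xs(2) _ reg u(2)]) (use u(1) in auto)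
    then show False using JP u(1) by blast
  qed
  moreover have "\<one> \<in> T"
  proof -
    have "\<one> = \<one> \<otimes> x [^] (0::nat)" using xs(2) by simp
    moreover have "\<one> \<in> carrier R - P" using P.I_notcarr P.one_imp_carrier by auto
    ultimately show ?thesis unfolding T_def by blast
  qed
  moreover have "s \<otimes> t \<in> T" if "s \<in> T" "t \<in> T" for s t
  proof -
    obtain u n u' n' where uv: "s = u \<otimes> x [^] (n::nat)" "t = u' \<otimes> x [^] (n'::nat)"
      "u \<in> carrier R - P" "u' \<in> carrier R - P" using \<open>s \<in> T\<close> \<open>t \<in> T\<close> unfolding T_def by blast
    then have "s \<otimes> t = (u \<otimes> u') \<otimes> x [^] (n + n')"
      using xs(2) by (simp add: nat_pow_mult[symmetric] m_ac)
    moreover have "u \<otimes> u' \<in> carrier R - P" using uv P.I_prime by auto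
    ultimately show ?thesis unfolding T_def by blast
  qed
  ultimately obtain Q where Q: "primeideal Q R" "?J \<subseteq> Q" "Q \<inter> T = {}"
    using prime_ideal_avoiding[OF J] by metis
  interpret Q: primeideal Q R by (fact Q(1))
  have "u \<in> T" if "u \<in> carrier R - P" for u
    unfolding T_def using that by (auto intro!: exI[of _ u] exI[of _ 0])
  then have "Q \<subseteq> P" using Q(3) Q.Icarr by blast
  moreover have "x \<notin> Q"
  proof
    assume "x \<in> Q"
    have "\<one> \<otimes> x [^] (1::nat) \<in> T"
      unfolding T_def using P.I_notcarr P.one_imp_carrier by blast
    then show False using \<open>x \<in> Q\<close> Q(3) xs(2) by auto
  qed
  ultimately have QP: "Q \<subset> P" using xs(4) by blast
  have "set xs \<subseteq> Q" using genideal_self[OF xs(1)] Q(2) by blast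
  moreover have "regular_sequence R xs"
    unfolding regular_sequence_def
  proof (intro conjI allI impI ballI)
    show "Idl (set xs) \<noteq> carrier R"
      using JP P.I_notcarr P.a_subset by blast
    fix i a assume "i < length xs" "a \<in> carrier R" "xs ! i \<otimes> a \<in> Idl (set (take i xs))"
    then show "a \<in> Idl (set (take i xs))"
      using snoc.prems(1) unfolding regular_sequence_def
      by (auto simp: nth_append dest!: spec[of _ i] conjunct2)
  qed (use xs in auto)
  ultimately obtain p where p: "prime_chain R (length xs) p" "p (length xs) = Q"
    using snoc.IH Q(1) by blast
  show ?case
  proof (intro exI conjI)
    let ?p = "p(Suc (length xs) := P)"
    show "prime_chain R (length (xs @ [x])) ?p"
      using p QP snoc.prems(2) unfolding prime_chain_def
      by (auto simp: le_Suc_eq less_Suc_eq)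
    show "?p (length (xs @ [x])) = P" by simp
  qed
qed

lemma depth_le_height:
  assumes "primeideal P R" shows "depth R P \<le> height R P"
  unfolding depth_def height_def
  by (rule Sup_mono) (use regular_sequence_imp_prime_chain[OF _ assms] in blast)

end

section \<open>Isomorphic modules\<close>

locale module_isomorphism = M: module R M for R (structure) and M +
  fixes N :: "('a, 'c, 'n) module_scheme" and f :: "_ \<Rightarrow> 'c"
  assumes bij: "bij_betw f (carrier M) (carrier N)"
    and hom_add: "\<And>x y. x \<in> carrier M \<Longrightarrow> y \<in> carrier M \<Longrightarrow> f (x \<oplus>\<^bsub>M\<^esub> y) = f x \<oplus>\<^bsub>N\<^esub> f y"
    and hom_smult: "\<And>r x. r \<in> carrier R \<Longrightarrow> x \<in> carrier M \<Longrightarrow> f (r \<odot>\<^bsub>M\<^esub> x) = r \<odot>\<^bsub>N\<^esub> f x"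
    and hom_zero: "f \<zero>\<^bsub>M\<^esub> = \<zero>\<^bsub>N\<^esub>"
begin

lemma surj: "carrier N = f ` carrier M"
  using bij by (simp add: bij_betw_def)

lemma module_N: "module R N"
proof (rule moduleI[OF M.R.is_cring abelian_groupI])
  show "\<exists>y\<in>carrier N. y \<oplus>\<^bsub>N\<^esub> x = \<zero>\<^bsub>N\<^esub>" if x: "x \<in> carrier N" for x
  proof -
    obtain a where a: "a \<in> carrier M" "x = f a" using x surj by blast
    have "f (\<ominus>\<^bsub>M\<^esub> a) \<oplus>\<^bsub>N\<^esub> x = \<zero>\<^bsub>N\<^esub>"
      unfolding a(2) using a(1) hom_add[symmetric] hom_zero M.M.l_neg by simp
    moreover have "f (\<ominus>\<^bsub>M\<^esub> a) \<in> carrier N" using a(1) surj by simp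
    ultimately show ?thesis by blast
  qed
qed (auto simp: surj hom_zero[symmetric] M.smult_l_distr M.smult_r_distr M.smult_assoc1
    M.M.a_ac hom_add[symmetric] hom_smult[symmetric] intro!: imageI)

lemma submodule_vimage:
  assumes "submodule K R N" shows "submodule {x \<in> carrier M. f x \<in> K} R M"
proof -
  interpret N: module R N by (rule module_N)
  note K = N.submoduleE[OF assms]
  have zero: "\<zero>\<^bsub>N\<^esub> \<in> K" using submodule.axioms(1)[OF assms] subgroup.one_closed by fastforce
  have inv: "f (\<ominus>\<^bsub>M\<^esub> x) = \<ominus>\<^bsub>N\<^esub> f x" if x: "x \<in> carrier M" for x
  proof (rule N.M.minus_equality[symmetric])
    show "f (\<ominus>\<^bsub>M\<^esub> x) \<oplus>\<^bsub>N\<^esub> f x = \<zero>\<^bsub>N\<^esub>"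
      using x hom_add[symmetric] hom_zero M.M.l_neg by simp
  qed (use x surj in auto)
  show ?thesis
    by (rule M.submoduleI) (use K zero inv in \<open>auto simp: hom_zero hom_add hom_smult\<close>)
qed

lemma generates_image:
  assumes "generates_module R M G" shows "generates_module R N (f ` G)"
  unfolding generates_module_def
proof (intro conjI allI impI)
  have G: "G \<subseteq> carrier M" "\<And>K. submodule K R M \<Longrightarrow> G \<subseteq> K \<Longrightarrow> K = carrier M"
    using assms unfolding generates_module_def by auto
  then show "f ` G \<subseteq> carrier N" using surj by auto
  fix K assume K: "submodule K R N \<and> f ` G \<subseteq> K"
  have "{x \<in> carrier M. f x \<in> K} = carrier M"
    by (rule G(2)) (use K G(1) submodule_vimage in auto)
  then have "carrier N \<subseteq> K" using surj by auto
  moreover have "K \<subseteq> carrier N" using K module.submoduleE(1)[OF module_N] by blast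
  ultimately show "K = carrier N" by blast
qed

lemma module_isomorphism_inverse:
  "module_isomorphism R N M (inv_into (carrier M) f)"
proof -
  interpret N: module R N by (rule module_N)
  let ?g = "inv_into (carrier M) f"
  have inj: "inj_on f (carrier M)" using bij by (simp add: bij_betw_def)
  have g: "?g y \<in> carrier M" "f (?g y) = y" if "y \<in> carrier N" for y
    using that surj by (auto intro: inv_into_into f_inv_into_f)
  show ?thesis
  proof (intro module_isomorphism.intro module_isomorphism_axioms.intro module_N)
    show "bij_betw ?g (carrier N) (carrier M)" by (rule bij_betw_inv_into[OF bij])
    show "?g \<zero>\<^bsub>N\<^esub> = \<zero>\<^bsub>M\<^esub>"
      by (rule inj_onD[OF inj]) (use g hom_zero in auto)
    show "?g (x \<oplus>\<^bsub>N\<^esub> y) = ?g x \<oplus>\<^bsub>M\<^esub> ?g y" if "x \<in> carrier N" "y \<in> carrier N" for x y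
      by (rule inj_onD[OF inj]) (use that g hom_add in auto)
    show "?g (r \<odot>\<^bsub>N\<^esub> x) = r \<odot>\<^bsub>M\<^esub> ?g x" if "r \<in> carrier R" "x \<in> carrier N" for r x
      by (rule inj_onD[OF inj]) (use that g hom_smult in auto)
  qed
qed

lemma min_num_generators_le: "min_num_generators R N \<le> min_num_generators R M"
  unfolding min_num_generators_def
proof (rule Inf_greatest)
  fix n assume "n \<in> {enat (card G) |G. finite G \<and> generates_module R M G}"
  then obtain G where G: "n = enat (card G)" "finite G" "generates_module R M G" by blast
  have "enat (card (f ` G)) \<in> {enat (card G) |G. finite G \<and> generates_module R N G}"
    using G(2) generates_image[OF G(3)] by blast
  moreover have "enat (card (f ` G)) \<le> n" using G(1) card_image_le[OF G(2)] by simp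
  ultimately show "Inf {enat (card G) |G. finite G \<and> generates_module R N G} \<le> n"
    by (meson Inf_lower2)
qed

lemma min_num_generators_eq: "min_num_generators R N = min_num_generators R M"
  using min_num_generators_le module_isomorphism.min_num_generators_le[OF module_isomorphism_inverse]
  by (rule antisym)

lemma trace_ideal_le: "trace_ideal R M \<subseteq> trace_ideal R N"
proof -
  interpret I: module_isomorphism R N M "inv_into (carrier M) f"
    by (rule module_isomorphism_inverse)
  let ?g = "inv_into (carrier M) f"
  have "\<exists>\<psi>\<in>linear_forms R N. \<phi> x \<in> \<psi> ` carrier N"
    if \<phi>: "\<phi> \<in> linear_forms R M" and x: "x \<in> carrier M" for \<phi> x
  proof (intro bexI[of _ "\<phi> \<circ> ?g"] image_eqI)
    show "\<phi> x = (\<phi> \<circ> ?g) (f x)"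
      using bij x by (simp add: bij_betw_inv_into_left)
    show "f x \<in> carrier N" using x surj by simp
    have g: "?g y \<in> carrier M" if "y \<in> carrier N" for y
      using that inv_into_into[of y f "carrier M"] surj by simp
    show "\<phi> \<circ> ?g \<in> linear_forms R N"
      using \<phi> unfolding linear_forms_def by (auto simp: I.hom_add I.hom_smult g Pi_iff)
  qed
  then have "(\<Union>\<phi>\<in>linear_forms R M. \<phi> ` carrier M) \<subseteq> (\<Union>\<phi>\<in>linear_forms R N. \<phi> ` carrier N)"
    by fast
  then show ?thesis unfolding trace_ideal_def genideal_def by blast
qed

end

section \<open>Laurent polynomials\<close>

abbreviation supp :: "'k::field laurent \<Rightarrow> expo set" where
  "supp \<equiv> Poly_Mapping.keys"

abbreviation coef :: "'k::field laurent \<Rightarrow> expo \<Rightarrow> 'k" where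
  "coef \<equiv> Poly_Mapping.lookup"

abbreviation mon :: "expo \<Rightarrow> 'k::field laurent" where
  "mon a \<equiv> Poly_Mapping.single a 1"

abbreviation const :: "'k::field \<Rightarrow> 'k laurent" where
  "const c \<equiv> Poly_Mapping.single 0 c"

lemma coef_const_mult: "coef (const c * f) a = c * coef f a"
  by (simp add: mult_map_scale_conv_mult[symmetric] Poly_Mapping.map.rep_eq when_def)

lemma coef_mon_mult: "coef (mon s * f) (s + a) = coef f a"
proof -
  have "coef (mon s * f) (s + a)
      = (\<Sum>l. (1 when s = l) * (\<Sum>q. coef f q when s + a = l + q))"
    by (simp add: lookup_mult lookup_single)
  also have "\<dots> = (\<Sum>l. (\<Sum>q. coef f q when s + a = l + q) when s = l)"
    by (simp add: when_mult)
  also have "\<dots> = (\<Sum>q. coef f q when a = q)" by simp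
  finally show ?thesis by simp
qed

lemma coef_mon_mult': "coef (mon s * f) a = coef f (a - s)"
  using coef_mon_mult[of s f "a - s"] by simp

lemma supp_mult: "supp (f * g) \<subseteq> {a + b | a b. a \<in> supp f \<and> b \<in> supp g}"
  by (rule keys_mult)

lemma laurent_sum_monomials: "f = (\<Sum>a\<in>supp f. const (coef f a) * mon a)"
  by (rule poly_mapping_eqI)
    (simp add: lookup_sum mult_single lookup_single when_def in_keys_iff)

lemma laurent_induct [consumes 1, case_names mon const add zero]:
  assumes "supp f \<subseteq> A"
    and "\<And>a. a \<in> A \<Longrightarrow> P (mon a)"
    and "\<And>c g. supp g \<subseteq> A \<Longrightarrow> P g \<Longrightarrow> P (const c * g)"
    and "\<And>g h. P g \<Longrightarrow> P h \<Longrightarrow> P (g + h)" and "P 0"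
  shows "P f"
proof -
  have "P (\<Sum>a\<in>B. const (coef f a) * mon a)" if "B \<subseteq> A" "finite B" for B
    using that(2,1) by induction (auto intro!: assms)
  from this[OF assms(1)] show ?thesis using laurent_sum_monomials[of f] by simp
qed

interpretation laurent: vector_space "\<lambda>c f. const c * f :: 'k::field laurent"
  by unfold_locales
    (simp_all add: algebra_simps mult_single single_add flip: mult.assoc)

lemma supp_subset_iff_in_span:
  assumes "finite A"
  shows "supp f \<subseteq> A \<Longrightarrow> f \<in> laurent.span (mon ` A)"
  by (induction rule: laurent_induct)
    (auto intro: laurent.span_base laurent.span_scale laurent.span_add laurent.span_zero)

lemma (in vector_space) linear_relation_if_card_greater:
  assumes "finite I" "finite B" "card B < card I" "v ` I \<subseteq> span B"
  obtains c i where "i \<in> I" "c i \<noteq> 0" "(\<Sum>i\<in>I. scale (c i) (v i)) = 0"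
proof (cases "inj_on v I")
  case True
  have "\<not> independent (v ` I)"
    using independent_span_bound[OF assms(2) _ assms(4)] card_image[OF True] assms(3) by auto
  then obtain u i where "i \<in> I" "u (v i) \<noteq> 0" "(\<Sum>w\<in>v ` I. scale (u w) w) = 0"
    using dependent_finite[of "v ` I"] assms(1) by auto
  then show ?thesis
    using that[of i "u \<circ> v"] by (simp add: sum.reindex[OF True])
next
  case False
  then obtain i j where ij: "i \<in> I" "j \<in> I" "i \<noteq> j" "v i = v j"
    unfolding inj_on_def by blast
  let ?c = "\<lambda>x. (if x = i then 1 else 0) - (if x = j then 1 else 0)"
  have "(\<Sum>x\<in>I. scale (?c x) (v x))
      = (\<Sum>x\<in>I. (if x = i then v x else 0)) - (\<Sum>x\<in>I. (if x = j then v x else 0))"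
    unfolding sum_subtractf[symmetric] by (rule sum.cong) (auto simp: scale_left_diff_distrib)
  also have "\<dots> = 0" using ij assms(1) by simp
  finally show ?thesis using that[of i ?c] ij by simp
qed

section \<open>Semigroup rings\<close>

lemma semigroup_ring_simps [simp]:
  "carrier (semigroup_ring S) = {f. supp f \<subseteq> S}"
  "f \<otimes>\<^bsub>semigroup_ring S\<^esub> g = f * g" "f \<oplus>\<^bsub>semigroup_ring S\<^esub> g = f + g"
  "\<one>\<^bsub>semigroup_ring S\<^esub> = 1" "\<zero>\<^bsub>semigroup_ring S\<^esub> = 0"
  by (simp_all add: semigroup_ring_def)

locale expo_monoid =
  fixes S :: "expo set"
  assumes zero_in: "0 \<in> S" and add_in: "a \<in> S \<Longrightarrow> b \<in> S \<Longrightarrow> a + b \<in> S"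
begin

lemma supp_zero_in: "supp 0 \<subseteq> S" by simp

lemma supp_one_in: "supp (1 :: 'k::field laurent) \<subseteq> S" using zero_in by simp

lemma supp_add_in: "supp f \<subseteq> S \<Longrightarrow> supp g \<subseteq> S \<Longrightarrow> supp (f + g) \<subseteq> S"
  using Poly_Mapping.keys_add[of f g] by blast

lemma supp_mult_in: "supp f \<subseteq> S \<Longrightarrow> supp g \<subseteq> S \<Longrightarrow> supp (f * g) \<subseteq> S"
  using supp_mult[of f g] add_in by blast

lemma supp_uminus_in: "supp f \<subseteq> S \<Longrightarrow> supp (- f) \<subseteq> S"
  by (simp add: keys_def)

lemma supp_diff_in: "supp f \<subseteq> S \<Longrightarrow> supp g \<subseteq> S \<Longrightarrow> supp (f - g) \<subseteq> S"
  using supp_add_in[of f "- g"] supp_uminus_in[of g] by simp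

lemma supp_const_in: "supp (const c) \<subseteq> S" using zero_in by simp

lemma supp_mon_in: "a \<in> S \<Longrightarrow> supp (mon a :: 'k::field laurent) \<subseteq> S" by simp

lemma supp_sum_in: "(\<And>i. i \<in> I \<Longrightarrow> supp (f i) \<subseteq> S) \<Longrightarrow> supp (sum f I) \<subseteq> S"
  by (induction I rule: infinite_finite_induct) (simp_all add: supp_add_in)

lemma supp_power_in: "supp f \<subseteq> S \<Longrightarrow> supp (f ^ n) \<subseteq> S"
proof (induction n)
  case 0 show ?case using supp_one_in by simp
next
  case (Suc n)
  then show ?case using supp_mult_in by simp
qed

lemmas supp_in = supp_zero_in supp_one_in supp_add_in supp_mult_in supp_uminus_in supp_diff_in
  supp_const_in supp_mon_in supp_sum_in supp_power_in

lemma cring_semigroup_ring: "cring (semigroup_ring S :: 'k::field laurent ring)"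
proof (rule cringI)
  show "abelian_group (semigroup_ring S :: 'k laurent ring)"
  proof (rule abelian_groupI)
    fix f :: "'k laurent" assume "f \<in> carrier (semigroup_ring S)"
    then show "\<exists>g\<in>carrier (semigroup_ring S). g \<oplus>\<^bsub>semigroup_ring S\<^esub> f = \<zero>\<^bsub>semigroup_ring S\<^esub>"
      by (intro bexI[of _ "- f"]) (simp_all add: supp_uminus_in)
  qed (simp_all add: supp_in algebra_simps)
  show "comm_monoid (semigroup_ring S :: 'k laurent ring)"
    by (rule comm_monoidI) (simp_all add: supp_in algebra_simps zero_in)
qed (simp_all add: algebra_simps)

lemma ideal_semigroup_ring_iff:
  "ideal P (semigroup_ring S :: 'k::field laurent ring) \<longleftrightarrow>
     (\<forall>f\<in>P. supp f \<subseteq> S) \<and> 0 \<in> P \<and> (\<forall>f\<in>P. \<forall>g\<in>P. f + g \<in> P) \<and>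
     (\<forall>r f. supp r \<subseteq> S \<longrightarrow> f \<in> P \<longrightarrow> r * f \<in> P)" (is "?l \<longleftrightarrow> ?r")
proof
  assume ?l
  then interpret P: ideal P "semigroup_ring S :: 'k laurent ring" .
  show ?r
  proof (intro conjI ballI allI impI)
    show "supp f \<subseteq> S" if "f \<in> P" for f using P.Icarr[OF that] by simp
    show "0 \<in> P" using additive_subgroup.zero_closed[OF P.additive_subgroup_axioms] by simp
    show "f + g \<in> P" if "f \<in> P" "g \<in> P" for f g
      using additive_subgroup.a_closed[OF P.additive_subgroup_axioms that] by simp
    show "r * f \<in> P" if "supp r \<subseteq> S" "f \<in> P" for r f
      using P.I_l_closed[OF that(2), of r] that(1) by simp
  qed
next
  interpret R: cring "semigroup_ring S :: 'k laurent ring" by (rule cring_semigroup_ring)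
  assume r: ?r
  have inv: "\<ominus>\<^bsub>semigroup_ring S\<^esub> f = - f" if "supp f \<subseteq> S" for f :: "'k laurent"
  proof (rule R.minus_equality)
    show "- f \<in> carrier (semigroup_ring S)" using supp_uminus_in[OF that] by simp
  qed (use that in simp_all)
  have neg: "- f \<in> P" if "f \<in> P" for f
  proof -
    have "supp (- 1 :: 'k laurent) \<subseteq> S" by (rule supp_uminus_in[OF supp_one_in])
    then have "(- 1) * f \<in> P" using r that by blast
    then show ?thesis by simp
  qed
  show ?l
  proof (rule idealI[OF R.ring_axioms])
    show "subgroup P (add_monoid (semigroup_ring S))"
    proof (rule R.add.subgroupI)
      show "\<ominus>\<^bsub>semigroup_ring S\<^esub> f \<in> P" if f: "f \<in> P" for f
        using inv[of f] neg[OF f] r f by simp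
      show "f \<oplus>\<^bsub>semigroup_ring S\<^esub> g \<in> P" if "f \<in> P" "g \<in> P" for f g
        using r that by simp
      show "P \<subseteq> carrier (semigroup_ring S)" using r by auto
      show "P \<noteq> {}" using r by blast
    qed
    show "g \<otimes>\<^bsub>semigroup_ring S\<^esub> f \<in> P" "f \<otimes>\<^bsub>semigroup_ring S\<^esub> g \<in> P"
      if "f \<in> P" "g \<in> carrier (semigroup_ring S)" for f g
      using r that by (simp_all add: mult.commute[of f g])
  qed
qed

end

lemma ideal_semigroup_ringD:
  assumes "expo_monoid S" "ideal P (semigroup_ring S :: 'k::field laurent ring)"
  shows "f \<in> P \<Longrightarrow> supp f \<subseteq> S" "0 \<in> P" "f \<in> P \<Longrightarrow> g \<in> P \<Longrightarrow> f + g \<in> P"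
    "supp r \<subseteq> S \<Longrightarrow> f \<in> P \<Longrightarrow> r * f \<in> P" "supp r \<subseteq> S \<Longrightarrow> f \<in> P \<Longrightarrow> f * r \<in> P"
    "f \<in> P \<Longrightarrow> - f \<in> P" "f \<in> P \<Longrightarrow> g \<in> P \<Longrightarrow> f - g \<in> P"
    "(\<And>i. i \<in> I \<Longrightarrow> h i \<in> P) \<Longrightarrow> sum h I \<in> P"
proof -
  interpret expo_monoid S by fact
  note * = assms(2)[unfolded ideal_semigroup_ring_iff]
  show "f \<in> P \<Longrightarrow> supp f \<subseteq> S" "0 \<in> P" and a: "f \<in> P \<Longrightarrow> g \<in> P \<Longrightarrow> f + g \<in> P" for f g
    using * by blast+
  show m: "supp r \<subseteq> S \<Longrightarrow> f \<in> P \<Longrightarrow> r * f \<in> P" for f r using * by blast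
  show "supp r \<subseteq> S \<Longrightarrow> f \<in> P \<Longrightarrow> f * r \<in> P" using m[of r f] by (simp add: mult.commute)
  have n: "- f \<in> P" if "f \<in> P" for f
    using m[OF supp_uminus_in[OF supp_one_in] that] by simp
  then show "f \<in> P \<Longrightarrow> - f \<in> P" .
  show "f \<in> P \<Longrightarrow> g \<in> P \<Longrightarrow> f - g \<in> P" using a[OF _ n] by fastforce
  show "(\<And>i. i \<in> I \<Longrightarrow> h i \<in> P) \<Longrightarrow> sum h I \<in> P"
    by (induction I rule: infinite_finite_induct) (use * in auto)
qed

section \<open>Dimension of plane semigroup rings\<close>

definition pt :: "int \<Rightarrow> int \<Rightarrow> expo" where
  "pt x y = Poly_Mapping.single 0 x + Poly_Mapping.single 1 y"

lemma lookup_pt: "Poly_Mapping.lookup (pt x y) i = (if i = 0 then x else if i = 1 then y else 0)"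
  by (auto simp: pt_def lookup_add lookup_single when_def)

lemma pt_eq_iff [simp]: "pt x y = pt x' y' \<longleftrightarrow> x = x' \<and> y = y'"
  by (metis lookup_pt zero_neq_one)

lemma pt_add [simp]: "pt x y + pt x' y' = pt (x + x') (y + y')"
  by (rule poly_mapping_eqI) (simp add: lookup_pt lookup_add)

lemma pt_diff [simp]: "pt x y - pt x' y' = pt (x - x') (y - y')"
  by (rule poly_mapping_eqI) (simp add: lookup_pt lookup_minus)

lemma pt_uminus [simp]: "- pt x y = pt (- x) (- y)"
  by (rule poly_mapping_eqI) (simp add: lookup_pt)

lemma pt_zero: "pt 0 0 = 0" by (simp add: pt_def)

lemma pt_eq_0_iff [simp]: "pt x y = 0 \<longleftrightarrow> x = 0 \<and> y = 0"
  using pt_eq_iff[of x y 0 0] by (simp add: pt_zero)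

lemma nonneg_vectors_2: "nonneg_vectors 2 = {pt x y | x y. 0 \<le> x \<and> 0 \<le> y}"
proof (intro equalityI subsetI)
  fix a assume a: "a \<in> nonneg_vectors 2"
  have "a = pt (Poly_Mapping.lookup a 0) (Poly_Mapping.lookup a 1)"
  proof (rule poly_mapping_eqI)
    fix i show "Poly_Mapping.lookup a i
        = Poly_Mapping.lookup (pt (Poly_Mapping.lookup a 0) (Poly_Mapping.lookup a 1)) i"
      using a by (cases "i \<in> Poly_Mapping.keys a")
        (auto simp: nonneg_vectors_def lookup_pt in_keys_iff less_2_cases_iff)
  qed
  then show "a \<in> {pt x y | x y. 0 \<le> x \<and> 0 \<le> y}" using a
    by (auto simp: nonneg_vectors_def)
next
  fix a assume "a \<in> {pt x y | x y. 0 \<le> x \<and> 0 \<le> y}"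
  then show "a \<in> nonneg_vectors 2"
    by (auto simp: nonneg_vectors_def lookup_pt in_keys_iff split: if_splits)
qed

definition box :: "nat \<Rightarrow> expo set" where
  "box c = (\<lambda>(x, y). pt x y) ` ({0..int c} \<times> {0..int c})"

lemma box_mono: "b \<le> c \<Longrightarrow> box b \<subseteq> box c"
  unfolding box_def by (intro image_mono Sigma_mono) auto

lemma card_box: "finite (box c)" "card (box c) \<le> (c + 1) ^ 2"
proof -
  show "finite (box c)" by (simp add: box_def)
  show "card (box c) \<le> (c + 1) ^ 2"
    unfolding box_def by (rule order.trans[OF card_image_le])
      (simp_all add: power2_eq_square nat_add_distrib)
qed

lemma box_add: "a \<in> box b \<Longrightarrow> a' \<in> box c \<Longrightarrow> a + a' \<in> box (b + c)"
  unfolding box_def by fastforce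

lemma supp_mult_box: "supp f \<subseteq> box b \<Longrightarrow> supp g \<subseteq> box c \<Longrightarrow> supp (f * g) \<subseteq> box (b + c)"
  using supp_mult[of f g] box_add by blast

lemma supp_power_box: "supp f \<subseteq> box b \<Longrightarrow> supp (f ^ n) \<subseteq> box (n * b)"
proof (induction n)
  case 0 show ?case by (auto simp: box_def pt_zero[symmetric])
next
  case (Suc n) then show ?case using supp_mult_box[of f b "f ^ n" "n * b"] by simp
qed

lemma supp_subset_box:
  assumes "supp f \<subseteq> nonneg_vectors 2"
  obtains b where "supp f \<subseteq> box b"
proof -
  have "\<exists>b. A \<subseteq> box b" if "finite A" "A \<subseteq> nonneg_vectors 2" for A
    using that
  proof induction
    case (insert a A)
    then obtain b x y where b: "A \<subseteq> box b" "a = pt x y" "0 \<le> x" "0 \<le> y"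
      by (auto simp: nonneg_vectors_2)
    then have "a \<in> box (nat (max x y))" by (auto simp: box_def)
    then have "insert a A \<subseteq> box (max b (nat (max x y)))"
      using b(1) box_mono[of b "max b (nat (max x y))"]
        box_mono[of "nat (max x y)" "max b (nat (max x y))"] by auto
    then show ?case by blast
  qed auto
  then show ?thesis using assms that by (meson finite_keys)
qed

text \<open>
There are \<open>N\<^sup>3\<close> monomials of degree below \<open>N\<close> in each of three given polynomials, whereas their
supports all lie in a square with \<open>O(N\<^sup>2)\<close> lattice points. The relation is written in nested form,
ready to be taken apart one variable at a time.
\<close>

lemma algebraic_relation:
  fixes f g h :: "'k::field laurent"
  assumes "supp f \<subseteq> nonneg_vectors 2" "supp g \<subseteq> nonneg_vectors 2" "supp h \<subseteq> nonneg_vectors 2"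
  obtains N c i j l where "i < N" "j < N" "l < N" "c i j l \<noteq> (0::'k)"
    "(\<Sum>i<N. f ^ i * (\<Sum>j<N. g ^ j * (\<Sum>l<N. h ^ l * const (c i j l)))) = 0"
proof -
  obtain b1 b2 b3 where b: "supp f \<subseteq> box b1" "supp g \<subseteq> box b2" "supp h \<subseteq> box b3"
    using assms supp_subset_box by metis
  define b where "b = max b1 (max b2 b3)"
  have bb: "supp f \<subseteq> box b" "supp g \<subseteq> box b" "supp h \<subseteq> box b"
    using b box_mono[of b1 b] box_mono[of b2 b] box_mono[of b3 b]
    unfolding b_def by (meson max.cobounded1 max.cobounded2 order_trans)+
  \<comment> \<open>The least \<open>N\<close> for which the crude bound \<open>(3 N b + 1)\<^sup>2 \<le> N\<^sup>2 (3 b + 1)\<^sup>2\<close> drops below \<open>N\<^sup>3\<close>.\<close>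
  define N where "N = (3 * b + 1) ^ 2 + 1"
  define v where "v = (\<lambda>(i, j, l). f ^ i * (g ^ j * h ^ l))"
  let ?I = "{..<N} \<times> {..<N} \<times> {..<N}" and ?B = "mon ` box (3 * N * b) :: 'k laurent set"
  have "supp (v t) \<subseteq> box (3 * N * b)" if "t \<in> ?I" for t
  proof -
    obtain i j l where t: "t = (i, j, l)" "i < N" "j < N" "l < N"
      using \<open>t \<in> ?I\<close> by auto
    have "supp (v t) \<subseteq> box (i * b + (j * b + l * b))"
      unfolding t v_def prod.case by (intro supp_mult_box supp_power_box bb)
    moreover have "i * b + (j * b + l * b) \<le> 3 * N * b"
    proof -
      have "(i + j + l) * b \<le> (3 * N) * b" using t by (intro mult_right_mono) auto
      then show ?thesis by (simp add: algebra_simps)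
    qed
    ultimately show ?thesis using box_mono by blast
  qed
  then have span: "v ` ?I \<subseteq> laurent.span ?B"
    using supp_subset_iff_in_span[OF card_box(1)] by blast
  have "card ?B \<le> (3 * N * b + 1) ^ 2"
    using card_image_le[OF card_box(1)] card_box(2) le_trans by blast
  also have "\<dots> \<le> (N * (3 * b + 1)) ^ 2"
    by (intro power_mono) (auto simp: N_def algebra_simps)
  also have "\<dots> < N ^ 3"
  proof -
    have "N ^ 2 * (3 * b + 1) ^ 2 < N ^ 2 * N" by (rule mult_strict_left_mono) (auto simp: N_def)
    then show ?thesis by (simp add: power2_eq_square power3_eq_cube algebra_simps)
  qed
  also have "\<dots> = card ?I" by (simp add: power3_eq_cube)
  finally have "card ?B < card ?I" .
  have "finite ?I" "finite ?B" using card_box(1) by simp_all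
  then obtain c t where c: "t \<in> ?I" "c t \<noteq> 0" "(\<Sum>t\<in>?I. const (c t) * v t) = 0"
    by (rule laurent.linear_relation_if_card_greater[OF _ _ \<open>card ?B < card ?I\<close> span])
  have "(\<Sum>t\<in>?I. const (c t) * v t)
      = (\<Sum>i<N. \<Sum>j<N. \<Sum>l<N. const (c (i, j, l)) * (f ^ i * (g ^ j * h ^ l)))"
    unfolding sum.cartesian_product v_def by (rule sum.cong) auto
  also have "\<dots> = (\<Sum>i<N. f ^ i * (\<Sum>j<N. g ^ j * (\<Sum>l<N. h ^ l * const (c (i, j, l)))))"
    by (simp add: sum_distrib_left mult.commute mult.left_commute mult.assoc)
  finally have rel: "(\<Sum>i<N. f ^ i * (\<Sum>j<N. g ^ j * (\<Sum>l<N. h ^ l * const (c (i, j, l))))) = 0"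
    using c(3) by simp
  obtain i j l where "t = (i, j, l)" by (cases t)
  then show ?thesis using that[of i N j l "\<lambda>i j l. c (i, j, l)"] c(1,2) rel by simp
qed

lemma least_index:
  assumes "i < (n::nat)" "P i"
  obtains k where "k < n" "P k" "\<And>j. j < k \<Longrightarrow> \<not> P j"
  by (metis assms LeastI Least_le le_less_trans not_less_Least)

context expo_monoid begin

text \<open>
In a relation \<open>a\<^sub>0 + f a\<^sub>1 + f\<^sup>2 a\<^sub>2 + \<dots> \<in> Q\<close> a common power of \<open>f\<close> can be cancelled, because \<open>f\<close> is
regular modulo \<open>Q\<close>; what is left of the first nonzero coefficient lies in every ideal above \<open>Q\<close> that
contains \<open>f\<close>.
\<close>

lemma lowest_coefficient_in:
  assumes Q: "\<And>x. supp x \<subseteq> S \<Longrightarrow> f * x \<in> Q \<Longrightarrow> x \<in> Q" and QQ': "Q \<subseteq> Q'"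
    and Q': "ideal Q' (semigroup_ring S :: 'k::field laurent ring)" and f: "f \<in> Q'"
    and a: "\<And>i. supp (a i) \<subseteq> S" and "(\<Sum>i<N. f ^ i * a i) \<in> Q"
    and "i0 < N" "\<And>i. i < i0 \<Longrightarrow> a i = 0"
  shows "a i0 \<in> Q'"
  using a assms(6-8)
proof (induction i0 arbitrary: N a)
  case 0
  note I = ideal_semigroup_ringD[OF expo_monoid_axioms Q']
  obtain M where N: "N = Suc M" using 0 by (cases N) auto
  have "(\<Sum>i<N. f ^ i * a i) = a 0 + (\<Sum>i<M. f * (f ^ i * a (Suc i)))"
    unfolding N sum.lessThan_Suc_shift by (simp add: mult.assoc)
  then have "a 0 = (\<Sum>i<N. f ^ i * a i) - f * (\<Sum>i<M. f ^ i * a (Suc i))"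
    by (simp add: sum_distrib_left)
  moreover have "supp (\<Sum>i<M. f ^ i * a (Suc i)) \<subseteq> S"
    by (intro supp_sum_in supp_mult_in supp_power_in I(1)[OF f] 0(1))
  then have "f * (\<Sum>i<M. f ^ i * a (Suc i)) \<in> Q'" by (rule I(5)[OF _ f])
  moreover have "(\<Sum>i<N. f ^ i * a i) \<in> Q'" using 0(2) QQ' by blast
  ultimately show ?case using I(7) by simp
next
  case (Suc i0)
  note I = ideal_semigroup_ringD[OF expo_monoid_axioms Q']
  obtain M where N: "N = Suc M" using Suc.prems by (cases N) auto
  have "(\<Sum>i<N. f ^ i * a i) = f * (\<Sum>i<M. f ^ i * a (Suc i))"
    unfolding N sum.lessThan_Suc_shift using Suc.prems(4)[of 0]
    by (simp add: mult.assoc sum_distrib_left)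
  then have "f * (\<Sum>i<M. f ^ i * a (Suc i)) \<in> Q" using Suc.prems(2) by simp
  then have "(\<Sum>i<M. f ^ i * a (Suc i)) \<in> Q"
    by (rule Q[rotated]) (intro supp_sum_in supp_mult_in supp_power_in I(1)[OF f] Suc.prems(1))
  then show ?case
    using Suc.IH[of "\<lambda>i. a (Suc i)" M] Suc.prems(1,3,4) N by simp
qed

text \<open>
Elements \<open>f\<close>, \<open>g\<close>, \<open>h\<close> chosen in the three steps of a chain of length 3 would be algebraically
independent: going up the chain, the lowest coefficients of a relation turn into a relation for \<open>g\<close>
and \<open>h\<close>, then for \<open>h\<close> alone, and finally into a nonzero constant in a proper ideal.
\<close>

lemma prime_chain_length_le_2:
  assumes S: "S \<subseteq> nonneg_vectors 2"
    and chain: "prime_chain (semigroup_ring S :: 'k::field laurent ring) n p"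
  shows "n \<le> 2"
proof (rule ccontr)
  assume "\<not> n \<le> 2"
  then have pr: "\<And>i. i \<le> 3 \<Longrightarrow> primeideal (p i) (semigroup_ring S :: 'k laurent ring)"
    and sub: "\<And>i. i < 3 \<Longrightarrow> p i \<subset> p (Suc i)"
    using chain unfolding prime_chain_def by auto
  have idl: "ideal (p i) (semigroup_ring S :: 'k laurent ring)" if "i \<le> 3" for i
    using pr[OF that] primeideal.axioms(1) by blast
  have canc: "x \<in> p i" if "i \<le> 3" "f \<notin> p i" "supp f \<subseteq> S" "supp x \<subseteq> S" "f * x \<in> p i" for i f x
    using primeideal.I_prime[OF pr[OF that(1)], of f x] that by auto
  obtain f g h where fgh: "f \<in> p 1" "f \<notin> p 0" "g \<in> p 2" "g \<notin> p 1" "h \<in> p 3" "h \<notin> p 2"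
    using sub[of 0] sub[of 1] sub[of 2] by (auto simp: numeral_eq_Suc)
  have s: "supp f \<subseteq> S" "supp g \<subseteq> S" "supp h \<subseteq> S"
    using ideal_semigroup_ringD(1)[OF expo_monoid_axioms idl[of 1]] fgh
      ideal_semigroup_ringD(1)[OF expo_monoid_axioms idl[of 2]]
      ideal_semigroup_ringD(1)[OF expo_monoid_axioms idl[of 3]] by simp_all
  obtain N c i j l where c: "i < N" "j < N" "l < N" "c i j l \<noteq> (0::'k)"
    "(\<Sum>i<N. f ^ i * (\<Sum>j<N. g ^ j * (\<Sum>l<N. h ^ l * const (c i j l)))) = 0"
    by (rule algebraic_relation[OF s[THEN order_trans[OF _ S]]])
  have "\<exists>j<N. \<exists>l<N. c i j l \<noteq> 0" using c by blast
  with c(1) obtain i0 where i0: "i0 < N" "\<exists>j<N. \<exists>l<N. c i0 j l \<noteq> 0"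
    and i0_min: "\<And>i. i < i0 \<Longrightarrow> \<not> (\<exists>j<N. \<exists>l<N. c i j l \<noteq> 0)"
    by (rule least_index) metis
  obtain j where "j < N" "\<exists>l<N. c i0 j l \<noteq> 0" using i0 by blast
  then obtain j0 where j0: "j0 < N" "\<exists>l<N. c i0 j0 l \<noteq> 0"
    and j0_min: "\<And>j. j < j0 \<Longrightarrow> \<not> (\<exists>l<N. c i0 j l \<noteq> 0)"
    by (rule least_index) metis
  obtain l where "l < N" "c i0 j0 l \<noteq> 0" using j0 by blast
  then obtain l0 where l0: "l0 < N" "c i0 j0 l0 \<noteq> 0" and l0_min: "\<And>l. l < l0 \<Longrightarrow> \<not> c i0 j0 l \<noteq> 0"
    by (rule least_index) metis
  have Q1: "(\<Sum>j<N. g ^ j * (\<Sum>l<N. h ^ l * const (c i0 j l))) \<in> p 1"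
  proof (rule lowest_coefficient_in[where Q = "p 0" and f = f and N = N and ?i0.0 = i0
        and a = "\<lambda>i. \<Sum>j<N. g ^ j * (\<Sum>l<N. h ^ l * const (c i j l))"])
    show "x \<in> p 0" if "supp x \<subseteq> S" "f * x \<in> p 0" for x
      by (rule canc[OF _ fgh(2) s(1) that]) simp
    show "(\<Sum>i<N. f ^ i * (\<Sum>j<N. g ^ j * (\<Sum>l<N. h ^ l * const (c i j l)))) \<in> p 0"
      unfolding c(5) by (rule ideal_semigroup_ringD(2)[OF expo_monoid_axioms idl]) simp
    show "(\<Sum>j<N. g ^ j * (\<Sum>l<N. h ^ l * const (c i j l))) = 0" if "i < i0" for i
      using i0_min[OF that] by simp
    show "supp (\<Sum>j<N. g ^ j * (\<Sum>l<N. h ^ l * const (c i j l))) \<subseteq> S" for i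
      by (intro supp_in s)
  qed (use sub[of 0] idl[of 1] fgh i0 in auto)
  have Q2: "(\<Sum>l<N. h ^ l * const (c i0 j0 l)) \<in> p 2"
  proof (rule lowest_coefficient_in[where Q = "p 1" and f = g and N = N and ?i0.0 = j0
        and a = "\<lambda>j. \<Sum>l<N. h ^ l * const (c i0 j l)"])
    show "x \<in> p 1" if "supp x \<subseteq> S" "g * x \<in> p 1" for x
      by (rule canc[OF _ fgh(4) s(2) that]) simp
    show "(\<Sum>l<N. h ^ l * const (c i0 j l)) = 0" if "j < j0" for j
      using j0_min[OF that] by simp
    show "supp (\<Sum>l<N. h ^ l * const (c i0 j l)) \<subseteq> S" for j
      by (intro supp_in s)
  qed (use sub[of 1] idl[of 2] fgh j0 Q1 in \<open>auto simp: numeral_2_eq_2\<close>)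
  have "const (c i0 j0 l0) \<in> p 3"
  proof (rule lowest_coefficient_in[where Q = "p 2" and f = h and N = N and ?i0.0 = l0
        and a = "\<lambda>l. const (c i0 j0 l)"])
    show "x \<in> p 2" if "supp x \<subseteq> S" "h * x \<in> p 2" for x
      by (rule canc[OF _ fgh(6) s(3) that]) simp
    show "const (c i0 j0 l) = 0" if "l < l0" for l
      using l0_min[OF that] by simp
    show "supp (const (c i0 j0 l)) \<subseteq> S" for l
      by (rule supp_const_in)
  qed (use sub[of 2] idl[of 3] fgh l0 Q2 in \<open>auto simp: numeral_3_eq_3 numeral_2_eq_2\<close>)
  then have "const (inverse (c i0 j0 l0)) * const (c i0 j0 l0) \<in> p 3"
    by (intro ideal_semigroup_ringD(4)[OF expo_monoid_axioms idl[of 3]] supp_const_in) auto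
  then have "1 \<in> p 3" using l0 by (simp add: mult_single)
  then show False
    using primeideal.I_notcarr[OF pr[of 3]] ideal.one_imp_carrier[OF idl[of 3]] by simp
qed

end

section \<open>Maximal ideals\<close>

definition poly_at :: "'k::field laurent \<Rightarrow> 'k poly \<Rightarrow> 'k laurent" where
  "poly_at u p = poly (map_poly (\<lambda>c. const c) p) u"

lemma poly_at_0 [simp]: "poly_at u 0 = 0"
  by (simp add: poly_at_def)

lemma poly_at_pCons: "poly_at u (pCons c p) = const c + u * poly_at u p"
  by (simp add: poly_at_def map_poly_pCons)

lemma poly_at_1 [simp]: "poly_at u 1 = 1"
  by (simp add: one_pCons poly_at_pCons)

lemma poly_at_add: "poly_at u (p + q) = poly_at u p + poly_at u q"
  by (induction p q rule: poly_induct2) (simp_all add: poly_at_pCons single_add algebra_simps)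

lemma poly_at_smult: "poly_at u (Polynomial.smult c p) = const c * poly_at u p"
  by (induction p) (simp_all add: poly_at_pCons mult_single algebra_simps)

lemma poly_at_uminus: "poly_at u (- p) = - poly_at u p"
  using poly_at_add[of u p "- p"] by (simp add: eq_neg_iff_add_eq_0 add.commute)

lemma poly_at_diff: "poly_at u (p - q) = poly_at u p - poly_at u q"
  using poly_at_add[of u p "- q"] by (simp add: poly_at_uminus)

lemma poly_at_mult: "poly_at u (p * q) = poly_at u p * poly_at u q"
  by (induction p) (simp_all add: poly_at_pCons poly_at_add poly_at_smult algebra_simps)

lemma poly_at_power: "poly_at u (p ^ n) = poly_at u p ^ n"
  by (induction n) (simp_all add: poly_at_mult)

lemma poly_at_sum: "poly_at u (sum p I) = (\<Sum>i\<in>I. poly_at u (p i))"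
  by (induction I rule: infinite_finite_induct) (simp_all add: poly_at_add)

lemma poly_at_monom: "poly_at u (Polynomial.monom c n) = const c * u ^ n"
  by (induction n) (simp_all add: Polynomial.monom_0 Polynomial.monom_Suc poly_at_pCons algebra_simps)

context expo_monoid begin

lemma supp_poly_at_in: "supp u \<subseteq> S \<Longrightarrow> supp (poly_at u p) \<subseteq> S"
  by (induction p) (simp_all add: poly_at_pCons supp_add_in supp_mult_in zero_in)

lemma inverse_modulo_maximalideal:
  assumes "maximalideal P (semigroup_ring S :: 'k::field laurent ring)"
    and r: "supp r \<subseteq> S" "r \<notin> P"
  obtains g where "supp g \<subseteq> S" "r * g - 1 \<in> P"
proof -
  let ?R = "semigroup_ring S :: 'k laurent ring"
  interpret cring ?R by (rule cring_semigroup_ring)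
  interpret P: maximalideal P ?R by fact
  note I = ideal_semigroup_ringD[OF expo_monoid_axioms P.is_ideal]
  let ?J = "{q + r * g | q g. q \<in> P \<and> supp g \<subseteq> S}"
  have "ideal ?J ?R" using ideal_plus_multiples[OF P.is_ideal, of r] r(1) by simp
  moreover have "P \<subseteq> ?J"
  proof
    fix q assume "q \<in> P"
    then have "q = q + r * 0 \<and> q \<in> P \<and> supp (0 :: 'k laurent) \<subseteq> S" by simp
    then show "q \<in> ?J" by blast
  qed
  moreover have "?J \<noteq> P"
  proof -
    have "r = 0 + r * 1 \<and> 0 \<in> P \<and> supp (1 :: 'k laurent) \<subseteq> S" using I(2) supp_one_in by simp
    then have "r \<in> ?J" by blast
    then show ?thesis using r(2) by blast
  qed
  moreover have "?J \<subseteq> carrier ?R"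
  proof
    fix f assume "f \<in> ?J"
    then obtain q g where "f = q + r * g" "q \<in> P" "supp g \<subseteq> S" by blast
    then have "supp f \<subseteq> S" using supp_add_in[OF I(1) supp_mult_in[OF r(1)]] by simp
    then show "f \<in> carrier ?R" by simp
  qed
  ultimately have "?J = carrier ?R" using P.I_maximal[of ?J] by metis
  then have "1 \<in> ?J" using supp_one_in by simp
  then obtain q g where g: "1 = q + r * g" "q \<in> P" "supp g \<subseteq> S" by blast
  then have "r * g - 1 = - q" by (simp add: algebra_simps)
  then show ?thesis using that[of g] g(2,3) I(6) by simp
qed

text \<open>
A relation between \<open>h\<close>, \<open>u\<close> and \<open>v\<close> becomes, modulo a nonzero \<open>h \<in> P\<close>, an algebraic equation for \<open>v\<close>
over the polynomials in \<open>u\<close>.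
\<close>

lemma algebraic_modulo_nonzero_ideal:
  fixes u v :: "'k::field laurent"
  assumes S: "S \<subseteq> nonneg_vectors 2"
    and P: "ideal P (semigroup_ring S :: 'k laurent ring)" and h: "h \<in> P" "h \<noteq> 0"
    and u: "supp u \<subseteq> S" and v: "supp v \<subseteq> S"
  obtains m and c :: "nat \<Rightarrow> 'k poly"
  where "c m \<noteq> 0" "(\<Sum>l\<le>m. poly_at u (c l) * v ^ l) \<in> P"
proof -
  note I = ideal_semigroup_ringD[OF expo_monoid_axioms P]
  have s: "supp h \<subseteq> S" by (rule I(1)[OF h(1)])
  obtain N c i j l where c: "i < N" "j < N" "l < N" "c i j l \<noteq> (0::'k)"
    "(\<Sum>i<N. h ^ i * (\<Sum>j<N. u ^ j * (\<Sum>l<N. v ^ l * const (c i j l)))) = 0"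
    by (rule algebraic_relation[OF s[THEN order_trans[OF _ S]] u[THEN order_trans[OF _ S]]
          v[THEN order_trans[OF _ S]]])
  have "\<exists>j<N. \<exists>l<N. c i j l \<noteq> 0" using c by blast
  with c(1) obtain i0 where i0: "i0 < N" "\<exists>j<N. \<exists>l<N. c i0 j l \<noteq> 0"
    and i0_min: "\<And>i. i < i0 \<Longrightarrow> \<not> (\<exists>j<N. \<exists>l<N. c i j l \<noteq> 0)"
    by (rule least_index) metis
  have Q: "(\<Sum>j<N. u ^ j * (\<Sum>l<N. v ^ l * const (c i0 j l))) \<in> P"
  proof (rule lowest_coefficient_in[where Q = "{0}" and f = h and N = N and ?i0.0 = i0
        and a = "\<lambda>i. \<Sum>j<N. u ^ j * (\<Sum>l<N. v ^ l * const (c i j l))"])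
    show "(\<Sum>j<N. u ^ j * (\<Sum>l<N. v ^ l * const (c i j l))) = 0" if "i < i0" for i
      using i0_min[OF that] by simp
    show "supp (\<Sum>j<N. u ^ j * (\<Sum>l<N. v ^ l * const (c i j l))) \<subseteq> S" for i
      by (intro supp_in u v)
  qed (use I(2) P h i0(1) c(5) in auto)
  define C where "C l = (\<Sum>j<N. Polynomial.monom (c i0 j l) j)" for l
  have coeff_C: "Polynomial.coeff (C l) j = c i0 j l" if "j < N" for j l
    using that by (simp add: C_def Polynomial.coeff_sum)
  let ?L = "{l. l < N \<and> C l \<noteq> 0}"
  obtain j l where "j < N" "l < N" "c i0 j l \<noteq> 0" using i0 by blast
  then have "l \<in> ?L" using coeff_C[of j l] by auto
  then have "Max ?L \<in> ?L" by (intro Max_in) auto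
  define m where "m = Max ?L"
  have m: "m < N" "C m \<noteq> 0" using \<open>Max ?L \<in> ?L\<close> unfolding m_def by auto
  have above: "C l = 0" if "m < l" "l < N" for l
    using Max_ge[of ?L l] that unfolding m_def by fastforce
  have "(\<Sum>j<N. u ^ j * (\<Sum>l<N. v ^ l * const (c i0 j l)))
      = (\<Sum>l<N. \<Sum>j<N. u ^ j * (v ^ l * const (c i0 j l)))"
    by (simp add: sum_distrib_left) (rule sum.swap)
  also have "\<dots> = (\<Sum>l<N. poly_at u (C l) * v ^ l)"
    by (simp add: C_def poly_at_sum poly_at_monom sum_distrib_right sum_distrib_left
        mult.commute mult.left_commute)
  also have "\<dots> = (\<Sum>l\<le>m. poly_at u (C l) * v ^ l)"
    by (rule sum.mono_neutral_right) (use m(1) above in \<open>auto simp: not_le\<close>)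
  finally show ?thesis using that[of C m] m(2) Q by simp
qed

end

locale ideal_and_element = expo_monoid S for S +
  fixes P :: "'k::field laurent set" and u :: "'k laurent"
  assumes idl: "ideal P (semigroup_ring S)" and u: "supp u \<subseteq> S"
begin

lemmas idealD = ideal_semigroup_ringD[OF expo_monoid_axioms idl]

text \<open>
The submodule of \<open>R/P\<close> over the polynomial ring in \<open>u\<close> that \<open>E\<close> generates, pulled back to \<open>R\<close>.
\<close>

definition poly_span :: "'k laurent set \<Rightarrow> 'k laurent set" where
  "poly_span E = {(\<Sum>g\<in>E. poly_at u (a g) * g) + q | a q. q \<in> P}"

definition poly_indep :: "'k laurent set \<Rightarrow> bool" where
  "poly_indep E \<longleftrightarrow> (\<forall>a. (\<Sum>g\<in>E. poly_at u (a g) * g) \<in> P \<longrightarrow> (\<forall>g\<in>E. a g = 0))"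

lemma poly_span_ideal: "q \<in> P \<Longrightarrow> q \<in> poly_span E"
proof -
  assume "q \<in> P"
  then have "q = (\<Sum>g\<in>E. poly_at u 0 * g) + q \<and> q \<in> P" by simp
  then show ?thesis unfolding poly_span_def by (intro CollectI exI[of _ "\<lambda>_. 0"] exI[of _ q])
qed

lemma poly_span_add:
  assumes "f \<in> poly_span E" "g \<in> poly_span E" shows "f + g \<in> poly_span E"
proof -
  obtain a q b r where "f = (\<Sum>g\<in>E. poly_at u (a g) * g) + q" "q \<in> P"
    "g = (\<Sum>g\<in>E. poly_at u (b g) * g) + r" "r \<in> P"
    using assms unfolding poly_span_def by blast
  then have "f + g = (\<Sum>g\<in>E. poly_at u (a g + b g) * g) + (q + r) \<and> q + r \<in> P"
    using idealD(3) by (simp add: poly_at_add sum.distrib algebra_simps)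
  then show ?thesis unfolding poly_span_def by (intro CollectI exI[of _ "\<lambda>g. a g + b g"] exI[of _ "q + r"])
qed

lemma poly_span_mult:
  assumes "f \<in> poly_span E" shows "poly_at u p * f \<in> poly_span E"
proof -
  obtain a q where "f = (\<Sum>g\<in>E. poly_at u (a g) * g) + q" "q \<in> P"
    using assms unfolding poly_span_def by blast
  then have "poly_at u p * f = (\<Sum>g\<in>E. poly_at u (p * a g) * g) + poly_at u p * q
      \<and> poly_at u p * q \<in> P"
    using idealD(4)[OF supp_poly_at_in[OF u]]
    by (simp add: poly_at_mult sum_distrib_left algebra_simps)
  then show ?thesis unfolding poly_span_def
    by (intro CollectI exI[of _ "\<lambda>g. p * a g"] exI[of _ "poly_at u p * q"])
qed

lemma poly_span_sum:
  "(\<And>i. i \<in> I \<Longrightarrow> f i \<in> poly_span E) \<Longrightarrow> sum f I \<in> poly_span E"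
  by (induction I rule: infinite_finite_induct)
    (simp_all add: poly_span_ideal[OF idealD(2)] poly_span_add)

lemma poly_span_base:
  assumes "finite E" "g \<in> E" shows "g \<in> poly_span E"
proof -
  have "(\<Sum>h\<in>E. poly_at u (if h = g then 1 else 0) * h) = (\<Sum>h\<in>E. if h = g then h else 0)"
    by (rule sum.cong) auto
  then have "g = (\<Sum>h\<in>E. poly_at u (if h = g then 1 else 0) * h) + 0 \<and> 0 \<in> P"
    using assms idealD(2) by simp
  then show ?thesis unfolding poly_span_def
    by (intro CollectI exI[of _ "\<lambda>h. if h = g then 1 else 0"] exI[of _ 0])
qed

lemma poly_span_image:
  assumes h: "supp h \<subseteq> S" and hE: "\<And>g. g \<in> E \<Longrightarrow> h * g \<in> poly_span E'"
    and f: "f \<in> poly_span E"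
  shows "h * f \<in> poly_span E'"
proof -
  obtain a q where f: "f = (\<Sum>g\<in>E. poly_at u (a g) * g) + q" "q \<in> P"
    using f unfolding poly_span_def by blast
  have "h * f = (\<Sum>g\<in>E. poly_at u (a g) * (h * g)) + h * q"
    unfolding f(1) by (simp add: sum_distrib_left algebra_simps)
  also have "\<dots> \<in> poly_span E'"
    by (intro poly_span_add poly_span_sum poly_span_mult hE poly_span_ideal idealD(4) h f(2))
  finally show ?thesis .
qed

text \<open>
Every element of \<open>E\<close> is algebraically dependent on a maximal independent subset, so a product of
leading coefficients is a common denominator. Keeping 1 in the subset makes it possible to read
off a coefficient of 1 later on.
\<close>

lemma poly_indep_denominator:
  assumes E: "finite E" "1 \<in> E" and inj: "\<And>p. poly_at u p \<in> P \<Longrightarrow> p = 0"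
  obtains I b where "finite I" "1 \<in> I" "poly_indep I" "b \<noteq> 0"
    "\<And>g. g \<in> E \<Longrightarrow> poly_at u b * g \<in> poly_span I"
proof -
  let ?C = "{I. I \<subseteq> E \<and> 1 \<in> I \<and> poly_indep I}"
  have "{1} \<in> ?C" using E inj by (auto simp: poly_indep_def)
  then have ne: "?C \<noteq> {}" by (metis empty_iff)
  have "finite ?C" using E(1) by simp
  from finite_has_maximal[OF this ne]
  obtain I where I: "I \<in> ?C" and max: "\<And>J. J \<in> ?C \<Longrightarrow> I \<subseteq> J \<Longrightarrow> J = I"
    by (elim bexE) (rule, assumption, blast)
  then have fin: "finite I" using E(1) finite_subset by blast
  have "\<exists>b. b \<noteq> 0 \<and> poly_at u b * g \<in> poly_span I" if g: "g \<in> E" for g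
  proof (cases "g \<in> I")
    case True
    then have "poly_at u 1 * g \<in> poly_span I" using poly_span_base[OF fin] by simp
    then show ?thesis by (intro exI[of _ 1]) simp
  next
    case False
    then have "insert g I \<notin> ?C" using max[of "insert g I"] by blast
    then have "\<not> poly_indep (insert g I)" using I g by blast
    then obtain a where a: "(\<Sum>h\<in>insert g I. poly_at u (a h) * h) \<in> P"
      and nz: "\<exists>h\<in>insert g I. a h \<noteq> 0" unfolding poly_indep_def by blast
    have sum: "poly_at u (a g) * g + (\<Sum>h\<in>I. poly_at u (a h) * h) \<in> P"
      using a fin False by simp
    have "a g \<noteq> 0"
    proof
      assume "a g = 0"
      then have "\<forall>h\<in>I. a h = 0" using sum I unfolding poly_indep_def by simp
      then show False using nz \<open>a g = 0\<close> by blast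
    qed
    moreover have "poly_at u (a g) * g = (\<Sum>h\<in>I. poly_at u (- a h) * h)
        + (poly_at u (a g) * g + (\<Sum>h\<in>I. poly_at u (a h) * h))"
      by (simp add: poly_at_uminus sum_negf)
    then have "poly_at u (a g) * g \<in> poly_span I"
      using sum unfolding poly_span_def
      by (intro CollectI exI[of _ "\<lambda>h. - a h"] exI conjI)
    ultimately show ?thesis by blast
  qed
  then obtain b where b: "\<And>g. g \<in> E \<Longrightarrow> b g \<noteq> 0"
    "\<And>g. g \<in> E \<Longrightarrow> poly_at u (b g) * g \<in> poly_span I" by metis
  have "poly_at u (prod b E) * g \<in> poly_span I" if "g \<in> E" for g
  proof -
    have "prod b E = prod b (E - {g}) * b g"
      using prod.remove[OF E(1) that, of b] by (simp add: mult.commute)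
    then have "poly_at u (prod b E) * g = poly_at u (prod b (E - {g})) * (poly_at u (b g) * g)"
      by (simp add: poly_at_mult mult.assoc)
    then show ?thesis using poly_span_mult[OF b(2)[OF that], of "prod b (E - {g})"] by metis
  qed
  moreover have "prod b E \<noteq> 0" using b(1) E(1) by simp
  ultimately show ?thesis using that I fin by blast
qed

end

lemma (in expo_monoid) nonzero_in_maximalideal:
  assumes S: "S \<subseteq> nonneg_vectors 2" and e: "e \<in> S" "e \<noteq> 0"
    and P: "maximalideal P (semigroup_ring S :: 'k::field laurent ring)"
  obtains h where "h \<in> P" "h \<noteq> 0"
proof (cases "mon e \<in> P")
  case True
  then show ?thesis using that[of "mon e"] by (metis single_zero one_neq_zero inj_single injD)
next
  case False
  then obtain g where g: "supp g \<subseteq> S" "mon e * g - 1 \<in> P"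
    using inverse_modulo_maximalideal[OF P _ False] e by auto
  have "mon e * g \<noteq> 1"
  proof
    assume "mon e * g = 1"
    then have "coef (mon e * g) 0 = 1" by simp
    then have "- e \<in> supp g" by (simp add: coef_mon_mult' in_keys_iff)
    then have "- e \<in> nonneg_vectors 2" "e \<in> nonneg_vectors 2" using g(1) S e by blast+
    then show False using e(2) by (auto simp: nonneg_vectors_2)
  qed
  then show ?thesis using that[OF g(2)] by simp
qed

text \<open>
The instance of Hilbert's Nullstellensatz that is needed: the residue field of a maximal ideal is
algebraic over the base field. Suppose that \<open>u = mon e\<close> is transcendental modulo \<open>P\<close>. Then
\<open>v = mon e'\<close> satisfies an equation over the polynomials in \<open>u\<close>, with leading coefficient \<open>c m\<close>, and
there is a polynomial \<open>d\<close>, a product of \<open>c m\<close> and a common denominator \<open>b\<close>, such that every element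
of the residue field, times a power of \<open>d\<close>, lies in a free module over the polynomials in \<open>u\<close> that
has 1 in its basis. This cannot hold for the inverse of the polynomial \<open>1 + u d\<close>, which is prime
to \<open>d\<close>.

The premise \<open>gen\<close> says that the translates of \<open>B\<close> by multiples of \<open>e\<close> and \<open>e'\<close> cover \<open>S\<close>; it has
the form of an induction principle.
\<close>

lemma (in expo_monoid) polynomial_in_maximalideal:
  fixes P :: "'k::field laurent set"
  assumes S: "S \<subseteq> nonneg_vectors 2"
    and P: "maximalideal P (semigroup_ring S :: 'k laurent ring)"
    and e: "e \<in> S" "e \<noteq> 0" and e': "e' \<in> S" and B: "finite B" "B \<subseteq> S" "0 \<in> B"
    and gen: "\<And>Z. B \<subseteq> Z \<Longrightarrow> (\<And>s. s \<in> Z \<Longrightarrow> s + e \<in> Z) \<Longrightarrow> (\<And>s. s \<in> Z \<Longrightarrow> s + e' \<in> Z) \<Longrightarrow> S \<subseteq> Z"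
  shows "\<exists>p. p \<noteq> 0 \<and> poly_at (mon e) p \<in> P"
proof (rule ccontr)
  assume contra: "\<not> ?thesis"
  have inj: "p = 0" if p: "poly_at (mon e) p \<in> P" for p using contra p by blast
  let ?u = "mon e :: 'k laurent" and ?v = "mon e' :: 'k laurent"
  have P_ideal: "ideal P (semigroup_ring S)" using P maximalideal.axioms(1) by blast
  have uv: "supp ?u \<subseteq> S" "supp ?v \<subseteq> S" using e e' by auto
  interpret ideal_and_element S P ?u
    by (intro ideal_and_element.intro ideal_and_element_axioms.intro expo_monoid_axioms P_ideal uv)
  obtain h where h: "h \<in> P" "h \<noteq> 0" using nonzero_in_maximalideal[OF S e P] .
  obtain m and c :: "nat \<Rightarrow> 'k poly"
    where c: "c m \<noteq> 0" "(\<Sum>l\<le>m. poly_at ?u (c l) * ?v ^ l) \<in> P"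
    by (rule algebraic_modulo_nonzero_ideal[OF S P_ideal h uv])
  have "m > 0"
  proof (rule ccontr)
    assume "\<not> m > 0"
    then have "poly_at ?u (c 0) \<in> P" using c(2) by simp
    then show False using inj c(1) \<open>\<not> m > 0\<close> by auto
  qed
  \<comment> \<open>Powers of \<open>v\<close> from the \<open>m\<close>-th on are reduced by the equation, at the price of a factor \<open>c m\<close>.\<close>
  define E where "E = (\<lambda>(b, l). mon b * ?v ^ l) ` (B \<times> {..<m})"
  have finE: "finite E" using B(1) by (simp add: E_def)
  have base: "mon b * ?v ^ l \<in> E" if "b \<in> B" "l < m" for b l
    using that by (auto simp: E_def)
  then have E1: "1 \<in> E" using base[OF B(3) \<open>m > 0\<close>] by simp
  obtain I b where I: "finite I" "1 \<in> I" "poly_indep I" "b \<noteq> 0"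
    "\<And>g. g \<in> E \<Longrightarrow> poly_at ?u b * g \<in> poly_span I"
    using poly_indep_denominator[OF finE E1 inj] by metis
  have step: "poly_at ?u (c m) * ?v * g \<in> poly_span E" if g: "g \<in> E" for g
  proof -
    obtain b l where bl: "b \<in> B" "l < m" "g = mon b * ?v ^ l" using g by (auto simp: E_def)
    show ?thesis
    proof (cases "Suc l < m")
      case True
      have "poly_at ?u (c m) * (mon b * ?v ^ Suc l) \<in> poly_span E"
        by (intro poly_span_mult poly_span_base finE base bl True)
      then show ?thesis by (simp add: bl(3) mult.assoc mult.left_commute)
    next
      case False
      then have m: "m = Suc l" using bl(2) by simp
      have "poly_at ?u (c m) * ?v * g = mon b * (\<Sum>l\<le>m. poly_at ?u (c l) * ?v ^ l)
          + (\<Sum>l<m. poly_at ?u (- c l) * (mon b * ?v ^ l))"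
        unfolding bl(3) lessThan_Suc_atMost[symmetric]
        by (simp add: m poly_at_uminus sum_negf sum_distrib_left algebra_simps)
      also have "\<dots> \<in> poly_span E"
      proof (rule poly_span_add)
        have "supp (mon b :: 'k laurent) \<subseteq> S" using bl(1) B(2) by auto
        then show "mon b * (\<Sum>l\<le>m. poly_at ?u (c l) * ?v ^ l) \<in> poly_span E"
          by (intro poly_span_ideal idealD(4) c(2))
        show "(\<Sum>l<m. poly_at ?u (- c l) * (mon b * ?v ^ l)) \<in> poly_span E"
          by (rule poly_span_sum, rule poly_span_mult, rule poly_span_base[OF finE base[OF bl(1)]])
            simp
      qed
      finally show ?thesis .
    qed
  qed
  let ?fin = "\<lambda>f. \<exists>n. poly_at ?u (c m ^ n) * f \<in> poly_span E"
  have "S \<subseteq> {s. ?fin (mon s)}"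
  proof (rule gen)
    show "B \<subseteq> {s. ?fin (mon s)}"
      using poly_span_base[OF finE base[OF _ \<open>m > 0\<close>]] by (auto intro!: exI[of _ 0])
  next
    fix s assume "s \<in> {s. ?fin (mon s)}"
    then obtain n where n: "poly_at ?u (c m ^ n) * mon s \<in> poly_span E" by blast
    have "poly_at ?u [:0, 1:] * (poly_at ?u (c m ^ n) * mon s)
        = poly_at ?u (c m ^ n) * (?u * mon s)"
      by (simp add: poly_at_pCons mult.left_commute)
    also have "?u * mon s = mon (s + e)" by (simp add: mult_single add.commute)
    finally have "poly_at ?u (c m ^ n) * mon (s + e) \<in> poly_span E"
      using poly_span_mult[OF n, of "[:0, 1:]"] by metis
    then show "s + e \<in> {s. ?fin (mon s)}" by blast
    have "supp (poly_at ?u (c m) * ?v) \<subseteq> S" by (intro supp_mult_in supp_poly_at_in uv)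
    then have "poly_at ?u (c m) * ?v * (poly_at ?u (c m ^ n) * mon s) \<in> poly_span E"
      using poly_span_image[OF _ step n] by blast
    also have "poly_at ?u (c m) * ?v * (poly_at ?u (c m ^ n) * mon s)
        = poly_at ?u (c m ^ Suc n) * (?v * mon s)"
      by (simp add: poly_at_mult mult.assoc mult.left_commute)
    also have "?v * mon s = mon (s + e')" by (simp add: mult_single add.commute)
    finally show "s + e' \<in> {s. ?fin (mon s)}" by blast
  qed
  then have monS: "?fin (mon s)" if "s \<in> S" for s using that by blast
  have fin: "?fin f" if "supp f \<subseteq> S" for f
    using that
  proof (induction rule: laurent_induct)
    case (mon a) then show ?case by (rule monS)
  next
    case (const k g)
    then obtain n where "poly_at ?u (c m ^ n) * g \<in> poly_span E" by blast
    then have "poly_at ?u [:k:] * (poly_at ?u (c m ^ n) * g) \<in> poly_span E"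
      by (rule poly_span_mult)
    then show ?case by (auto simp: poly_at_pCons mult.left_commute)
  next
    case (add g h)
    then obtain n k where nk: "poly_at ?u (c m ^ n) * g \<in> poly_span E"
      "poly_at ?u (c m ^ k) * h \<in> poly_span E" by blast
    then have "poly_at ?u (c m ^ k) * (poly_at ?u (c m ^ n) * g)
        + poly_at ?u (c m ^ n) * (poly_at ?u (c m ^ k) * h) \<in> poly_span E"
      by (intro poly_span_add poly_span_mult[OF nk(1)] poly_span_mult[OF nk(2)])
    moreover have "poly_at ?u (c m ^ k) * (poly_at ?u (c m ^ n) * g)
        + poly_at ?u (c m ^ n) * (poly_at ?u (c m ^ k) * h) = poly_at ?u (c m ^ (n + k)) * (g + h)"
      by (simp add: power_add poly_at_mult algebra_simps)
    ultimately show ?case by metis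
  next
    case zero
    show ?case using poly_span_ideal[OF idealD(2)] by simp
  qed
  define d where "d = c m * b"
  \<comment> \<open>This is \<open>1 + u d\<close>.\<close>
  define q where "q = pCons 1 d"
  have d: "d \<noteq> 0" using c(1) I(4) by (simp add: d_def)
  have "q \<noteq> 0" by (simp add: q_def)
  then have "poly_at ?u q \<notin> P" using inj by blast
  then obtain g where g: "supp g \<subseteq> S" "poly_at ?u q * g - 1 \<in> P"
    using inverse_modulo_maximalideal[OF P supp_poly_at_in[OF uv(1)]] by metis
  obtain n where "poly_at ?u (c m ^ n) * g \<in> poly_span E" using fin[OF g(1)] by blast
  then have "poly_at ?u b * (poly_at ?u (c m ^ n) * g) \<in> poly_span I"
    using poly_span_image[OF supp_poly_at_in[OF uv(1)] I(5)] by blast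
  then have "poly_at ?u (c m * b ^ n) * (poly_at ?u b * (poly_at ?u (c m ^ n) * g)) \<in> poly_span I"
    by (rule poly_span_mult)
  then have "poly_at ?u (d ^ Suc n) * g \<in> poly_span I"
    by (simp add: d_def poly_at_mult poly_at_power power_mult_distrib algebra_simps)
  then obtain a r where ar: "poly_at ?u (d ^ Suc n) * g = (\<Sum>i\<in>I. poly_at ?u (a i) * i) + r" "r \<in> P"
    unfolding poly_span_def by blast
  \<comment> \<open>Comparing the coefficients of 1 in \<open>q (d\<^bsup>n+1\<^esup> g) = d\<^bsup>n+1\<^esup>\<close> modulo \<open>P\<close> shows that \<open>q\<close> divides \<open>d\<^bsup>n+1\<^esup>\<close>.\<close>
  have "(\<Sum>i\<in>I. poly_at ?u (q * a i - (if i = 1 then d ^ Suc n else 0)) * i)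
      = (\<Sum>i\<in>I. poly_at ?u q * (poly_at ?u (a i) * i) - (if i = 1 then poly_at ?u (d ^ Suc n) else 0))"
    by (rule sum.cong) (auto simp: poly_at_diff poly_at_mult algebra_simps)
  also have "\<dots> = poly_at ?u q * (\<Sum>i\<in>I. poly_at ?u (a i) * i) - poly_at ?u (d ^ Suc n)"
    using I(1,2) by (simp add: sum_subtractf sum_distrib_left)
  also have "\<dots> = poly_at ?u (d ^ Suc n) * (poly_at ?u q * g - 1) - poly_at ?u q * r"
  proof -
    have *: "(\<Sum>i\<in>I. poly_at ?u (a i) * i) = poly_at ?u (d ^ Suc n) * g - r" using ar(1) by simp
    show ?thesis unfolding * by (simp add: algebra_simps)
  qed
  also have "\<dots> \<in> P"
    by (intro idealD(7) idealD(4) supp_poly_at_in uv g ar)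
  finally have "\<forall>i\<in>I. q * a i - (if i = 1 then d ^ Suc n else 0) = 0"
    by (rule I(3)[unfolded poly_indep_def, THEN spec, THEN mp])
  then have "q * a 1 - d ^ Suc n = 0" using I(2) by fastforce
  then have "q dvd d ^ Suc n" by (metis dvd_triv_left eq_iff_diff_eq_0)
  then have "q dvd 1"
  proof (induction "Suc n" arbitrary: n)
    case (Suc n)
    have "[:0, 1:] * d ^ Suc n = q * d ^ n - d ^ n" by (simp add: q_def)
    then have "q dvd q * d ^ n - d ^ n" using Suc.prems by (metis dvd_mult)
    then have "q dvd d ^ n" by (simp add: dvd_diff_right_iff)
    then show ?case using Suc.hyps(1) by (cases n) auto
  qed
  then show False using d by (simp add: q_def is_unit_pCons_iff)
qed

section \<open>Monomial modules\<close>

definition monomial_module :: "expo set \<Rightarrow> ('k::field laurent, 'k laurent) module" where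
  "monomial_module W = \<lparr>carrier = {f. supp f \<subseteq> W}, monoid.mult = (*), one = 1, zero = 0, add = (+),
     module.smult = (*)\<rparr>"

lemma monomial_module_simps [simp]:
  "carrier (monomial_module W) = {f. supp f \<subseteq> W}"
  "f \<oplus>\<^bsub>monomial_module W\<^esub> g = f + g" "\<zero>\<^bsub>monomial_module W\<^esub> = 0"
  "r \<odot>\<^bsub>monomial_module W\<^esub> f = r * f"
  by (simp_all add: monomial_module_def)

locale expo_module = expo_monoid S for S +
  fixes W :: "expo set"
  assumes act: "s \<in> S \<Longrightarrow> w \<in> W \<Longrightarrow> s + w \<in> W"
begin

lemma supp_act: "supp r \<subseteq> S \<Longrightarrow> supp f \<subseteq> W \<Longrightarrow> supp (r * f) \<subseteq> W"
  using supp_mult[of r f] act by blast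

lemma supp_add_W: "supp f \<subseteq> W \<Longrightarrow> supp g \<subseteq> W \<Longrightarrow> supp (f + g) \<subseteq> W"
  using Poly_Mapping.keys_add[of f g] by blast

lemma module_monomial_module:
  "module (semigroup_ring S :: 'k::field laurent ring) (monomial_module W)"
proof (rule moduleI[OF cring_semigroup_ring abelian_groupI])
  fix f :: "'k laurent" assume "f \<in> carrier (monomial_module W)"
  then show "\<exists>g\<in>carrier (monomial_module W). g \<oplus>\<^bsub>monomial_module W\<^esub> f = \<zero>\<^bsub>monomial_module W\<^esub>"
    by (intro bexI[of _ "- f"]) simp_all
qed (simp_all add: supp_act supp_add_W algebra_simps)

lemma submodule_monomial_moduleI:
  fixes N :: "'k::field laurent set"
  assumes "\<And>f. f \<in> N \<Longrightarrow> supp f \<subseteq> W" "0 \<in> N" "\<And>f g. f \<in> N \<Longrightarrow> g \<in> N \<Longrightarrow> f + g \<in> N"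
    "\<And>r f. supp r \<subseteq> S \<Longrightarrow> f \<in> N \<Longrightarrow> r * f \<in> N"
  shows "submodule N (semigroup_ring S) (monomial_module W)"
proof -
  interpret M: module "semigroup_ring S :: 'k laurent ring" "monomial_module W"
    by (rule module_monomial_module)
  have neg: "- f \<in> N" if "f \<in> N" for f
    using assms(4)[OF supp_uminus_in[OF supp_one_in] that] by simp
  show ?thesis
  proof (rule M.submoduleI)
    fix f assume f: "f \<in> N"
    have "\<ominus>\<^bsub>monomial_module W\<^esub> f = - f"
      by (rule M.M.minus_equality) (use assms(1)[OF f] in simp_all)
    then show "\<ominus>\<^bsub>monomial_module W\<^esub> f \<in> N" using neg[OF f] by simp
  qed (use assms in auto)
qed

lemma submodule_monomial_moduleD:
  assumes "submodule N (semigroup_ring S :: 'k::field laurent ring) (monomial_module W)"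
  shows "f \<in> N \<Longrightarrow> supp f \<subseteq> W" "0 \<in> N" "f \<in> N \<Longrightarrow> g \<in> N \<Longrightarrow> f + g \<in> N"
    "supp r \<subseteq> S \<Longrightarrow> f \<in> N \<Longrightarrow> r * f \<in> N"
proof -
  interpret M: module "semigroup_ring S :: 'k laurent ring" "monomial_module W"
    by (rule module_monomial_module)
  note N = M.submoduleE[OF assms]
  show "f \<in> N \<Longrightarrow> supp f \<subseteq> W" using N(1) by auto
  show "0 \<in> N" using subgroup.one_closed[OF submodule.axioms(1)[OF assms]] by simp
  show "f \<in> N \<Longrightarrow> g \<in> N \<Longrightarrow> f + g \<in> N" using N(5)[of f g] by simp
  show "supp r \<subseteq> S \<Longrightarrow> f \<in> N \<Longrightarrow> r * f \<in> N" using N(4)[of r f] by simp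
qed

end

locale expo_module_generators = expo_module S W for S W +
  fixes H :: "expo set"
  assumes finite_H: "finite H" and H_subset: "H \<subseteq> W"
    and H_generates: "w \<in> W \<Longrightarrow> \<exists>h\<in>H. w - h \<in> S"
    and H_minimal: "h \<in> H \<Longrightarrow> s \<in> S \<Longrightarrow> h - s \<in> W \<Longrightarrow> s = 0"
begin

lemma mon_H_generates:
  "generates_module (semigroup_ring S :: 'k::field laurent ring) (monomial_module W) (mon ` H)"
  unfolding generates_module_def
proof (intro conjI allI impI)
  show "mon ` H \<subseteq> carrier (monomial_module W :: ('k laurent, 'k laurent) module)"
    using H_subset by auto
  fix N :: "'k laurent set"
  assume "submodule N (semigroup_ring S :: 'k laurent ring) (monomial_module W) \<and> mon ` H \<subseteq> N"
  then have N: "submodule N (semigroup_ring S :: 'k laurent ring) (monomial_module W)"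
    and HN: "mon ` H \<subseteq> N" by auto
  note Nd = submodule_monomial_moduleD[OF N]
  have "f \<in> N" if "supp f \<subseteq> W" for f
    using that
  proof (induction rule: laurent_induct)
    case (mon w)
    then obtain h where h: "h \<in> H" "w - h \<in> S" using H_generates by blast
    have "mon (w - h) * mon h \<in> N" by (rule Nd(4)) (use h HN in auto)
    then show ?case by (simp add: mult_single)
  next
    case (const c g) then show ?case using Nd(4)[OF supp_const_in] by blast
  qed (auto intro: Nd)
  then show "N = carrier (monomial_module W)" using Nd(1) by auto
qed

text \<open>
The coefficients at the minimal exponents \<open>H\<close>. As \<open>head_mult\<close> shows, this is the passage to the quotient
by the graded maximal ideal times the module.
\<close>

definition head :: "'k::field laurent \<Rightarrow> 'k laurent" where
  "head f = (\<Sum>h\<in>H. const (coef f h) * mon h)"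

lemma coef_head: "coef (head f) a = (if a \<in> H then coef f a else 0)"
  using finite_H by (simp add: head_def lookup_sum coef_const_mult lookup_single when_def
      if_distrib sum.If_cases Int_def conj_commute cong: if_cong)

lemma head_add: "head (f + g) = head f + head g"
  by (rule poly_mapping_eqI) (simp add: coef_head lookup_add)

lemma head_mult:
  assumes "supp r \<subseteq> S" "supp f \<subseteq> W" shows "head (r * f) = const (coef r 0) * head f"
proof (rule poly_mapping_eqI)
  fix a
  have "coef ((r - const (coef r 0)) * f) a = 0" if a: "a \<in> H"
  proof (rule ccontr)
    assume "coef ((r - const (coef r 0)) * f) a \<noteq> 0"
    then have "a \<in> supp ((r - const (coef r 0)) * f)" by (simp add: in_keys_iff)
    then obtain s w where sw: "s \<in> supp (r - const (coef r 0))" "w \<in> supp f" "a = s + w"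
      using supp_mult[of "r - const (coef r 0)" f] by blast
    have "s \<noteq> 0" using sw(1) by (auto simp: in_keys_iff lookup_minus)
    moreover have "s \<in> S" using sw(1) supp_diff_in[OF assms(1) supp_const_in] by blast
    ultimately show False using H_minimal[OF a, of s] sw assms(2) by auto
  qed
  then show "coef (head (r * f)) a = coef (const (coef r 0) * head f) a"
    by (simp add: coef_head coef_const_mult left_diff_distrib lookup_minus)
qed

text \<open>
The elements whose head lies in the linear span of the heads of \<open>G\<close> form a submodule. So if \<open>G\<close>
generates, then its heads span a space of dimension \<open>card H\<close>.
\<close>

lemma card_H_le:
  fixes G :: "'k::field laurent set"
  assumes G: "generates_module (semigroup_ring S) (monomial_module W) G" "finite G"
  shows "card H \<le> card G"
proof -
  let ?B = "mon ` H :: 'k laurent set"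
  define N where "N = {f. supp f \<subseteq> W \<and> head f \<in> laurent.span (head ` G)}"
  have "submodule N (semigroup_ring S) (monomial_module W)"
  proof (rule submodule_monomial_moduleI)
    have "head 0 = (0 :: 'k laurent)" by (rule poly_mapping_eqI) (simp add: coef_head)
    then show "0 \<in> N" by (simp add: N_def laurent.span_zero)
    show "r * f \<in> N" if "supp r \<subseteq> S" "f \<in> N" for r f
      using that by (simp add: N_def head_mult laurent.span_scale supp_act)
    show "f + g \<in> N" if "f \<in> N" "g \<in> N" for f g
      using that by (simp add: N_def head_add laurent.span_add supp_add_W)
  qed (simp add: N_def)
  moreover have "G \<subseteq> N"
    using G(1) by (auto simp: N_def generates_module_def intro: laurent.span_base)
  ultimately have "N = {f. supp f \<subseteq> W}" using G(1) by (simp add: generates_module_def)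
  then have "mon h \<in> N" if "h \<in> H" for h using that H_subset by auto
  then have "head (mon h) \<in> laurent.span (head ` G)" if "h \<in> H" for h
    using that by (simp add: N_def)
  moreover have "head (mon h) = (mon h :: 'k laurent)" if "h \<in> H" for h
    by (rule poly_mapping_eqI) (use that in \<open>auto simp: coef_head lookup_single when_def\<close>)
  ultimately have span: "?B \<subseteq> laurent.span (head ` G)" by fastforce
  have inj: "inj_on (mon :: expo \<Rightarrow> 'k laurent) H"
    by (rule inj_onI) (metis keys_single singleton_inject zero_neq_one)
  have "laurent.independent ?B"
  proof
    assume "laurent.dependent ?B"
    then obtain c h where c: "h \<in> H" "c (mon h) \<noteq> 0" "(\<Sum>b\<in>?B. const (c b) * b) = 0"
      using laurent.dependent_finite[of ?B] finite_H by auto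
    have "(\<Sum>b\<in>?B. const (c b) * b) = (\<Sum>h\<in>H. const (c (mon h)) * mon h)"
      by (simp add: sum.reindex[OF inj])
    then have "coef (\<Sum>h\<in>H. const (c (mon h)) * mon h) h = 0" using c(3) by simp
    then show False
      using c(1,2) finite_H by (simp add: lookup_sum coef_const_mult lookup_single when_def
          if_distrib cong: if_cong)
  qed
  then have "card ?B \<le> card (head ` G)"
    using laurent.independent_span_bound[OF _ _ span] G(2) by simp
  also have "\<dots> \<le> card G" by (rule card_image_le[OF G(2)])
  finally show ?thesis by (simp add: card_image[OF inj])
qed

lemma min_num_generators_monomial_module:
  "min_num_generators (semigroup_ring S :: 'k::field laurent ring) (monomial_module W) = enat (card H)"
proof (rule antisym)
  have "card (mon ` H :: 'k laurent set) \<le> card H" by (rule card_image_le[OF finite_H])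
  moreover have "finite (mon ` H :: 'k laurent set)" using finite_H by simp
  ultimately show "min_num_generators (semigroup_ring S :: 'k laurent ring) (monomial_module W)
      \<le> enat (card H)"
    unfolding min_num_generators_def using mon_H_generates
    by (intro Inf_lower2[of "enat (card (mon ` H :: 'k laurent set))"]) auto
  show "enat (card H) \<le> min_num_generators (semigroup_ring S :: 'k laurent ring) (monomial_module W)"
    unfolding min_num_generators_def by (rule Inf_greatest) (use card_H_le in auto)
qed

end

text \<open>
Multiplication by the monomial of exponent \<open>t\<close> is a linear form if it carries \<open>W\<close> into \<open>S\<close>, and it has
the monomial of exponent \<open>a\<close> in its image if \<open>a - t\<close> lies in \<open>W\<close>.
\<close>

lemma (in expo_module) graded_max_ideal_subset_trace:
  assumes gen: "\<And>s. s \<in> S \<Longrightarrow> s \<noteq> 0 \<Longrightarrow> \<exists>a\<in>B. s - a \<in> S"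
    and shift: "\<And>a. a \<in> B \<Longrightarrow> \<exists>t. a - t \<in> W \<and> (\<forall>w\<in>W. t + w \<in> S)"
  shows "graded_max_ideal S \<subseteq> trace_ideal (semigroup_ring S :: 'k::field laurent ring) (monomial_module W)"
proof
  let ?R = "semigroup_ring S :: 'k laurent ring" and ?M = "monomial_module W :: ('k laurent, 'k laurent) module"
  interpret R: cring ?R by (rule cring_semigroup_ring)
  let ?U = "\<Union>\<phi>\<in>linear_forms ?R ?M. \<phi> ` carrier ?M"
  have "?U \<subseteq> carrier ?R" by (auto simp: linear_forms_def Pi_iff simp del: subsetI)
  then have idl: "ideal (trace_ideal ?R ?M) ?R" and sub: "?U \<subseteq> trace_ideal ?R ?M"
    unfolding trace_ideal_def by (rule R.genideal_ideal, rule R.genideal_self)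
  note I = ideal_semigroup_ringD[OF expo_monoid_axioms idl]
  have mon_a: "mon a \<in> trace_ideal ?R ?M" if "a \<in> B" for a
  proof -
    obtain t where t: "a - t \<in> W" "\<And>w. w \<in> W \<Longrightarrow> t + w \<in> S" using shift \<open>a \<in> B\<close> by blast
    have "supp (mon t * f) \<subseteq> S" if "supp f \<subseteq> W" for f :: "'k laurent"
      using supp_mult[of "mon t" f] that t(2) by auto
    then have "(\<lambda>f. mon t * f) \<in> linear_forms ?R ?M"
      by (auto simp: linear_forms_def algebra_simps simp del: subsetI)
    moreover have "mon (a - t) \<in> carrier ?M" using t(1) by simp
    ultimately have "mon t * mon (a - t) \<in> ?U" by blast
    then show ?thesis using sub by (auto simp: mult_single)
  qed
  fix f :: "'k laurent" assume "f \<in> graded_max_ideal S"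
  then have "supp f \<subseteq> S - {0}" by (simp add: graded_max_ideal_def)
  then show "f \<in> trace_ideal ?R ?M"
  proof (induction rule: laurent_induct)
    case (mon s)
    then obtain a where a: "a \<in> B" "s - a \<in> S" using gen by blast
    have "mon (s - a) * mon a \<in> trace_ideal ?R ?M" by (rule I(4)[OF _ mon_a[OF a(1)]]) (use a in simp)
    then show ?case by (simp add: mult_single)
  next
    case (const c g) then show ?case using I(4)[OF supp_const_in] by blast
  qed (auto intro: I)
qed

section \<open>Projective monomial curves\<close>

lemma submonoid_span_add: "a \<in> submonoid_span G \<Longrightarrow> b \<in> submonoid_span G \<Longrightarrow> a + b \<in> submonoid_span G"
  by (induction rule: submonoid_span.induct) (auto intro: submonoid_span.intros simp: add.assoc)

text \<open>
The semigroup is generated by the vectors \<open>(a, D - a)\<close> with \<open>a \<in> A\<close>. For each residue \<open>k\<close> modulo \<open>D\<close>,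
\<open>X k\<close> and \<open>Y k\<close> are the least coordinates that occur among the elements of \<open>S\<close> whose first coordinate is
congruent to \<open>k\<close>. That both minima are attained by one element of \<open>S\<close> is the combinatorial
Cohen-Macaulay condition; then \<open>S\<close> is the disjoint union of the quadrants
\<open>(X k, Y k) + D\<nat>\<^sup>2\<close>. The axioms can be checked residue by residue: by \<open>XY_add\<close> this union of
quadrants is closed under addition of generators, and by \<open>XY_pred\<close> every nonzero corner is a
generator plus another corner.
\<close>

locale monomial_curve =
  fixes D :: int and A :: "int set" and X Y :: "int \<Rightarrow> int"
  assumes D_pos: "0 < D"
    and finite_A: "finite A" and A_bounds: "A \<subseteq> {0..D}" and A_ends: "0 \<in> A" "D \<in> A"
    and XY_0: "X 0 = 0" "Y 0 = 0"
    and XY_nonneg: "\<And>k. k \<in> {0..<D} \<Longrightarrow> 0 \<le> X k \<and> 0 \<le> Y k"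
    and X_mod: "\<And>k. k \<in> {0..<D} \<Longrightarrow> X k mod D = k"
    and XY_dvd: "\<And>k. k \<in> {0..<D} \<Longrightarrow> D dvd X k + Y k"
    and XY_add: "\<And>a k. a \<in> A \<Longrightarrow> k \<in> {0..<D} \<Longrightarrow>
      X ((k + a) mod D) \<le> X k + a \<and> Y ((k + a) mod D) \<le> Y k + (D - a)"
    and XY_pred: "\<And>k. k \<in> {1..<D} \<Longrightarrow>
      \<exists>a\<in>A. X k - a = X ((k - a) mod D) \<and> Y k - (D - a) = Y ((k - a) mod D)"
begin

definition gens :: "expo set" where
  "gens = (\<lambda>a. pt a (D - a)) ` A"

definition S :: "expo set" where
  "S = submonoid_span gens"

definition in_S :: "int \<Rightarrow> int \<Rightarrow> bool" where
  "in_S x y \<longleftrightarrow> D dvd x + y \<and> X (x mod D) \<le> x \<and> Y (x mod D) \<le> y"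

lemma residue: "x mod D \<in> {0..<D}" using D_pos by simp

lemma dvd_diff_X: "D dvd x - X (x mod D)"
  using X_mod[OF residue[of x]] by (metis mod_eq_dvd_iff mod_mod_trivial)

lemma dvd_diff_Y: "D dvd x + y \<Longrightarrow> D dvd y - Y (x mod D)"
proof -
  assume xy: "D dvd x + y"
  have "D dvd x + y - (X (x mod D) + Y (x mod D)) - (x - X (x mod D))"
    by (intro dvd_diff xy XY_dvd residue dvd_diff_X)
  then show ?thesis by simp
qed

lemma in_S_XY: "k \<in> {0..<D} \<Longrightarrow> in_S (X k) (Y k)"
  using X_mod[of k] XY_dvd[of k] by (simp add: in_S_def)

lemma in_S_quadrant:
  assumes "in_S x y"
  obtains i j where "x = X (x mod D) + int i * D" "y = Y (x mod D) + int j * D"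
proof -
  obtain i j where ij: "x - X (x mod D) = D * i" "y - Y (x mod D) = D * j"
    using dvd_diff_X[of x] dvd_diff_Y[of x y] assms unfolding in_S_def by (metis dvdE)
  have "0 \<le> D * i" "0 \<le> D * j" using ij assms unfolding in_S_def by linarith+
  then have "0 \<le> i" "0 \<le> j" using D_pos by (simp_all add: zero_le_mult_iff)
  then show ?thesis using ij that[of "nat i" "nat j"] by (simp add: algebra_simps)
qed

lemma in_S_imp_span: "in_S x y \<Longrightarrow> pt x y \<in> S"
proof (induction "nat (x + y)" arbitrary: x y rule: less_induct)
  case less
  note xy = less.prems
  have nonneg: "0 \<le> x" "0 \<le> y"
    using xy XY_nonneg[OF residue[of x]] unfolding in_S_def by linarith+
  obtain i j where ij: "x = X (x mod D) + int i * D" "y = Y (x mod D) + int j * D"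
    by (rule in_S_quadrant[OF xy])
  have step: "pt x y \<in> S" if "a \<in> A" "in_S (x - a) (y - (D - a))" for a
  proof -
    have pos: "0 \<le> x - a" "0 \<le> y - (D - a)"
      using that(2) XY_nonneg[OF residue[of "x - a"]] unfolding in_S_def by linarith+
    have "pt (x - a) (y - (D - a)) \<in> S"
      by (rule less.hyps[OF _ that(2)]) (use pos D_pos in auto)
    then have "pt a (D - a) + pt (x - a) (y - (D - a)) \<in> S"
      unfolding S_def gens_def using that(1) by (intro submonoid_span.add) auto
    then show ?thesis by simp
  qed
  consider "0 < i" | "0 < j" | "i = 0" "j = 0" by auto
  then show ?case
  proof cases
    case 1
    then have "1 * D \<le> int i * D" using D_pos by (intro mult_right_mono) auto
    moreover have "(x - D) mod D = x mod D" by simp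
    ultimately have "in_S (x - D) y" using xy ij
      unfolding in_S_def by (metis add_diff_eq add.commute diff_add_eq dvd_diff dvd_refl
          le_add_same_cancel1 diff_ge_0_iff_ge mult_1)
    then show ?thesis using step[OF A_ends(2)] by simp
  next
    case 2
    then have "1 * D \<le> int j * D" using D_pos by (intro mult_right_mono) auto
    then have "Y (x mod D) \<le> y - D" using ij by linarith
    then have "in_S x (y - D)" using xy unfolding in_S_def
      by (metis add_diff_eq dvd_diff dvd_refl)
    then show ?thesis using step[OF A_ends(1)] by simp
  next
    case 3
    define k where "k = x mod D"
    have k: "k \<in> {0..<D}" "x = X k" "y = Y k" using ij 3 residue unfolding k_def by auto
    show ?thesis
    proof (cases "k = 0")
      case True
      then show ?thesis using k XY_0 by (simp add: S_def pt_zero submonoid_span.zero)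
    next
      case False
      then obtain a where a: "a \<in> A" "X k - a = X ((k - a) mod D)" "Y k - (D - a) = Y ((k - a) mod D)"
        using XY_pred[of k] k(1) by auto
      then show ?thesis using step[OF a(1)] in_S_XY[OF residue[of "k - a"]] k by simp
    qed
  qed
qed

lemma S_eq: "S = {pt x y | x y. in_S x y}"
proof (intro equalityI subsetI)
  fix s assume "s \<in> S"
  then show "s \<in> {pt x y | x y. in_S x y}"
    unfolding S_def
  proof induction
    case zero
    have "in_S 0 0" using XY_0 by (simp add: in_S_def)
    then show ?case by (metis (mono_tags, lifting) mem_Collect_eq pt_zero)
  next
    case (add a b)
    then obtain a' x y where a: "a' \<in> A" "a = pt a' (D - a')" and b: "b = pt x y" "in_S x y"
      by (auto simp: gens_def)
    have "X ((x + a') mod D) \<le> X (x mod D) + a'" "Y ((x + a') mod D) \<le> Y (x mod D) + (D - a')"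
      using XY_add[OF a(1) residue[of x]] by (simp_all add: mod_simps)
    moreover have "x + a' + (y + (D - a')) = x + y + D" by simp
    ultimately have "in_S (x + a') (y + (D - a'))" using b(2) unfolding in_S_def
      by (simp only:) (auto intro: dvd_add)
    then have "in_S (a' + x) (D - a' + y)"
      by (simp only: add.commute[of a' x] add.commute[of "D - a'" y])
    then show ?case unfolding a b pt_add by blast
  qed
qed (auto intro: in_S_imp_span)

lemma pt_in_S_iff [simp]: "pt x y \<in> S \<longleftrightarrow> in_S x y"
  by (auto simp: S_eq)

lemma S_nonneg: "S \<subseteq> nonneg_vectors 2"
proof
  fix s assume "s \<in> S"
  then obtain x y where "s = pt x y" "in_S x y" by (auto simp: S_eq)
  then show "s \<in> nonneg_vectors 2"
    using XY_nonneg[OF residue[of x]] unfolding in_S_def nonneg_vectors_2 by fastforce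
qed

sublocale expo_monoid S
  by unfold_locales (auto simp: S_def submonoid_span.zero submonoid_span_add)

lemma e_in_S: "pt D 0 \<in> S" "pt 0 D \<in> S"
  using A_ends unfolding S_def gens_def
  by (metis (no_types, lifting) add.right_neutral diff_self diff_zero imageI submonoid_span.simps)+

lemma gens_nonneg: "finite gens" "gens \<subseteq> nonneg_vectors 2"
  using finite_A A_bounds by (auto simp: gens_def nonneg_vectors_2)

lemma affine_semigroup_S: "affine_semigroup S"
  unfolding affine_semigroup_def S_def using gens_nonneg by blast

definition total :: "expo \<Rightarrow> int" where
  "total a = Poly_Mapping.lookup a 0 + Poly_Mapping.lookup a 1"

lemma total_pt [simp]: "total (pt x y) = x + y"
  by (simp add: total_def lookup_pt)

lemma total_add: "total (a + b) = total a + total b"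
  by (simp add: total_def lookup_add)

lemma total_S: "s \<in> S \<Longrightarrow> s \<noteq> 0 \<Longrightarrow> D \<le> total s"
proof -
  assume s: "s \<in> S" "s \<noteq> 0"
  then obtain x y where xy: "s = pt x y" "in_S x y" by (auto simp: S_eq)
  then have "pt x y \<in> nonneg_vectors 2" using S_nonneg s(1) by blast
  then have "0 \<le> x" "0 \<le> y" by (auto simp: nonneg_vectors_2)
  moreover have "x + y \<noteq> 0" using calculation s(2) xy by auto
  ultimately show ?thesis using xy unfolding in_S_def by (auto intro: zdvd_imp_le)
qed

lemma S_cases:
  assumes "s \<in> S" "s \<noteq> 0"
  obtains a t where "a \<in> A" "t \<in> S" "s = pt a (D - a) + t"
proof -
  have "s \<in> submonoid_span gens" using assms(1) by (simp add: S_def)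
  then show ?thesis
    by cases (use assms that in \<open>auto simp: gens_def S_def\<close>)
qed

lemma min_gens_S: "min_gens S = gens"
proof (intro equalityI subsetI)
  fix s assume "s \<in> min_gens S"
  then have s: "s \<in> S" "s \<noteq> 0" "\<And>b c. b \<in> S - {0} \<Longrightarrow> c \<in> S - {0} \<Longrightarrow> s \<noteq> b + c"
    by (auto simp: min_gens_def)
  obtain a t where a: "a \<in> A" "t \<in> S" "s = pt a (D - a) + t" using S_cases[OF s(1,2)] .
  have "pt a (D - a) \<in> S - {0}"
    using a(1) D_pos submonoid_span.add[OF _ submonoid_span.zero, of "pt a (D - a)" gens]
    by (auto simp: gens_def S_def)
  then have "t = 0" using s(3) a by blast
  then show "s \<in> gens" using a by (simp add: gens_def)
next
  fix s assume "s \<in> gens"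
  then obtain a where a: "a \<in> A" "s = pt a (D - a)" by (auto simp: gens_def)
  have "s \<in> S" using submonoid_span.add[OF \<open>s \<in> gens\<close> submonoid_span.zero] by (simp add: S_def)
  moreover have "s \<noteq> 0" using a D_pos by auto
  moreover have "s \<noteq> b + c" if "b \<in> S - {0}" "c \<in> S - {0}" for b c
  proof
    assume "s = b + c"
    then have "total s = total b + total c" by (simp add: total_add)
    moreover have "total s = D" using a by simp
    ultimately show False using total_S[of b] total_S[of c] that D_pos by auto
  qed
  ultimately show "s \<in> min_gens S" by (auto simp: min_gens_def)
qed

lemma homogeneous_semigroup_S: "homogeneous_semigroup S"
  unfolding homogeneous_semigroup_def min_gens_S
proof (intro exI[of _ "\<lambda>_. 1"] exI[of _ "of_int D"] conjI ballI)
  show "of_int D \<noteq> (0 :: real)" using D_pos by simp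
  fix s assume "s \<in> gens"
  then obtain a where a: "s = pt a (D - a)" by (auto simp: gens_def)
  have "(\<Sum>i\<in>Poly_Mapping.keys s. 1 * of_int (Poly_Mapping.lookup s i))
      = (\<Sum>i\<in>{0, 1}. (of_int (Poly_Mapping.lookup s i) :: real))"
    unfolding a by (simp only: mult_1, rule sum.mono_neutral_left)
      (auto simp: in_keys_iff lookup_pt split: if_splits)
  also have "\<dots> = of_int D" by (simp add: a lookup_pt)
  finally show "(\<Sum>i\<in>Poly_Mapping.keys s. 1 * of_int (Poly_Mapping.lookup s i)) = (of_int D :: real)" .
qed

section \<open>Cohen-Macaulayness\<close>

abbreviation u :: "'k::field laurent" where "u \<equiv> mon (pt D 0)"
abbreviation v :: "'k::field laurent" where "v \<equiv> mon (pt 0 D)"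

definition apery :: "expo set" where
  "apery = (\<lambda>k. pt (X k) (Y k)) ` {0..<D}"

lemma apery: "finite apery" "apery \<subseteq> S" "0 \<in> apery"
proof -
  show "apery \<subseteq> S" by (auto simp: apery_def intro!: in_S_XY)
  show "0 \<in> apery" using XY_0 D_pos unfolding apery_def by (intro image_eqI[of _ _ 0]) (auto simp: pt_zero)
qed (simp add: apery_def)

lemma S_subset_if_closed:
  assumes "apery \<subseteq> Z" "\<And>s. s \<in> Z \<Longrightarrow> s + pt D 0 \<in> Z" "\<And>s. s \<in> Z \<Longrightarrow> s + pt 0 D \<in> Z"
  shows "S \<subseteq> Z"
proof
  fix s assume "s \<in> S"
  then obtain x y where s: "s = pt x y" "in_S x y" by (auto simp: S_eq)
  obtain i j where ij: "x = X (x mod D) + int i * D" "y = Y (x mod D) + int j * D"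
    by (rule in_S_quadrant[OF s(2)])
  have "pt (X k + int i * D) (Y k) \<in> Z" if "k \<in> {0..<D}" for k i
    using assms(2)[of "pt (X k + int _ * D) (Y k)"] assms(1) that
    by (induction i) (auto simp: apery_def algebra_simps)
  then have "pt (X k + int i * D) (Y k + int j * D) \<in> Z" if "k \<in> {0..<D}" for k i j
    using assms(3)[of "pt (X k + int i * D) (Y k + int _ * D)"] that
    by (induction j) (auto simp: algebra_simps)
  from this[OF residue, of x i j] show "s \<in> Z" using s ij by simp
qed

lemma polynomials_in_maximalideal:
  assumes "maximalideal P (semigroup_ring S :: 'k::field laurent ring)"
  shows "\<exists>p. p \<noteq> 0 \<and> poly_at u p \<in> P" "\<exists>q. q \<noteq> 0 \<and> poly_at v q \<in> P"
proof -
  show "\<exists>p. p \<noteq> 0 \<and> poly_at u p \<in> P"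
    by (rule polynomial_in_maximalideal[OF S_nonneg assms e_in_S(1) _ e_in_S(2) apery])
      (use D_pos S_subset_if_closed in auto)
  show "\<exists>q. q \<noteq> 0 \<and> poly_at v q \<in> P"
    by (rule polynomial_in_maximalideal[OF S_nonneg assms e_in_S(2) _ e_in_S(1) apery])
      (use D_pos S_subset_if_closed in auto)
qed

text \<open>
The number of the column of its quadrant in which a point lies. It is the \<open>u\<close>-degree of a monomial
if \<open>k[S]\<close> is regarded as a free module over \<open>k[u, v]\<close> with the corners of the quadrants as basis.
\<close>

definition u_degree :: "expo \<Rightarrow> int" where
  "u_degree s = (Poly_Mapping.lookup s 0 - X (Poly_Mapping.lookup s 0 mod D)) div D"

lemma u_degree_pt: "u_degree (pt x y) = (x - X (x mod D)) div D"
  by (simp add: u_degree_def lookup_pt)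

lemma u_degree_shift [simp]:
  "u_degree (pt (x + i * D) y) = u_degree (pt x y) + i"
  "u_degree (pt (x - i * D) y) = u_degree (pt x y) - i"
proof -
  show *: "u_degree (pt (x + i * D) y) = u_degree (pt x y) + i" for i
  proof -
    have "(x + i * D - X (x mod D)) div D = (x - X (x mod D) + i * D) div D"
      by (simp add: algebra_simps)
    then show ?thesis using D_pos by (simp add: u_degree_pt)
  qed
  show "u_degree (pt (x - i * D) y) = u_degree (pt x y) - i" using *[of "- i"] by simp
qed

lemma u_degree_nonneg: "in_S x y \<Longrightarrow> 0 \<le> u_degree (pt x y)"
  using D_pos by (simp add: u_degree_pt in_S_def pos_imp_zdiv_nonneg_iff)

lemma in_S_shift:
  assumes "in_S x y" "0 \<le> u_degree (pt x y) + i"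
  shows "in_S (x + i * D) y"
proof -
  have "0 \<le> u_degree (pt (x + i * D) y)" using assms(2) by simp
  then have "X (x mod D) \<le> x + i * D"
    using D_pos by (simp add: u_degree_pt pos_imp_zdiv_nonneg_iff)
  moreover have "D dvd x + i * D + y"
    using assms(1) dvd_add[of D "x + y" "i * D"] by (simp add: in_S_def algebra_simps)
  ultimately show ?thesis using assms(1) by (simp add: in_S_def)
qed

lemma u_power: "u ^ n = mon (pt (int n * D) 0)"
  by (induction n) (simp_all add: mult_single algebra_simps pt_zero)

lemma poly_at_u: "poly_at u p = (\<Sum>i\<le>degree p. const (Polynomial.coeff p i) * mon (pt (int i * D) 0))"
  using poly_at_sum[of u "\<lambda>i. Polynomial.monom (Polynomial.coeff p i) i" "{..degree p}"]
  by (simp add: poly_as_sum_of_monoms poly_at_monom u_power)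

text \<open>
Long division with respect to the \<open>u\<close>-degree: multiplication by \<open>u\<close> is a bijection between the
points of neighbouring columns.
\<close>

lemma divide_by_poly_at_u:
  fixes p :: "'k::field poly"
  assumes p: "p \<noteq> 0" and f: "supp f \<subseteq> S"
  obtains c r where "supp c \<subseteq> S" "supp r \<subseteq> {s \<in> S. u_degree s < int (degree p)}"
    "f = poly_at u p * c + r"
proof -
  let ?n = "degree p" and ?T = "{s \<in> S. u_degree s < int (degree p)}"
  define Dec where "Dec f \<longleftrightarrow> (\<exists>c r. supp c \<subseteq> S \<and> supp r \<subseteq> ?T \<and> f = poly_at u p * c + r)" for f
  have DecI: "Dec f" if "supp c \<subseteq> S" "supp r \<subseteq> ?T" "f = poly_at u p * c + r" for f c r
    unfolding Dec_def using that by blast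
  have add: "Dec (f + g)" if fg: "Dec f" "Dec g" for f g
  proof -
    obtain c r c' r' where h: "supp c \<subseteq> S" "supp r \<subseteq> ?T" "f = poly_at u p * c + r"
      "supp c' \<subseteq> S" "supp r' \<subseteq> ?T" "g = poly_at u p * c' + r'"
      using fg unfolding Dec_def by blast
    show ?thesis
      by (rule DecI[of "c + c'" "r + r'"])
        (use h Poly_Mapping.keys_add[of c c'] Poly_Mapping.keys_add[of r r']
          in \<open>auto simp: algebra_simps\<close>)
  qed
  have scale: "Dec (const k * f)" if f: "Dec f" for f k
  proof -
    obtain c r where h: "supp c \<subseteq> S" "supp r \<subseteq> ?T" "f = poly_at u p * c + r"
      using f unfolding Dec_def by blast
    have "supp (const k * g) \<subseteq> supp g" for g :: "'k laurent"
      by (auto simp: in_keys_iff coef_const_mult)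
    then show ?thesis
      by (intro DecI[of "const k * c" "const k * r"])
        (use h in \<open>auto simp: algebra_simps\<close>)
  qed
  have zero: "Dec 0" by (rule DecI[of 0 0]) auto
  have sum: "Dec (sum g I)" if "\<And>i. i \<in> I \<Longrightarrow> Dec (g i)" for g and I :: "nat set"
    using that by (induction I rule: infinite_finite_induct) (auto intro: zero add)
  have mon: "Dec (mon (pt x y))" if "in_S x y" for x y
    using that
  proof (induction "nat (u_degree (pt x y))" arbitrary: x y rule: less_induct)
    case less
    show ?case
    proof (cases "u_degree (pt x y) < int ?n")
      case True
      show ?thesis by (rule DecI[of 0 "mon (pt x y)"]) (use True less.prems in auto)
    next
      case False
      define x' where "x' = x - int ?n * D"
      have x': "in_S x' y" "u_degree (pt x' y) = u_degree (pt x y) - int ?n"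
        using in_S_shift[OF less.prems, of "- int ?n"] False by (simp_all add: x'_def)
      have lower: "Dec (mon (pt (x' + int i * D) y))" if "i < ?n" for i
      proof (rule less.hyps)
        show "in_S (x' + int i * D) y"
          using in_S_shift[OF x'(1), of "int i"] u_degree_nonneg[OF x'(1)] by simp
        show "nat (u_degree (pt (x' + int i * D) y)) < nat (u_degree (pt x y))"
          using x'(2) that u_degree_nonneg[OF x'(1)] by simp
      qed
      let ?lc = "Polynomial.lead_coeff p"
      have "poly_at u p * mon (pt x' y)
          = (\<Sum>i\<le>?n. const (Polynomial.coeff p i) * mon (pt (x' + int i * D) y))"
        by (simp add: poly_at_u sum_distrib_right mult.assoc mult_single add.commute)
      also have "\<dots> = (\<Sum>i<?n. const (Polynomial.coeff p i) * mon (pt (x' + int i * D) y))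
          + const ?lc * mon (pt x y)"
        unfolding lessThan_Suc_atMost[symmetric] by (simp add: x'_def)
      finally have "const (inverse ?lc) * (const ?lc * mon (pt x y))
          = const (inverse ?lc) * (poly_at u p * mon (pt x' y)
            + (\<Sum>i<?n. const (- Polynomial.coeff p i) * mon (pt (x' + int i * D) y)))"
        by (simp add: sum_negf single_uminus)
      then have eq: "mon (pt x y) = const (inverse ?lc) * (poly_at u p * mon (pt x' y)
            + (\<Sum>i<?n. const (- Polynomial.coeff p i) * mon (pt (x' + int i * D) y)))"
        using p by (simp add: mult_single flip: mult.assoc)
      have "Dec (poly_at u p * mon (pt x' y))"
        by (rule DecI[of "mon (pt x' y)" 0]) (use x'(1) in auto)
      then show ?thesis unfolding eq
        by (intro scale add sum lower) auto
    qed
  qed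
  from f have "Dec f"
  proof (induction rule: laurent_induct)
    case (mon a)
    then show ?case using \<open>\<And>y x. in_S x y \<Longrightarrow> Dec (mon (pt x y))\<close> by (auto simp: S_eq)
  qed (auto intro: scale add zero)
  then show ?thesis unfolding Dec_def using that by blast
qed

lemma supp_poly_at_v_mult:
  assumes "supp r \<subseteq> {s \<in> S. u_degree s < n}"
  shows "supp (poly_at v q * r) \<subseteq> {s \<in> S. u_degree s < n}" (is "_ \<subseteq> ?T")
proof (induction q)
  case (pCons c q)
  have "supp (const c * r) \<subseteq> ?T" using assms by (auto simp: in_keys_iff coef_const_mult)
  moreover have "supp (v * (poly_at v q * r)) \<subseteq> ?T"
  proof
    fix s assume "s \<in> supp (v * (poly_at v q * r))"
    then obtain t where t: "t \<in> supp (poly_at v q * r)" "s = pt 0 D + t"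
      using supp_mult[of v "poly_at v q * r"] by auto
    then have "t \<in> S" "u_degree t < n" using pCons.IH by auto
    then show "s \<in> ?T" using t(2) add_in[OF e_in_S(2)] by (auto simp: S_eq u_degree_pt)
  qed
  ultimately show ?case
    using Poly_Mapping.keys_add[of "const c * r" "v * (poly_at v q * r)"]
    by (auto simp: poly_at_pCons algebra_simps)
qed simp

text \<open>
The top coefficients in \<open>u\<close> do not cancel.
\<close>

lemma u_degree_poly_at_u_mult:
  fixes p :: "'k::field poly"
  assumes p: "p \<noteq> 0" and b: "supp b \<subseteq> S" "b \<noteq> 0"
  obtains s where "s \<in> supp (poly_at u p * b)" "int (degree p) \<le> u_degree s"
proof -
  let ?N = "Max (u_degree ` supp b)" and ?n = "degree p"
  have ne: "supp b \<noteq> {}" using b(2) by simp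
  then have "?N \<in> u_degree ` supp b" by (intro Max_in) auto
  then obtain s where s: "s \<in> supp b" "u_degree s = ?N" by auto
  then obtain x y where xy: "s = pt x y" "in_S x y" using b(1) by (auto simp: S_eq)
  have max: "u_degree t \<le> ?N" if "t \<in> supp b" for t using that by (intro Max_ge) auto
  have "coef (poly_at u p * b) (pt (x + int ?n * D) y)
      = (\<Sum>i\<le>?n. Polynomial.coeff p i * coef b (pt (x + (int ?n - int i) * D) y))"
    by (simp add: poly_at_u sum_distrib_right lookup_sum mult.assoc coef_const_mult
        coef_mon_mult' left_diff_distrib diff_add_eq add_diff_eq)
  also have "\<dots> = (\<Sum>i\<in>{?n}. Polynomial.coeff p i * coef b (pt (x + (int ?n - int i) * D) y))"
  proof (rule sum.mono_neutral_right)
    show "\<forall>i\<in>{..?n} - {?n}. Polynomial.coeff p i * coef b (pt (x + (int ?n - int i) * D) y) = 0"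
    proof
      fix i assume "i \<in> {..?n} - {?n}"
      then have "u_degree (pt (x + (int ?n - int i) * D) y) > ?N" using s(2) xy(1) by simp
      then show "Polynomial.coeff p i * coef b (pt (x + (int ?n - int i) * D) y) = 0"
        using max[of "pt (x + (int ?n - int i) * D) y"] by (auto simp: in_keys_iff)
    qed
  qed auto
  also have "\<dots> \<noteq> 0" using p s xy by (simp add: in_keys_iff)
  finally have "pt (x + int ?n * D) y \<in> supp (poly_at u p * b)" by (simp add: in_keys_iff)
  from that[OF this] show ?thesis using u_degree_nonneg[OF xy(2)] by simp
qed

lemma poly_at_u_nonzero: "p \<noteq> 0 \<Longrightarrow> poly_at u p \<noteq> 0"
  by (rule u_degree_poly_at_u_mult[of p 1]) (use supp_one_in in auto)

lemma poly_at_v_nonzero: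
  assumes "q \<noteq> 0" shows "poly_at v q \<noteq> 0"
proof
  assume "poly_at v q = 0"
  have pow: "v ^ n = mon (pt 0 (int n * D))" for n
    by (induction n) (simp_all add: mult_single algebra_simps pt_zero)
  have "poly_at v q = (\<Sum>i\<le>degree q. const (Polynomial.coeff q i) * mon (pt 0 (int i * D)))"
    using poly_at_sum[of v "\<lambda>i. Polynomial.monom (Polynomial.coeff q i) i" "{..degree q}"]
    by (simp add: poly_as_sum_of_monoms poly_at_monom pow)
  then have "coef (poly_at v q) (pt 0 (int (degree q) * D))
      = (\<Sum>i\<le>degree q. if i = degree q then Polynomial.coeff q i else 0)"
    using D_pos by (simp add: lookup_sum coef_const_mult lookup_single when_def if_distrib cong: if_cong)
  then show False using assms \<open>poly_at v q = 0\<close> by simp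
qed

text \<open>
The remainder \<open>r\<close> of \<open>a\<close> has small \<open>u\<close>-degree, and so has \<open>q(v) r\<close>; but \<open>q(v) r\<close> is also a multiple of
\<open>p(u)\<close>, hence zero.
\<close>

lemma poly_at_v_regular_modulo_poly_at_u:
  fixes p q :: "'k::field poly"
  assumes pq: "p \<noteq> 0" "q \<noteq> 0" and ab: "supp a \<subseteq> S" "supp b \<subseteq> S"
    and eq: "poly_at v q * a = poly_at u p * b"
  shows "\<exists>c. supp c \<subseteq> S \<and> a = poly_at u p * c"
proof -
  obtain c r where cr: "supp c \<subseteq> S" "supp r \<subseteq> {s \<in> S. u_degree s < int (degree p)}"
    "a = poly_at u p * c + r" using divide_by_poly_at_u[OF pq(1) ab(1)] .
  define b' where "b' = b - poly_at v q * c"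
  have eq': "poly_at v q * r = poly_at u p * b'"
    using eq unfolding b'_def cr(3) by (simp add: algebra_simps)
  have supp_b': "supp b' \<subseteq> S"
    unfolding b'_def by (intro supp_diff_in supp_mult_in supp_poly_at_in ab cr) (use e_in_S in simp)
  have "b' = 0"
  proof (rule ccontr)
    assume "b' \<noteq> 0"
    then obtain s where "s \<in> supp (poly_at u p * b')" "int (degree p) \<le> u_degree s"
      using u_degree_poly_at_u_mult[OF pq(1) supp_b'] by blast
    then show False using supp_poly_at_v_mult[OF cr(2), of q] unfolding eq' by auto
  qed
  then have "poly_at v q * r = 0" using eq' by simp
  then have "r = 0" using poly_at_v_nonzero[OF pq(2)] by simp
  then show ?thesis using cr by auto
qed

lemma regular_sequence_poly_at:
  fixes p q :: "'k::field poly"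
  assumes pq: "p \<noteq> 0" "q \<noteq> 0"
    and proper: "Idl\<^bsub>semigroup_ring S\<^esub> {poly_at u p, poly_at v q} \<noteq> carrier (semigroup_ring S)"
  shows "regular_sequence (semigroup_ring S) [poly_at u p, poly_at v q]"
proof -
  interpret R: cring "semigroup_ring S :: 'k laurent ring" by (rule cring_semigroup_ring)
  have in_S: "supp (poly_at u p) \<subseteq> S" "supp (poly_at v q) \<subseteq> S"
    by (intro supp_poly_at_in supp_mon_in e_in_S)+
  have idl0: "Idl\<^bsub>semigroup_ring S\<^esub> {} = {0 :: 'k laurent}"
  proof
    show "Idl\<^bsub>semigroup_ring S\<^esub> {} \<subseteq> {0 :: 'k laurent}"
      using R.genideal_minimal[OF R.zeroideal, of "{}"] by simp
    have "ideal (Idl\<^bsub>semigroup_ring S\<^esub> {}) (semigroup_ring S :: 'k laurent ring)"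
      by (rule R.genideal_ideal) simp
    then show "{0 :: 'k laurent} \<subseteq> Idl\<^bsub>semigroup_ring S\<^esub> {}"
      using ideal_semigroup_ringD(2)[OF expo_monoid_axioms] by blast
  qed
  have idl1: "Idl\<^bsub>semigroup_ring S\<^esub> {poly_at u p} = {c * poly_at u p | c. supp c \<subseteq> S}"
    using R.cgenideal_eq_genideal[of "poly_at u p"] in_S by (simp add: cgenideal_def)
  show ?thesis
    unfolding regular_sequence_def
  proof (intro conjI allI impI ballI)
    fix i and a :: "'k laurent"
    assume i: "i < length [poly_at u p, poly_at v q]" and a: "a \<in> carrier (semigroup_ring S)"
      and mem: "[poly_at u p, poly_at v q] ! i \<otimes>\<^bsub>semigroup_ring S\<^esub> a
        \<in> Idl\<^bsub>semigroup_ring S\<^esub> (set (take i [poly_at u p, poly_at v q]))"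
    consider "i = 0" | "i = 1" using i by (auto simp: less_Suc_eq)
    then show "a \<in> Idl\<^bsub>semigroup_ring S\<^esub> (set (take i [poly_at u p, poly_at v q]))"
    proof cases
      case 1
      then show ?thesis using mem poly_at_u_nonzero[OF pq(1)] by (simp add: idl0)
    next
      case 2
      then obtain b where b: "supp b \<subseteq> S" "poly_at v q * a = poly_at u p * b"
        using mem by (auto simp: idl1 mult.commute)
      then show ?thesis
        using poly_at_v_regular_modulo_poly_at_u[OF pq _ b] a 2
        by (auto simp: idl1 mult.commute)
    qed
  qed (use in_S proper in auto)
qed

lemma height_le_2: "height (semigroup_ring S :: 'k::field laurent ring) P \<le> 2"
  unfolding height_def
  by (rule Sup_least) (use prime_chain_length_le_2[OF S_nonneg] in \<open>auto simp: numeral_eq_enat\<close>)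

text \<open>
Every maximal ideal contains a regular sequence \<open>p(u), q(v)\<close>, and no chain of primes is longer
than 2.
\<close>

lemma cohen_macaulay_S: "cohen_macaulay (semigroup_ring S :: 'k::field laurent ring)"
  unfolding cohen_macaulay_def
proof (intro allI impI)
  fix P assume P: "maximalideal P (semigroup_ring S :: 'k laurent ring)"
  interpret R: cring "semigroup_ring S :: 'k laurent ring" by (rule cring_semigroup_ring)
  interpret P: maximalideal P "semigroup_ring S :: 'k laurent ring" by (rule P)
  obtain p q where pq: "p \<noteq> 0" "poly_at u p \<in> P" "q \<noteq> 0" "poly_at v q \<in> P"
    using polynomials_in_maximalideal[OF P] by blast
  have "Idl\<^bsub>semigroup_ring S\<^esub> {poly_at u p, poly_at v q} \<subseteq> P"
    by (rule R.genideal_minimal[OF P.is_ideal]) (use pq in simp)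
  moreover have "P \<subset> carrier (semigroup_ring S)" using P.I_notcarr P.Icarr by blast
  ultimately have "regular_sequence (semigroup_ring S) [poly_at u p, poly_at v q]"
    by (intro regular_sequence_poly_at pq) blast
  then have "enat (length [poly_at u p, poly_at v q]) \<le> depth (semigroup_ring S) P"
    unfolding depth_def using pq by (intro Sup_upper CollectI exI[of _ "[poly_at u p, poly_at v q]"]) auto
  moreover have "depth (semigroup_ring S) P \<le> height (semigroup_ring S) P"
    by (rule R.depth_le_height[OF R.maximalideal_prime[OF P]])
  ultimately show "depth (semigroup_ring S) P = height (semigroup_ring S) P"
    using height_le_2[of P] by (simp add: numeral_eq_enat numeral_2_eq_2)
qed

lemma krull_dim_S: "krull_dim (semigroup_ring S :: 'k::field laurent ring) = 2"
proof (rule antisym)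
  let ?R = "semigroup_ring S :: 'k laurent ring" and ?M = "graded_max_ideal S :: 'k laurent set"
  interpret R: cring ?R by (rule cring_semigroup_ring)
  show "krull_dim ?R \<le> 2"
    unfolding krull_dim_def
    by (rule Sup_least) (use prime_chain_length_le_2[OF S_nonneg] in \<open>auto simp: numeral_eq_enat\<close>)
  have "ideal ?M ?R"
    unfolding ideal_semigroup_ring_iff
  proof (intro conjI ballI allI impI)
    show "f + g \<in> ?M" if "f \<in> ?M" "g \<in> ?M" for f g
      using that Poly_Mapping.keys_add[of f g] unfolding graded_max_ideal_def by blast
    show "r * f \<in> ?M" if r: "supp r \<subseteq> S" "f \<in> ?M" for r f
    proof -
      have "a + b \<in> S - {0}" if "a \<in> S" "b \<in> S - {0}" for a b
      proof -
        have "0 \<le> total a"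
          using total_S[OF that(1)] D_pos by (cases "a = 0") (simp_all add: total_def)
        moreover have "D \<le> total b" using that(2) total_S by blast
        ultimately have "total (a + b) \<noteq> total 0"
          unfolding total_add using D_pos by (simp add: total_def)
        then have "a + b \<noteq> 0" by metis
        then show ?thesis using that add_in by blast
      qed
      then have "{a + b | a b. a \<in> supp r \<and> b \<in> supp f} \<subseteq> S - {0}"
        using r unfolding graded_max_ideal_def by auto
      then show ?thesis
        using supp_mult[of r f] unfolding graded_max_ideal_def by (simp only: mem_Collect_eq)
    qed
  qed (auto simp: graded_max_ideal_def)
  moreover have "{u, v} \<subseteq> ?M"
    using e_in_S D_pos by (auto simp: graded_max_ideal_def)
  ultimately have M: "Idl\<^bsub>?R\<^esub> {u, v} \<subseteq> ?M" by (intro R.genideal_minimal)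
  have idl: "ideal (Idl\<^bsub>?R\<^esub> {u, v}) ?R" by (rule R.genideal_ideal) (use e_in_S in simp)
  have one: "1 \<notin> Idl\<^bsub>?R\<^esub> {u, v}" using M by (auto simp: graded_max_ideal_def)
  have "regular_sequence ?R [poly_at u [:0, 1:], poly_at v [:0, 1:]]"
    by (rule regular_sequence_poly_at) (use one supp_one_in in \<open>auto simp: poly_at_pCons\<close>)
  then have reg: "regular_sequence ?R [u, v]" by (simp add: poly_at_pCons)
  obtain P where P: "primeideal P ?R" "Idl\<^bsub>?R\<^esub> {u, v} \<subseteq> P"
    by (rule R.prime_ideal_avoiding[OF idl, of "{1}"]) (use one supp_one_in in auto)
  have "{u, v} \<subseteq> P" using R.genideal_self[of "{u, v}"] P(2) e_in_S by auto
  then obtain p where "prime_chain ?R (length [u, v :: 'k laurent]) p"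
    using R.regular_sequence_imp_prime_chain[OF reg P(1)] by auto
  then have "enat (length [u, v :: 'k laurent]) \<le> krull_dim ?R"
    unfolding krull_dim_def by (intro Sup_upper) blast
  then show "2 \<le> krull_dim ?R" by (simp add: numeral_eq_enat numeral_2_eq_2)
qed

lemma semigroup_dim_S: "semigroup_dim TYPE('k::field) S = 2"
  by (simp add: semigroup_dim_def krull_dim_S numeral_eq_enat)

end

section \<open>Top local cohomology\<close>

context monomial_curve begin

text \<open>
The group generated by \<open>S\<close>, followed by the localizations of \<open>S\<close> at the two extremal generators.
\<close>

definition S_group :: "expo set" where
  "S_group = {pt x y | x y. D dvd x + y}"

definition S_u :: "expo set" where
  "S_u = {pt x y | x y. D dvd x + y \<and> Y (x mod D) \<le> y}"

definition S_v :: "expo set" where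
  "S_v = {pt x y | x y. D dvd x + y \<and> X (x mod D) \<le> x}"

lemma S_subset_group: "S \<subseteq> S_group" "S_u \<subseteq> S_group" "S_v \<subseteq> S_group"
  by (auto simp: S_group_def S_eq S_u_def S_v_def in_S_def)

lemma group_add: "a \<in> S_group \<Longrightarrow> b \<in> S_group \<Longrightarrow> a + b \<in> S_group"
proof -
  assume "a \<in> S_group" "b \<in> S_group"
  then obtain x y x' y' where *: "a = pt x y" "D dvd x + y" "b = pt x' y'" "D dvd x' + y'"
    by (auto simp: S_group_def)
  then have "D dvd (x + x') + (y + y')" using dvd_add[OF *(2,4)] by (simp add: algebra_simps)
  then show ?thesis unfolding * pt_add S_group_def by blast
qed

lemma group_uminus: "a \<in> S_group \<Longrightarrow> - a \<in> S_group"
proof -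
  assume "a \<in> S_group"
  then obtain x y where *: "a = pt x y" "D dvd x + y" by (auto simp: S_group_def)
  then have "D dvd - x + - y" by (metis dvd_minus_iff minus_add_distrib)
  then show ?thesis unfolding * pt_uminus S_group_def by blast
qed

definition bound :: int where
  "bound = Max (X ` {0..<D} \<union> Y ` {0..<D})"

lemma XY_le_bound: "X (x mod D) \<le> bound" "Y (x mod D) \<le> bound"
  unfolding bound_def using residue[of x] by (auto intro!: Max_ge)

lemma prod_mon_power:
  "(\<Prod>g\<in>F. Poly_Mapping.single g 1) ^ N = (mon (of_nat N * (\<Sum>g\<in>F. g)) :: 'k::field laurent)"
proof -
  have "(\<Prod>g\<in>F. Poly_Mapping.single g 1) = (mon (\<Sum>g\<in>F. g) :: 'k laurent)"
    by (induction F rule: infinite_finite_induct) (simp_all add: mult_single)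
  then show ?thesis by (induction N) (simp_all add: mult_single distrib_right)
qed

lemma supp_mon_mult_subset_iff: "supp (mon t * f) \<subseteq> Z \<longleftrightarrow> (\<forall>a\<in>supp f. t + a \<in> Z)"
proof
  show "supp (mon t * f) \<subseteq> Z" if *: "\<forall>a\<in>supp f. t + a \<in> Z"
    using supp_mult[of "mon t" f] * by auto
  show "\<forall>a\<in>supp f. t + a \<in> Z" if *: "supp (mon t * f) \<subseteq> Z"
    using * by (auto simp: in_keys_iff coef_mon_mult)
qed

lemma of_nat_mult_pt: "of_nat N * pt x y = pt (int N * x) (int N * y)"
  by (induction N) (simp_all add: pt_zero distrib_right)

lemma localization_iff:
  assumes "(\<Sum>g\<in>F. g) = pt x y"
  shows "f \<in> localization S F \<longleftrightarrow> (\<exists>N. \<forall>a\<in>supp f. pt (int N * x) (int N * y) + a \<in> S)"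
  by (simp add: localization_def prod_mon_power supp_mon_mult_subset_iff assms of_nat_mult_pt)

lemma in_localizationI:
  assumes "(\<Sum>g\<in>F. g) = pt x y"
    and "\<And>a. a \<in> supp f \<Longrightarrow> \<exists>N0. \<forall>N\<ge>N0. pt (int N * x) (int N * y) + a \<in> S"
  shows "f \<in> localization S F"
proof -
  obtain N0 where N0: "\<And>a N. a \<in> supp f \<Longrightarrow> N0 a \<le> N \<Longrightarrow> pt (int N * x) (int N * y) + a \<in> S"
    using assms(2) by metis
  have "pt (int (Max (N0 ` supp f)) * x) (int (Max (N0 ` supp f)) * y) + a \<in> S" if "a \<in> supp f" for a
    by (rule N0[OF that]) (use that in \<open>auto intro!: Max_ge\<close>)
  then show ?thesis unfolding localization_iff[OF assms(1)] by blast
qed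

lemma large_multiple: "0 < (p::int) \<Longrightarrow> nat (b - x) \<le> N \<Longrightarrow> b \<le> int N * p + x"
proof -
  assume "0 < p" "nat (b - x) \<le> N"
  then have "int N * 1 \<le> int N * p" by (intro mult_left_mono) auto
  then show ?thesis using \<open>nat (b - x) \<le> N\<close> by linarith
qed

lemma gens_in_group: "g \<in> gens \<Longrightarrow> g \<in> S_group"
  by (auto simp: gens_def S_group_def)

lemma localization_in_group:
  assumes "F \<subseteq> gens" "f \<in> localization S F" shows "supp f \<subseteq> S_group"
proof
  fix a assume a: "a \<in> supp f"
  have "(\<Sum>g\<in>F. g) \<in> S_group" if "finite F" "F \<subseteq> gens" for F
    using that
  proof induction
    case empty
    have "D dvd 0 + 0" by simp
    then have "pt 0 0 \<in> S_group" unfolding S_group_def by blast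
    then show ?case by (simp add: pt_zero)
  next
    case (insert g F)
    then show ?case using group_add gens_in_group by simp
  qed
  then have "(\<Sum>g\<in>F. g) \<in> S_group" using assms(1) gens_nonneg(1) finite_subset by metis
  then obtain x y where xy: "(\<Sum>g\<in>F. g) = pt x y" "D dvd x + y" by (auto simp: S_group_def)
  then obtain N where "pt (int N * x) (int N * y) + a \<in> S"
    using assms(2) a localization_iff by blast
  moreover have "- pt (int N * x) (int N * y) \<in> S_group"
    by (rule group_uminus) (use xy(2) in \<open>auto simp: S_group_def simp flip: distrib_left\<close>)
  ultimately have "- pt (int N * x) (int N * y) + (pt (int N * x) (int N * y) + a) \<in> S_group"
    by (rule group_add[OF _ subsetD[OF S_subset_group(1)], rotated])
  then show "a \<in> S_group" by (simp only: minus_add_cancel)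
qed

lemma group_in_localization:
  assumes "(\<Sum>g\<in>F. g) = pt p q" "0 < p" "0 < q" "D dvd p + q" "supp f \<subseteq> S_group"
  shows "f \<in> localization S F"
proof (rule in_localizationI[OF assms(1)])
  fix a assume "a \<in> supp f"
  then obtain x y where a: "a = pt x y" "D dvd x + y" using assms(5) by (auto simp: S_group_def)
  have "in_S (int N * p + x) (int N * q + y)"
    if N: "max (nat (bound - x)) (nat (bound - y)) \<le> N" for N
  proof -
    have "bound \<le> int N * p + x" "bound \<le> int N * q + y"
      by (intro large_multiple assms(2,3), use N in simp)+
    moreover have "D dvd int N * (p + q) + (x + y)" using assms(4) a(2) by auto
    ultimately show ?thesis
      using XY_le_bound[of "int N * p + x"] by (simp add: in_S_def algebra_simps)
  qed
  then show "\<exists>N0. \<forall>N\<ge>N0. pt (int N * p) (int N * q) + a \<in> S"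
    unfolding a pt_add pt_in_S_iff by blast
qed

abbreviation e1 :: expo where "e1 \<equiv> pt D 0"
abbreviation e2 :: expo where "e2 \<equiv> pt 0 D"

lemma e_in_gens: "e1 \<in> gens" "e2 \<in> gens" "e1 \<noteq> e2"
  using A_ends D_pos unfolding gens_def by (force, force, simp)

text \<open>
Two distinct generators add up to a vector in the open quadrant; its multiples eventually carry
every point of the group into \<open>S\<close>.
\<close>

lemma group_in_localization_pair:
  assumes "g \<in> gens" "h \<in> gens" "g \<noteq> h" "supp f \<subseteq> S_group" shows "f \<in> localization S {g, h}"
proof -
  obtain a b where ab: "a \<in> A" "b \<in> A" "g = pt a (D - a)" "h = pt b (D - b)" "a \<noteq> b"
    using assms by (auto simp: gens_def)
  then have "0 \<le> a" "a \<le> D" "0 \<le> b" "b \<le> D" using A_bounds by auto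
  then show ?thesis
    using ab by (intro group_in_localization[of _ "a + b" "2 * D - a - b"] assms) auto
qed

lemma group_in_localization_interior:
  assumes "g \<in> gens" "g \<noteq> e1" "g \<noteq> e2" "supp f \<subseteq> S_group" shows "f \<in> localization S {g}"
proof -
  obtain a where a: "a \<in> A" "g = pt a (D - a)" using assms by (auto simp: gens_def)
  then have "0 \<le> a" "a \<le> D" "a \<noteq> 0" "a \<noteq> D" using A_bounds assms by auto
  then show ?thesis using a by (intro group_in_localization[of _ a "D - a"] assms) auto
qed

lemma localization_u: "f \<in> localization S {e1} \<longleftrightarrow> supp f \<subseteq> S_u"
proof
  assume "f \<in> localization S {e1}"
  then obtain N where N: "\<And>a. a \<in> supp f \<Longrightarrow> pt (int N * D) 0 + a \<in> S"
    using localization_iff[of "{e1}" D 0 f] by auto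
  show "supp f \<subseteq> S_u"
  proof
    fix a assume a: "a \<in> supp f"
    then obtain x y where xy: "a = pt x y" "D dvd x + y"
      using localization_in_group[OF _ \<open>f \<in> localization S {e1}\<close>] e_in_gens(1) by (auto simp: S_group_def)
    then show "a \<in> S_u" using N[OF a] by (auto simp: S_u_def in_S_def)
  qed
next
  assume f: "supp f \<subseteq> S_u"
  show "f \<in> localization S {e1}"
  proof (rule in_localizationI)
    fix a assume "a \<in> supp f"
    then obtain x y where a: "a = pt x y" "D dvd x + y" "Y (x mod D) \<le> y"
      using f by (auto simp: S_u_def)
    have "in_S (int N * D + x) y" if "nat (bound - x) \<le> N" for N
      using large_multiple[OF D_pos that] XY_le_bound(1)[of x] a
      by (simp add: in_S_def add.assoc)
    then show "\<exists>N0. \<forall>N\<ge>N0. pt (int N * D) (int N * 0) + a \<in> S" unfolding a by auto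
  qed simp
qed

lemma localization_v: "f \<in> localization S {e2} \<longleftrightarrow> supp f \<subseteq> S_v"
proof
  assume "f \<in> localization S {e2}"
  then obtain N where N: "\<And>a. a \<in> supp f \<Longrightarrow> pt 0 (int N * D) + a \<in> S"
    using localization_iff[of "{e2}" 0 D f] by auto
  show "supp f \<subseteq> S_v"
  proof
    fix a assume a: "a \<in> supp f"
    then obtain x y where xy: "a = pt x y" "D dvd x + y"
      using localization_in_group[OF _ \<open>f \<in> localization S {e2}\<close>] e_in_gens(2) by (auto simp: S_group_def)
    then show "a \<in> S_v" using N[OF a] by (auto simp: S_v_def in_S_def)
  qed
next
  assume f: "supp f \<subseteq> S_v"
  show "f \<in> localization S {e2}"
  proof (rule in_localizationI)
    fix a assume "a \<in> supp f"
    then obtain x y where a: "a = pt x y" "D dvd x + y" "X (x mod D) \<le> x"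
      using f by (auto simp: S_v_def)
    have "in_S x (int N * D + y)" if "nat (bound - y) \<le> N" for N
    proof -
      have "D dvd (x + y) + int N * D" using a(2) by simp
      then show ?thesis
        using large_multiple[OF D_pos that] XY_le_bound(2)[of x] a
        by (simp add: in_S_def algebra_simps)
    qed
    then show "\<exists>N0. \<forall>N\<ge>N0. pt (int N * 0) (int N * D) + a \<in> S" unfolding a by auto
  qed simp
qed

subsection \<open>Cocycles\<close>

text \<open>
Functions on the generators are turned into alternating cochains of degree 1, and their differences
into cochains of degree 2. The former are not required to take values in the localizations, so that
all 2-cocycles, not only coboundaries, are of the form \<open>edge y\<close>.
\<close>

definition vertex :: "(expo \<Rightarrow> 'k::field laurent) \<Rightarrow> 'k cochain" where
  "vertex y F = (if F \<subseteq> gens \<and> card F = 1 then y (the_elem F) else 0)"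

definition edge :: "(expo \<Rightarrow> 'k::field laurent) \<Rightarrow> 'k cochain" where
  "edge y F = (if F \<subseteq> gens \<and> card F = 2 then y (Max F) - y (Min F) else 0)"

lemma card_2_linorder:
  assumes "card F = 2" obtains g h where "F = {g, h}" "g < (h :: 'a::linorder)"
  using assms by (auto simp: card_2_iff) (metis insert_commute linorder_neqE)

lemma card_3_linorder:
  assumes "card F = 3" obtains g h k where "F = {g, h, k}" "g < h" "h < (k :: 'a::linorder)"
proof -
  have fin: "finite F" using assms by (simp add: card_ge_0_finite)
  have ne: "F \<noteq> {}" using assms by auto
  have "card (F - {Min F}) = 2" using assms fin ne by simp
  then obtain h k where hk: "F - {Min F} = {h, k}" "h < k" by (rule card_2_linorder)
  then have "h \<in> F" "h \<noteq> Min F" by auto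
  then have "Min F < h" using fin by (simp add: order_less_le)
  moreover have "F = {Min F, h, k}" using hk(1) ne fin by (metis Min_in insert_Diff)
  ultimately show ?thesis using that hk(2) by blast
qed

lemma edge_pair: "g \<in> gens \<Longrightarrow> h \<in> gens \<Longrightarrow> g < h \<Longrightarrow> edge y {g, h} = y h - y g"
  using less_imp_le[of g h] by (simp add: edge_def max_def min_def)

lemma edge_outside: "\<not> (F \<subseteq> gens \<and> card F = 2) \<Longrightarrow> edge y F = 0"
  by (simp only: edge_def if_False)

lemma edge_eqI:
  assumes "\<And>g h. g \<in> gens \<Longrightarrow> h \<in> gens \<Longrightarrow> g < h \<Longrightarrow> z {g, h} = y h - y g"
    and "\<And>F. \<not> (F \<subseteq> gens \<and> card F = 2) \<Longrightarrow> z F = 0"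
  shows "z = edge y"
proof
  fix F show "z F = edge y F"
  proof (cases "F \<subseteq> gens \<and> card F = 2")
    case True
    then obtain g h where "F = {g, h}" "g < h" using card_2_linorder by blast
    then show ?thesis using True assms(1)[of g h] edge_pair[of g h y] by simp
  next
    case False
    then show ?thesis using assms(2) by (auto simp: edge_def)
  qed
qed

lemma coboundary_map_pair:
  assumes "g \<in> gens" "h \<in> gens" "g < h"
  shows "coboundary_map S z {g, h} = z {h} - z {g}"
proof -
  have *: "{x. (x = g \<or> x = h) \<and> x < g} = {}" "{x. (x = g \<or> x = h) \<and> x < h} = {g}"
    using assms(3) by auto
  have "{g, h} - {g} = {h}" "{g, h} - {h} = {g}" using assms(3) by auto
  then show ?thesis using assms by (simp add: coboundary_map_def min_gens_S *)
qed

lemma coboundary_map_triple: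
  assumes "g \<in> gens" "h \<in> gens" "k \<in> gens" "g < h" "h < k"
  shows "coboundary_map S z {g, h, k} = z {h, k} - z {g, k} + z {g, h}"
proof -
  have *: "{x. (x = g \<or> x = h \<or> x = k) \<and> x < g} = {}"
    "{x. (x = g \<or> x = h \<or> x = k) \<and> x < h} = {g}"
    "{x. (x = g \<or> x = h \<or> x = k) \<and> x < k} = {g, h}"
    using assms(4,5) by auto
  have "g \<noteq> h" "g \<noteq> k" "h \<noteq> k" using assms(4,5) by auto
  moreover have "{g, h, k} - {g} = {h, k}" "{g, h, k} - {h} = {g, k}" "{g, h, k} - {k} = {g, h}"
    using calculation by auto
  ultimately show ?thesis using assms(1-3) by (simp add: coboundary_map_def min_gens_S *)
qed

lemma coboundary_map_wrong_card:
  assumes "\<And>F. card F \<noteq> n \<Longrightarrow> z F = 0" "card F \<noteq> Suc n"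
  shows "coboundary_map S z F = 0"
proof (cases "F \<subseteq> gens")
  case True
  have "z (F - {g}) = 0" if "g \<in> F" for g
  proof -
    have "finite F" using True gens_nonneg(1) finite_subset by blast
    then have "card F = Suc (card (F - {g}))" using that by (metis card.remove)
    then show ?thesis using assms by auto
  qed
  then show ?thesis by (simp add: coboundary_map_def)
qed (simp add: coboundary_map_def min_gens_S)

lemma coboundary_map_outside: "\<not> F \<subseteq> gens \<Longrightarrow> coboundary_map S z F = 0"
  by (simp add: coboundary_map_def min_gens_S)

lemma coboundary_map_vertex: "coboundary_map S (vertex y) = edge y"
proof (rule edge_eqI)
  show "coboundary_map S (vertex y) {g, h} = y h - y g" if "g \<in> gens" "h \<in> gens" "g < h" for g h
    using that by (simp add: coboundary_map_pair vertex_def)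
  show "coboundary_map S (vertex y) F = 0" if "\<not> (F \<subseteq> gens \<and> card F = 2)" for F
    using that coboundary_map_outside[of F] coboundary_map_wrong_card[of 1 "vertex y" F]
    by (auto simp: vertex_def)
qed

lemma coboundary_map_edge: "coboundary_map S (edge y) = (\<lambda>_. 0)"
proof
  fix F show "coboundary_map S (edge y) F = 0"
  proof (cases "F \<subseteq> gens \<and> card F = 3")
    case True
    then obtain g h k where F: "F = {g, h, k}" "g < h" "h < k" using card_3_linorder by blast
    then show ?thesis using True edge_pair[of g h y] edge_pair[of g k y] edge_pair[of h k y]
      by (simp add: coboundary_map_triple)
  next
    case False
    then show ?thesis
      using coboundary_map_outside[of F] coboundary_map_wrong_card[of 2 "edge y" F]
      by (auto simp: edge_def)
  qed
qed

lemma coboundaries_2: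
  "coboundaries S 2 = {edge y | y. \<forall>g\<in>gens. y g \<in> localization S {g}}"
proof (intro equalityI subsetI)
  fix z :: "'a cochain" assume "z \<in> coboundaries S 2"
  then obtain c where c: "c \<in> cochains S 1" "z = coboundary_map S c"
    by (auto simp: coboundaries_def numeral_2_eq_2)
  have "c F = vertex (\<lambda>g. c {g}) F" for F
  proof (cases "F \<subseteq> gens \<and> card F = 1")
    case True
    then obtain g where "F = {g}" by (auto simp: card_1_singleton_iff)
    then show ?thesis using True by (simp add: vertex_def)
  next
    case False
    then show ?thesis using c(1) by (auto simp: vertex_def cochains_def min_gens_S)
  qed
  then have "c = vertex (\<lambda>g. c {g})" by blast
  then have "z = edge (\<lambda>g. c {g})" using c(2) coboundary_map_vertex by metis
  moreover have "c {g} \<in> localization S {g}" if "g \<in> gens" for g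
  proof -
    have "if {g} \<subseteq> min_gens S \<and> card {g} = 1 then c {g} \<in> localization S {g} else c {g} = 0"
      using c(1) unfolding cochains_def by blast
    then show ?thesis using that by (simp add: min_gens_S)
  qed
  ultimately show "z \<in> {edge y | y. \<forall>g\<in>gens. y g \<in> localization S {g}}" by blast
next
  fix z :: "'a cochain" assume "z \<in> {edge y | y. \<forall>g\<in>gens. y g \<in> localization S {g}}"
  then obtain y where y: "z = edge y" "\<And>g. g \<in> gens \<Longrightarrow> y g \<in> localization S {g}" by blast
  have "vertex y \<in> cochains S 1"
    using y(2) by (auto simp: cochains_def vertex_def min_gens_S card_1_singleton_iff)
  then show "z \<in> coboundaries S 2"
    using imageI[of "vertex y" "cochains S 1" "coboundary_map S"] y(1)
    by (simp add: coboundaries_def numeral_2_eq_2 coboundary_map_vertex)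
qed

definition alternating :: "'k::field cochain \<Rightarrow> expo \<Rightarrow> expo \<Rightarrow> 'k laurent" where
  "alternating z g h = (if g < h then z {g, h} else if h < g then - z {g, h} else 0)"

lemma cochains_2_iff:
  fixes z :: "'a::field cochain"
  shows "z \<in> cochains S 2 \<longleftrightarrow>
    (\<forall>F. if F \<subseteq> gens \<and> card F = 2 then supp (z F) \<subseteq> S_group else z F = 0)"
proof -
  have "f \<in> localization S F \<longleftrightarrow> supp f \<subseteq> S_group"
    if "F \<subseteq> gens" "card F = 2" for f :: "'a laurent" and F
    using card_2_linorder[OF that(2)] group_in_localization_pair[of _ _ f]
      localization_in_group[OF that(1), of f] that(1)
    by (metis insert_subset less_irrefl)
  then show ?thesis
    unfolding cochains_def min_gens_S mem_Collect_eq by (intro all_cong1 if_cong refl) blast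
qed

lemma supp_alternating:
  assumes z: "z \<in> cochains S 2" and "g \<in> gens" "h \<in> gens"
  shows "supp (alternating z g h) \<subseteq> S_group"
proof (cases "g = h")
  case False
  then have "supp (z {g, h}) \<subseteq> S_group"
    using z[unfolded cochains_2_iff, rule_format, of "{g, h}"] assms(2,3) by simp
  then show ?thesis by (auto simp: alternating_def)
qed (simp add: alternating_def)

text \<open>
The cone construction with apex \<open>e1\<close>. In the statement the sign conventions are absorbed by
\<open>alternating\<close>; in the proof they force a case distinction on the position of \<open>e1\<close>.
\<close>

lemma cocycle_eq_edge:
  assumes "z \<in> cocycles S 2"
  shows "z = edge (\<lambda>g. alternating z e1 g)"
proof (rule edge_eqI)
  have z: "z \<in> cochains S 2" "\<And>F. coboundary_map S z F = 0"
    using assms by (auto simp: cocycles_def dest: fun_cong)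
  show "z F = 0" if "\<not> (F \<subseteq> gens \<and> card F = 2)" for F
    using z(1)[unfolded cochains_2_iff, rule_format, of F] that by (simp split: if_splits)
  fix g h assume gh: "g \<in> gens" "h \<in> gens" "g < h"
  have tri: "z {b, c} - z {a, c} + z {a, b} = 0"
    if "a \<in> gens" "b \<in> gens" "c \<in> gens" "a < b" "b < c" for a b c
    using coboundary_map_triple[OF that, of z] z(2) by simp
  consider "e1 = g" | "e1 = h" | "e1 < g" | "g < e1" "e1 < h" | "h < e1"
    by (metis linorder_neqE)
  then show "z {g, h} = alternating z e1 h - alternating z e1 g"
  proof cases
    case 1 then show ?thesis using gh by (simp add: alternating_def)
  next
    case 2 then show ?thesis using gh by (simp add: alternating_def insert_commute not_less_iff_gr_or_eq)
  next
    case 3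
    then show ?thesis using tri[OF e_in_gens(1) gh(1,2)] gh(3) less_trans[OF 3 gh(3)]
      by (simp add: alternating_def algebra_simps)
  next
    case 4
    then show ?thesis using tri[OF gh(1) e_in_gens(1) gh(2)]
      by (simp add: alternating_def algebra_simps insert_commute less_not_sym)
  next
    case 5
    then have "g < e1" using gh(3) by simp
    then show ?thesis using tri[OF gh(1,2) e_in_gens(1)] gh(3) 5
      by (simp add: alternating_def algebra_simps insert_commute less_not_sym)
  qed
qed

text \<open>
Modulo coboundaries a 2-cocycle is determined by its value on the pair of extremal generators,
because the localization at any other generator is the whole group ring. Hence the top local
cohomology is the space of Laurent polynomials on the group modulo those supported on \<open>S_u\<close> and those
supported on \<open>S_v\<close>, just as for the Cech complex of the parameters \<open>u\<close> and \<open>v\<close>. The map \<open>rep\<close> below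
is a section of \<open>val\<close>.
\<close>

definition val :: "'k::field cochain \<Rightarrow> 'k laurent" where
  "val z = alternating z e1 e2"

lemma val_edge: "val (edge y) = y e2 - y e1"
  using e_in_gens edge_pair[of e1 e2 y] edge_pair[of e2 e1 y]
  by (auto simp: val_def alternating_def insert_commute not_less_iff_gr_or_eq)

lemma val_add: "val (\<lambda>F. y F + z F) = val y + val z"
  by (simp add: val_def alternating_def)

lemma val_mult: "val (\<lambda>F. r * z F) = r * val z"
  by (simp add: val_def alternating_def)

lemma supp_val: "z \<in> cocycles S 2 \<Longrightarrow> supp (val z) \<subseteq> S_group"
  unfolding val_def using supp_alternating e_in_gens by (auto simp: cocycles_def simp del: subsetI)

definition rep :: "'k::field laurent \<Rightarrow> 'k cochain" where
  "rep f = edge (\<lambda>g. if g = e2 then f else 0)"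

lemma val_rep [simp]: "val (rep f) = f"
  using D_pos by (simp add: rep_def val_edge)

lemma edge_add: "edge (\<lambda>g. y g + y' g) = (\<lambda>F. edge y F + edge y' F)"
  by (rule ext) (simp add: edge_def)

lemma edge_mult: "edge (\<lambda>g. r * y g) = (\<lambda>F. r * edge y F)"
  by (rule ext) (simp add: edge_def right_diff_distrib)

lemma rep_add: "rep (f + g) = (\<lambda>F. rep f F + rep g F)"
  unfolding rep_def edge_add[symmetric] by (rule arg_cong[of _ _ edge]) auto

lemma rep_mult: "rep (r * f) = (\<lambda>F. r * rep f F)"
  unfolding rep_def edge_mult[symmetric] by (rule arg_cong[of _ _ edge]) auto

lemma edge_shift: "(\<And>g. g \<in> gens \<Longrightarrow> y g = y' g + c) \<Longrightarrow> edge y = edge y'"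
proof (rule edge_eqI)
  show "edge y F = 0" if "\<not> (F \<subseteq> gens \<and> card F = 2)" for F by (rule edge_outside[OF that])
qed (simp add: edge_pair)

lemma edge_in_cocycles:
  assumes "\<And>g. g \<in> gens \<Longrightarrow> supp (y g) \<subseteq> S_group" shows "edge y \<in> cocycles S 2"
proof -
  have "supp (edge y F) \<subseteq> S_group" if F: "F \<subseteq> gens" "card F = 2" for F
  proof -
    obtain g h where gh: "F = {g, h}" "g < h" using card_2_linorder[OF F(2)] by blast
    have "supp (y h - y g) \<subseteq> supp (y h) \<union> supp (y g)" by (rule Poly_Mapping.keys_diff)
    also have "\<dots> \<subseteq> S_group" using assms gh F by simp
    finally show ?thesis using gh F edge_pair[of g h y] by simp
  qed
  then show ?thesis
    by (simp add: cocycles_def cochains_2_iff coboundary_map_edge) (simp add: edge_def)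
qed

lemma rep_in_cocycles: "supp f \<subseteq> S_group \<Longrightarrow> rep f \<in> cocycles S 2"
  unfolding rep_def by (rule edge_in_cocycles) simp

lemma localizationI:
  assumes "g \<in> gens" "supp f \<subseteq> S_group" "g = e1 \<Longrightarrow> supp f \<subseteq> S_u" "g = e2 \<Longrightarrow> supp f \<subseteq> S_v"
  shows "f \<in> localization S {g}"
  using assms group_in_localization_interior[of g f] localization_u[of f] localization_v[of f]
  by blast

lemma rep_in_coboundaries:
  assumes "supp f \<subseteq> S_u \<or> supp f \<subseteq> S_v" shows "rep f \<in> coboundaries S 2"
proof (cases "supp f \<subseteq> S_u")
  case True
  \<comment> \<open>Subtracting the constant \<open>f\<close> moves the value from \<open>e2\<close> to all the other generators,
    among which only \<open>e1\<close> has a localization smaller than the group ring.\<close>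
  let ?y = "\<lambda>g. if g = e2 then 0 else - f"
  have "rep f = edge ?y" unfolding rep_def by (rule edge_shift[where c = f]) auto
  moreover have "?y g \<in> localization S {g}" if "g \<in> gens" for g
    using that True S_subset_group(2) by (intro localizationI) (auto simp del: subsetI)
  ultimately show ?thesis unfolding coboundaries_2 by blast
next
  case False
  then have f: "supp f \<subseteq> S_v" using assms by blast
  have "(if g = e2 then f else 0) \<in> localization S {g}" if "g \<in> gens" for g
    using that f S_subset_group(3) D_pos by (intro localizationI) (auto simp del: subsetI)
  then show ?thesis unfolding coboundaries_2 rep_def by blast
qed

lemma val_coboundary:
  assumes "z \<in> coboundaries S 2"
  obtains f g where "val z = f - g" "supp f \<subseteq> S_v" "supp g \<subseteq> S_u"
proof -
  obtain y where "z = edge y" "\<And>g. g \<in> gens \<Longrightarrow> y g \<in> localization S {g}"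
    using assms unfolding coboundaries_2 by blast
  then show ?thesis
    using that[of "y e2" "y e1"] e_in_gens val_edge[of y] localization_u localization_v by metis
qed

text \<open>
The function \<open>y\<close> of which this is the edge cochain vanishes at both extremal generators.
\<close>

lemma cocycle_minus_rep_val:
  assumes z: "z \<in> cocycles S 2"
  shows "(\<lambda>F. z F + - 1 * rep (val z) F) \<in> coboundaries S 2"
proof -
  let ?y = "\<lambda>g. alternating z e1 g + - 1 * (if g = e2 then val z else 0)"
  have "(\<lambda>F. z F + - 1 * rep (val z) F) = edge ?y"
    unfolding edge_add edge_mult rep_def using cocycle_eq_edge[OF z] by metis
  moreover have "?y g \<in> localization S {g}" if g: "g \<in> gens" for g
  proof (cases "g = e2")
    case True
    then show ?thesis using g D_pos by (intro localizationI) (auto simp: val_def)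
  next
    case False
    have "z \<in> cochains S 2" using z by (simp add: cocycles_def)
    then show ?thesis using g False supp_alternating[of z e1 g] e_in_gens
      by (intro localizationI) (auto simp: alternating_def simp del: subsetI)
  qed
  ultimately show ?thesis unfolding coboundaries_2 by blast
qed

lemma cocycles_add:
  assumes "y \<in> cocycles S 2" "z \<in> cocycles S 2" shows "(\<lambda>F. y F + z F) \<in> cocycles S 2"
proof -
  let ?e = "\<lambda>z g. alternating z e1 g"
  have "(\<lambda>F. y F + z F) = edge (\<lambda>g. ?e y g + ?e z g)"
    unfolding edge_add using cocycle_eq_edge assms by metis
  also have "\<dots> \<in> cocycles S 2"
  proof (rule edge_in_cocycles)
    fix g assume "g \<in> gens"
    then have "supp (?e y g) \<subseteq> S_group" "supp (?e z g) \<subseteq> S_group"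
      by (intro supp_alternating e_in_gens(1); use assms in \<open>simp add: cocycles_def\<close>)+
    then show "supp (?e y g + ?e z g) \<subseteq> S_group" using Poly_Mapping.keys_add[of "?e y g"] by blast
  qed
  finally show ?thesis .
qed

lemma cocycles_mult:
  assumes r: "supp r \<subseteq> S" and z: "z \<in> cocycles S 2" shows "(\<lambda>F. r * z F) \<in> cocycles S 2"
proof -
  let ?e = "\<lambda>g. alternating z e1 g"
  have "(\<lambda>F. r * z F) = edge (\<lambda>g. r * ?e g)"
    unfolding edge_mult using cocycle_eq_edge z by metis
  also have "\<dots> \<in> cocycles S 2"
  proof (rule edge_in_cocycles)
    fix g assume "g \<in> gens"
    then have "supp (?e g) \<subseteq> S_group"
      by (intro supp_alternating e_in_gens(1); use z in \<open>simp add: cocycles_def\<close>)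
    then have "{a + b | a b. a \<in> supp r \<and> b \<in> supp (?e g)} \<subseteq> S_group"
      using r S_subset_group(1) group_add by blast
    then show "supp (r * ?e g) \<subseteq> S_group" using supp_mult[of r "?e g"] by (rule order_trans[rotated])
  qed
  finally show ?thesis .
qed

end

section \<open>The canonical module\<close>

context monomial_curve begin

text \<open>
The exponents of the canonical module: the negatives of the exponents of the top local cohomology.
\<close>

definition W :: "expo set" where
  "W = {w \<in> S_group. - w \<notin> S_u \<and> - w \<notin> S_v}"

text \<open>
Membership in a localization does not depend on the field, so any field serves to transfer it to
exponents.
\<close>

lemma S_u_iff: "a \<in> S_u \<longleftrightarrow> (\<exists>N. pt (int N * D) 0 + a \<in> S)"
  using localization_u[of "mon a :: rat laurent"] localization_iff[of "{e1}" D 0 "mon a :: rat laurent"]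
  by simp

lemma S_v_iff: "a \<in> S_v \<longleftrightarrow> (\<exists>N. pt 0 (int N * D) + a \<in> S)"
  using localization_v[of "mon a :: rat laurent"] localization_iff[of "{e2}" 0 D "mon a :: rat laurent"]
  by simp

lemma S_add_S_uv: "s \<in> S \<Longrightarrow> a \<in> S_u \<Longrightarrow> s + a \<in> S_u" "s \<in> S \<Longrightarrow> a \<in> S_v \<Longrightarrow> s + a \<in> S_v"
  unfolding S_u_iff S_v_iff using add_in by (metis add.left_commute)+

sublocale canonical: expo_module S W
proof
  fix s w assume sw: "s \<in> S" "w \<in> W"
  have "- w = s + - (s + w)" by simp
  then have "- (s + w) \<notin> S_u" "- (s + w) \<notin> S_v"
    using sw S_add_S_uv[OF sw(1)] unfolding W_def by (metis (no_types, lifting) mem_Collect_eq)+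
  moreover have "s + w \<in> S_group" using sw S_subset_group(1) group_add unfolding W_def by blast
  ultimately show "s + w \<in> W" by (simp add: W_def)
qed

lemma finite_W_degree: "finite {w \<in> W. total w = n}"
proof (rule finite_subset)
  let ?I = "{- bound..n + bound}"
  show "{w \<in> W. total w = n} \<subseteq> (\<lambda>x. pt x (n - x)) ` ?I"
  proof
    fix w assume "w \<in> {w \<in> W. total w = n}"
    then have wW: "w \<in> S_group" "- w \<notin> S_u" "- w \<notin> S_v" "total w = n" by (simp_all add: W_def)
    obtain x y where xy: "w = pt x y" "D dvd x + y" using wW(1) unfolding S_group_def by blast
    then have w: "w = pt x y" "D dvd x + y" "x + y = n"
      "pt (- x) (- y) \<notin> S_u" "pt (- x) (- y) \<notin> S_v"
      using wW by simp_all
    have "D dvd - (x + y)" using w(2) by (simp only: dvd_minus_iff)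
    then have "D dvd - x + - y" by (simp only: minus_add_distrib)
    then have "\<not> Y ((- x) mod D) \<le> - y" "\<not> X ((- x) mod D) \<le> - x"
      using w(4,5) unfolding S_u_def S_v_def by blast+
    then have "- y < bound" "- x < bound" using XY_le_bound[of "- x"] by linarith+
    then show "w \<in> (\<lambda>x. pt x (n - x)) ` ?I" using w by (intro image_eqI[of _ _ x]) auto
  qed
qed simp

subsection \<open>The grading\<close>

lemma degree_part_total:
  assumes "a \<in> degree_part S i" shows "total a = D * i"
proof -
  obtain c where c: "(\<Sum>g\<in>gens. c g) = i"
    "\<And>k. Poly_Mapping.lookup a k = (\<Sum>g\<in>gens. c g * Poly_Mapping.lookup g k)"
    using assms unfolding degree_part_def min_gens_S by blast
  have "total a = (\<Sum>g\<in>gens. c g * total g)"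
    by (simp add: total_def c(2) distrib_left sum.distrib)
  also have "\<dots> = (\<Sum>g\<in>gens. c g * D)"
    by (rule sum.cong) (auto simp: gens_def)
  finally show ?thesis using c(1) by (simp add: sum_distrib_right[symmetric])
qed

lemma degree_part_add:
  assumes "a \<in> degree_part S i" "b \<in> degree_part S j" shows "a + b \<in> degree_part S (i + j)"
proof -
  obtain c d where "(\<Sum>g\<in>gens. c g) = i"
    "\<And>k. Poly_Mapping.lookup a k = (\<Sum>g\<in>gens. c g * Poly_Mapping.lookup g k)"
    "(\<Sum>g\<in>gens. d g) = j"
    "\<And>k. Poly_Mapping.lookup b k = (\<Sum>g\<in>gens. d g * Poly_Mapping.lookup g k)"
    using assms unfolding degree_part_def min_gens_S by blast
  then show ?thesis unfolding degree_part_def min_gens_S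
    by (intro CollectI exI[of _ "\<lambda>g. c g + d g"]) (simp add: lookup_add sum.distrib distrib_right)
qed

lemma degree_part_uminus:
  assumes "a \<in> degree_part S i" shows "- a \<in> degree_part S (- i)"
proof -
  obtain c where "(\<Sum>g\<in>gens. c g) = i"
    "\<And>k. Poly_Mapping.lookup a k = (\<Sum>g\<in>gens. c g * Poly_Mapping.lookup g k)"
    using assms unfolding degree_part_def min_gens_S by blast
  then show ?thesis unfolding degree_part_def min_gens_S
    by (intro CollectI exI[of _ "\<lambda>g. - c g"]) (simp add: sum_negf)
qed

lemma degree_part_gens: "g \<in> gens \<Longrightarrow> g \<in> degree_part S 1"
  unfolding degree_part_def min_gens_S
  using gens_nonneg(1)
  by (intro CollectI exI[of _ "\<lambda>h. if h = g then 1 else 0"]) (simp add: if_distrib[of "\<lambda>c. c * _"] cong: if_cong)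

lemma S_in_degree_part: "s \<in> S \<Longrightarrow> \<exists>i. s \<in> degree_part S i"
  unfolding S_def
proof (induction rule: submonoid_span.induct)
  case zero
  have "0 \<in> degree_part S 0" unfolding degree_part_def by (intro CollectI exI[of _ "\<lambda>_. 0"]) simp
  then show ?case unfolding S_def by blast
next
  case (add a b)
  then show ?case using degree_part_add[OF degree_part_gens] unfolding S_def by blast
qed

lemma group_in_degree_part:
  assumes "a \<in> S_group" shows "a \<in> degree_part S (total a div D)"
proof -
  have "mon a \<in> localization S {e1, e2}"
    using assms e_in_gens by (intro group_in_localization_pair) auto
  then obtain N where N: "pt (int N * D) (int N * D) + a \<in> S"
    using localization_iff[of "{e1, e2}" D D "mon a"] D_pos by auto
  have "pt (int N * D) (int N * D) \<in> S"
    using D_pos XY_0 by (simp add: in_S_def)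
  then obtain i j where "pt (int N * D) (int N * D) \<in> degree_part S i"
    "pt (int N * D) (int N * D) + a \<in> degree_part S j"
    using N S_in_degree_part by blast
  then have "pt (int N * D) (int N * D) + a + - pt (int N * D) (int N * D) \<in> degree_part S (j + - i)"
    by (intro degree_part_add degree_part_uminus)
  then have "a \<in> degree_part S (j + - i)"
    by (simp only: add.commute[of "pt (int N * D) (int N * D)" a] add_minus_cancel add.assoc add.right_inverse add_0_right)
  moreover have "total a div D = j + - i" using degree_part_total[OF calculation] D_pos by simp
  ultimately show ?thesis by simp
qed

subsection \<open>Duality\<close>

text \<open>
The residue pairing: the coefficient at 0 of \<open>c f\<close> is the sum of the products of the coefficients
of \<open>c\<close> at \<open>w\<close> and of \<open>f\<close> at \<open>-w\<close>. In this form, linearity over the semigroup ring is associativity of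
multiplication.
\<close>

definition dual :: "'k::field laurent \<Rightarrow> 'k cochain \<Rightarrow> 'k" where
  "dual c z = (if z \<in> cocycles S 2 then coef (c * val z) 0 else 0)"

lemma coef_mult_0D:
  assumes "coef (c * f) 0 \<noteq> 0" obtains w where "w \<in> supp c" "- w \<in> supp f"
proof -
  have "0 \<in> supp (c * f)" using assms by (simp add: in_keys_iff)
  then obtain w a where "w \<in> supp c" "a \<in> supp f" "0 = w + a" using supp_mult[of c f] by blast
  then show ?thesis using that by (metis add.commute add_eq_0_iff)
qed

lemma dual_coboundary:
  assumes c: "supp c \<subseteq> W" and z: "z \<in> coboundaries S 2" shows "dual c z = 0"
proof -
  obtain f g where fg: "val z = f - g" "supp f \<subseteq> S_v" "supp g \<subseteq> S_u"
    using val_coboundary[OF z] .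
  have "coef (c * f) 0 = 0" using coef_mult_0D[of c f] c fg(2) unfolding W_def by blast
  moreover have "coef (c * g) 0 = 0" using coef_mult_0D[of c g] c fg(3) unfolding W_def by blast
  ultimately show ?thesis by (simp add: dual_def fg(1) right_diff_distrib lookup_minus)
qed

lemma dual_nonzeroD:
  assumes "dual c z \<noteq> 0" "z \<in> graded_cocycles S 2 i"
  obtains w where "w \<in> supp c" "total w = - (D * i)"
proof -
  obtain w where w: "w \<in> supp c" "- w \<in> supp (val z)"
    using assms(1) coef_mult_0D[of c "val z"] by (auto simp: dual_def split: if_splits)
  have "supp (val z) \<subseteq> degree_part S i"
    using assms(2) by (auto simp: graded_cocycles_def val_def alternating_def split: if_splits)
  then have "total (- w) = D * i" using w(2) degree_part_total by blast
  then show ?thesis using that[OF w(1)] by (simp add: total_def)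
qed

lemma dual_rep: "supp f \<subseteq> S_group \<Longrightarrow> dual c (rep f) = coef (c * f) 0"
  using rep_in_cocycles[of f] by (simp add: dual_def)

lemma dual_rep_mon: "w \<in> S_group \<Longrightarrow> dual c (rep (mon (- w))) = coef c w"
  using dual_rep[of "mon (- w)" c] group_uminus[of w] coef_mon_mult'[of "- w" c 0]
  by (simp add: mult.commute)

lemma W_subset_group: "W \<subseteq> S_group" by (auto simp: W_def)

lemma rep_mon_graded: "w \<in> S_group \<Longrightarrow> rep (mon w) \<in> graded_cocycles S 2 (total w div D)"
proof -
  assume w: "w \<in> S_group"
  then have "rep (mon w) \<in> cocycles S 2" by (intro rep_in_cocycles) simp
  moreover have "supp (rep (mon w) F) \<subseteq> {w}" for F by (simp add: rep_def edge_def)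
  ultimately show ?thesis using group_in_degree_part[OF w] unfolding graded_cocycles_def by blast
qed

lemma dual_in_canonical_module:
  fixes c :: "'k::field laurent"
  assumes c: "supp c \<subseteq> W" shows "dual c \<in> carrier (canonical_module S)"
proof -
  have "dual c \<in> cohomology_functionals S"
    unfolding cohomology_functionals_def semigroup_dim_S
  proof (intro CollectI conjI ballI allI impI)
    show "dual c (\<lambda>F. y F + z F) = dual c y + dual c z"
      if "y \<in> cocycles S 2" "z \<in> cocycles S 2" for y z
      using that cocycles_add[OF that] by (simp add: dual_def val_add distrib_left lookup_add)
    show "dual c (\<lambda>F. Poly_Mapping.single 0 k * z F) = k * dual c z" if "z \<in> cocycles S 2" for k z
      using that cocycles_mult[OF supp_const_in that, of k]
      by (simp add: dual_def val_mult mult.left_commute[of c "const k"] coef_const_mult)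
    show "dual c z = 0" if "z \<in> coboundaries S 2" for z by (rule dual_coboundary[OF c that])
  qed (simp add: dual_def)
  moreover have "finite {i. \<not> vanishes_in_degree S (dual c) i}"
  proof (rule finite_subset)
    show "{i. \<not> vanishes_in_degree S (dual c) i} \<subseteq> (\<lambda>w. - total w div D) ` supp c"
    proof
      fix i assume "i \<in> {i. \<not> vanishes_in_degree S (dual c) i}"
      then obtain z where "z \<in> graded_cocycles S 2 i" "dual c z \<noteq> 0"
        by (auto simp: vanishes_in_degree_def semigroup_dim_S)
      then obtain w where "w \<in> supp c" "total w = - (D * i)" using dual_nonzeroD by blast
      then show "i \<in> (\<lambda>w. - total w div D) ` supp c"
        using D_pos by (intro image_eqI[of _ _ w]) auto
    qed
  qed simp
  ultimately show ?thesis by (simp add: canonical_module_def)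
qed

text \<open>
The coefficients of \<open>c\<close> are the values of the functional on the monomial classes. Only finitely many of
them are nonzero, because the functional lives in finitely many degrees and \<open>W\<close> has finitely many
points in each degree.
\<close>

lemma functional_eq_dual:
  fixes \<phi> :: "'k::field cochain \<Rightarrow> 'k"
  assumes "\<phi> \<in> carrier (canonical_module S)"
  obtains c where "supp c \<subseteq> W" "\<phi> = dual c"
proof -
  have add: "\<phi> (\<lambda>F. y F + z F) = \<phi> y + \<phi> z" if "y \<in> cocycles S 2" "z \<in> cocycles S 2" for y z
    using assms that by (simp add: canonical_module_def cohomology_functionals_def semigroup_dim_S)
  have scale: "\<phi> (\<lambda>F. const k * z F) = k * \<phi> z" if "z \<in> cocycles S 2" for k z
    using assms that by (simp add: canonical_module_def cohomology_functionals_def semigroup_dim_S)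
  have cob: "\<phi> z = 0" if "z \<in> coboundaries S 2" for z
    using assms that by (simp add: canonical_module_def cohomology_functionals_def semigroup_dim_S)
  have outside: "\<phi> z = 0" if "z \<notin> cocycles S 2" for z
    using assms that by (simp add: canonical_module_def cohomology_functionals_def semigroup_dim_S)
  have fin: "finite {i. \<not> vanishes_in_degree S \<phi> i}"
    using assms by (simp add: canonical_module_def)
  define V where "V = {w \<in> W. \<phi> (rep (mon (- w))) \<noteq> 0}"
  have finV: "finite V"
  proof (rule finite_subset)
    let ?I = "{i. \<not> vanishes_in_degree S \<phi> i}"
    show "V \<subseteq> (\<Union>i\<in>?I. {w \<in> W. total w = - (D * i)})"
    proof
      fix w assume w: "w \<in> V"
      then have "- w \<in> S_group" using W_subset_group group_uminus unfolding V_def by blast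
      then have g: "rep (mon (- w)) \<in> graded_cocycles S 2 (total (- w) div D)"
        and "total (- w) = D * (total (- w) div D)"
        using rep_mon_graded degree_part_total group_in_degree_part by blast+
      moreover have "total (- w) = - total w" by (simp add: total_def)
      ultimately have "total w = - (D * (total (- w) div D))" by linarith
      moreover have "total (- w) div D \<in> ?I"
        using w g by (auto simp: V_def vanishes_in_degree_def semigroup_dim_S)
      ultimately show "w \<in> (\<Union>i\<in>?I. {w \<in> W. total w = - (D * i)})"
        using w by (auto simp: V_def)
    qed
    show "finite (\<Union>i\<in>?I. {w \<in> W. total w = - (D * i)})" using fin finite_W_degree by blast
  qed
  define c where "c = (\<Sum>w\<in>V. const (\<phi> (rep (mon (- w)))) * mon w)"
  have coef_c: "coef c w = (if w \<in> W then \<phi> (rep (mon (- w))) else 0)" for w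
    using finV by (auto simp: c_def lookup_sum coef_const_mult lookup_single when_def V_def
        if_distrib cong: if_cong)
  have rep_zero: "rep (0 :: 'k laurent) \<in> coboundaries S 2" by (rule rep_in_coboundaries) simp
  have rep: "supp f \<subseteq> S_group \<and> \<phi> (rep f) = coef (c * f) 0" if "supp f \<subseteq> S_group" for f
    using that
  proof (induction rule: laurent_induct)
    case (mon a)
    have "\<phi> (rep (mon a)) = coef c (- a)"
    proof (cases "- a \<in> W")
      case True then show ?thesis by (simp add: coef_c)
    next
      case False
      then have "a \<in> S_u \<or> a \<in> S_v" using mon group_uminus by (auto simp: W_def)
      then have "rep (mon a :: 'k laurent) \<in> coboundaries S 2" by (intro rep_in_coboundaries) auto
      then show ?thesis using False by (simp add: coef_c cob)
    qed
    then show ?case using mon coef_mon_mult'[of a c 0] by (simp add: mult.commute)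
  next
    case (const k g)
    have "supp (const k * g) \<subseteq> supp g" by (auto simp: in_keys_iff coef_const_mult)
    then show ?case using const scale[OF rep_in_cocycles[of g], of k]
      by (auto simp: rep_mult mult.left_commute[of c "const k"] coef_const_mult simp del: subsetI)
  next
    case (add g h)
    then have "supp (g + h) \<subseteq> S_group" using Poly_Mapping.keys_add[of g h] by blast
    then show ?case
      using add \<open>\<And>z y. y \<in> cocycles S 2 \<Longrightarrow> z \<in> cocycles S 2 \<Longrightarrow> \<phi> (\<lambda>F. y F + z F) = \<phi> y + \<phi> z\<close>
      by (simp add: rep_add rep_in_cocycles distrib_left lookup_add)
  next
    case zero then show ?case using cob[OF rep_zero] by simp
  qed
  have "\<phi> z = dual c z" for z
  proof (cases "z \<in> cocycles S 2")
    case True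
    let ?r = "rep (val z)"
    have r: "?r \<in> cocycles S 2" by (rule rep_in_cocycles[OF supp_val[OF True]])
    have mr: "(\<lambda>F. const (- 1) * ?r F) \<in> cocycles S 2" by (rule cocycles_mult[OF supp_const_in r])
    have m1: "const (- 1 :: 'k) = - 1" by (simp add: single_uminus)
    have "\<phi> (\<lambda>F. z F + const (- 1) * ?r F) = 0"
      using cob[OF cocycle_minus_rep_val[OF True]] unfolding m1 .
    then have "\<phi> z + - 1 * \<phi> ?r = 0" using add[OF True mr] scale[OF r, of "- 1"] by simp
    then show ?thesis using rep[OF supp_val[OF True]] True by (simp add: dual_def)
  qed (simp add: outside dual_def)
  then have "\<phi> = dual c" by blast
  moreover have "supp c \<subseteq> W" by (auto simp: in_keys_iff coef_c split: if_splits)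
  ultimately show ?thesis using that by blast
qed

lemma canonical_module_isomorphism:
  "module_isomorphism (semigroup_ring S :: 'k::field laurent ring) (monomial_module W)
     (canonical_module S) dual"
proof (intro module_isomorphism.intro module_isomorphism_axioms.intro
    canonical.module_monomial_module)
  show "bij_betw dual (carrier (monomial_module W)) (carrier (canonical_module S :: ('k laurent, 'k cochain \<Rightarrow> 'k) module))"
  proof (rule bij_betwI')
    fix c c' :: "'k laurent"
    assume c: "c \<in> carrier (monomial_module W)" "c' \<in> carrier (monomial_module W)"
    show "dual c = dual c' \<longleftrightarrow> c = c'"
    proof
      assume eq: "dual c = dual c'"
      show "c = c'"
      proof (rule poly_mapping_eqI)
        fix w show "coef c w = coef c' w"
        proof (cases "w \<in> W")
          case True
          then have "w \<in> S_group" using W_subset_group by blast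
          then show ?thesis using dual_rep_mon[of w c] dual_rep_mon[of w c'] eq by simp
        next
          case False
          then have "w \<notin> supp c" "w \<notin> supp c'" using c by auto
          then show ?thesis by (simp add: in_keys_iff)
        qed
      qed
    qed simp
  next
    fix c :: "'k laurent" assume "c \<in> carrier (monomial_module W)"
    then show "dual c \<in> carrier (canonical_module S)" using dual_in_canonical_module by simp
  next
    fix \<phi> :: "'k cochain \<Rightarrow> 'k" assume "\<phi> \<in> carrier (canonical_module S)"
    then obtain c where "supp c \<subseteq> W" "\<phi> = dual c" using functional_eq_dual by blast
    then show "\<exists>c\<in>carrier (monomial_module W). \<phi> = dual c" by auto
  qed
  fix c c' r :: "'k laurent"
  show "dual (c \<oplus>\<^bsub>monomial_module W\<^esub> c') = dual c \<oplus>\<^bsub>canonical_module S\<^esub> dual c'"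
    by (rule ext) (simp add: canonical_module_def dual_def distrib_right lookup_add)
  show "dual \<zero>\<^bsub>monomial_module W\<^esub> = (\<zero>\<^bsub>canonical_module S\<^esub> :: 'k cochain \<Rightarrow> 'k)"
    by (rule ext) (simp add: canonical_module_def dual_def)
  assume r: "r \<in> carrier (semigroup_ring S)"
  show "dual (r \<odot>\<^bsub>monomial_module W\<^esub> c) = r \<odot>\<^bsub>canonical_module S\<^esub> dual c"
  proof
    fix z
    show "dual (r \<odot>\<^bsub>monomial_module W\<^esub> c) z = (r \<odot>\<^bsub>canonical_module S\<^esub> dual c) z"
      using cocycles_mult[of r z] r
      by (auto simp: canonical_module_def dual_def semigroup_dim_S val_mult mult_ac)
  qed
qed

text \<open>
The monomial functionals are homogeneous of a unique degree, as they do not vanish on the class of the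
inverse monomial.
\<close>

lemma dual_mon_in_canonical_part:
  assumes w: "w \<in> W"
  shows "(dual (mon w) :: 'k::field cochain \<Rightarrow> 'k) \<in> canonical_part S i \<longleftrightarrow> i = total w div D"
proof
  have wg: "w \<in> S_group" using w W_subset_group by blast
  have tw: "total w = D * (total w div D)"
    using degree_part_total[OF group_in_degree_part[OF wg]] .
  have neg: "total (- w) div D = - (total w div D)"
  proof -
    have "total (- w) = D * - (total w div D)" using tw by (simp add: total_def)
    moreover have "D \<noteq> 0" using D_pos by simp
    ultimately show ?thesis by (metis nonzero_mult_div_cancel_left)
  qed
  assume i: "(dual (mon w) :: 'k cochain \<Rightarrow> 'k) \<in> canonical_part S i"
  show "i = total w div D"
  proof (rule ccontr)
    assume "i \<noteq> total w div D"
    then have "vanishes_in_degree S (dual (mon w) :: 'k cochain \<Rightarrow> 'k) (total (- w) div D)"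
      using i neg by (simp add: canonical_part_def)
    then have "dual (mon w) (rep (mon (- w)) :: 'k cochain) = 0"
      using rep_mon_graded[OF group_uminus[OF wg]]
      by (auto simp: vanishes_in_degree_def semigroup_dim_S)
    then show False using dual_rep_mon[OF wg, of "mon w :: 'k laurent"] by simp
  qed
next
  assume i: "i = total w div D"
  have "vanishes_in_degree S (dual (mon w) :: 'k cochain \<Rightarrow> 'k) j" if "j \<noteq> - i" for j
    unfolding vanishes_in_degree_def semigroup_dim_S
  proof (rule ballI, rule ccontr)
    fix z :: "'k cochain" assume "z \<in> graded_cocycles S 2 j" "dual (mon w) z \<noteq> 0"
    then have "total w = D * - j" using dual_nonzeroD[of "mon w" z j] by auto
    moreover have "D \<noteq> 0" using D_pos by simp
    ultimately have "total w div D = - j" by (metis nonzero_mult_div_cancel_left)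
    then show False using i that by simp
  qed
  then show "(dual (mon w) :: 'k cochain \<Rightarrow> 'k) \<in> canonical_part S i"
    using dual_in_canonical_module[of "mon w"] w by (simp add: canonical_part_def)
qed

end

section \<open>Type, trace and levelness\<close>

text \<open>
The exponents in \<open>W\<close> form the quadrants with the corners \<open>(D - X k, D - Y k)\<close>. The set \<open>K\<close> is meant to
single out those \<open>k\<close> for which this corner is a minimal generator, that is, for which \<open>(X k, Y k)\<close> is
maximal among all corners of \<open>S\<close> for divisibility in \<open>S\<close>: by \<open>K_above\<close> the corners from \<open>K\<close> suffice,
and by \<open>K_maximal\<close> none of them stays in \<open>W\<close> after subtraction of a generator of \<open>S\<close>. In \<open>trace\<close>, the
vector \<open>(p, q)\<close> translates \<open>W\<close> into \<open>S\<close>, and a point of \<open>W\<close> onto \<open>(a, D - a)\<close>.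
\<close>

locale nearly_gorenstein_curve = monomial_curve D A X Y
  for D A X Y +
  fixes K :: "int set"
  assumes K_subset: "K \<subseteq> {0..<D}"
    and K_above: "\<And>k. k \<in> {0..<D} \<Longrightarrow> \<exists>l\<in>K. in_S (X l - X k) (Y l - Y k)"
    and K_maximal: "\<And>l a. l \<in> K \<Longrightarrow> a \<in> A \<Longrightarrow>
      X ((l + a) mod D) \<le> X l + a - D \<or> Y ((l + a) mod D) \<le> Y l - a"
    and trace: "\<And>a. a \<in> A \<Longrightarrow> \<exists>p q. D dvd p + q \<and>
      p - a < X ((p - a) mod D) \<and> q + a - D < Y ((p - a) mod D) \<and>
      (\<forall>l\<in>K. in_S (p + D - X l) (q + D - Y l))"
    and two_degrees: "\<exists>l\<in>K. \<exists>l'\<in>K. X l + Y l \<noteq> X l' + Y l'"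
begin

definition H :: "expo set" where
  "H = (\<lambda>l. pt (D - X l) (D - Y l)) ` K"

lemma card_H: "card H = card K"
proof -
  have "inj_on (\<lambda>l. pt (D - X l) (D - Y l)) K"
  proof (rule inj_onI)
    fix l l' assume l: "l \<in> K" "l' \<in> K" and "pt (D - X l) (D - Y l) = pt (D - X l') (D - Y l')"
    then have "X l mod D = X l' mod D" by simp
    moreover have "l \<in> {0..<D}" "l' \<in> {0..<D}" using l K_subset by blast+
    ultimately show "l = l'" using X_mod by metis
  qed
  then show ?thesis unfolding H_def by (rule card_image)
qed

lemma pt_in_W_iff:
  "pt x y \<in> W \<longleftrightarrow> D dvd x + y \<and> - x < X ((- x) mod D) \<and> - y < Y ((- x) mod D)"
proof -
  have "D dvd - x + - y \<longleftrightarrow> D dvd x + y"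
    using dvd_minus_iff[of D "x + y"] by (simp only: minus_add_distrib)
  then show ?thesis by (auto simp: W_def S_group_def S_u_def S_v_def not_le)
qed

lemma in_S_add_quadrant:
  assumes "in_S x y" "D dvd m" "D dvd n" "0 \<le> m" "0 \<le> n" shows "in_S (x + m) (y + n)"
proof -
  have "D dvd (x + y) + (m + n)" using assms by (auto simp: in_S_def)
  moreover obtain i where "m = D * i" using assms(2) by blast
  then have "(x + m) mod D = x mod D" by simp
  ultimately show ?thesis using assms(1,4,5) by (simp add: in_S_def algebra_simps)
qed

sublocale generators: expo_module_generators S W H
proof
  show "finite H" using K_subset finite_subset[of K "{0..<D}"] by (simp add: H_def)
  show "H \<subseteq> W"
  proof
    fix h assume "h \<in> H"
    then obtain l where l: "l \<in> K" "h = pt (D - X l) (D - Y l)" by (auto simp: H_def)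
    then have k: "l \<in> {0..<D}" using K_subset by blast
    have "(- (D - X l)) mod D = l" using X_mod[OF k] by simp
    moreover have "D dvd (D + D) - (X l + Y l)" using XY_dvd[OF k] by (intro dvd_diff) auto
    ultimately show "h \<in> W" unfolding l(2) pt_in_W_iff using D_pos by (simp add: algebra_simps)
  qed
  show "\<exists>h\<in>H. w - h \<in> S" if wW: "w \<in> W" for w
  proof -
    obtain x y where w: "w = pt x y" "D dvd x + y" using wW by (auto simp: W_def S_group_def)
    define k where "k = (- x) mod D"
    have k: "k \<in> {0..<D}" unfolding k_def by (rule residue)
    have lt: "- x < X k" "- y < Y k" using wW w pt_in_W_iff unfolding k_def by auto
    have d: "D dvd x + X k" using dvd_diff_X[of "- x"] unfolding k_def
      by (metis dvd_minus_iff minus_diff_eq diff_minus_eq_add add.commute)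
    moreover have "D dvd (x + y) + (X k + Y k) - (x + X k)"
      by (intro dvd_diff dvd_add w(2) XY_dvd k d)
    ultimately have d2: "D dvd y + Y k" by simp
    have ge: "D \<le> x + X k" "D \<le> y + Y k" using lt d d2 by (auto intro: zdvd_imp_le)
    obtain l where l: "l \<in> K" "in_S (X l - X k) (Y l - Y k)" using K_above[OF k] by blast
    have "in_S (X l - X k + (x + X k - D)) (Y l - Y k + (y + Y k - D))"
      by (rule in_S_add_quadrant[OF l(2)]) (use d d2 ge in auto)
    then have "w - pt (D - X l) (D - Y l) \<in> S" unfolding w by (simp add: algebra_simps)
    then show ?thesis using l(1) unfolding H_def by blast
  qed
  show "s = 0" if h: "h \<in> H" and s: "s \<in> S" and hs: "h - s \<in> W" for h s
  proof (rule ccontr)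
    assume "s \<noteq> 0"
    then obtain a t where a: "a \<in> A" "t \<in> S" "s = pt a (D - a) + t" using S_cases[OF s] by blast
    obtain l where l: "l \<in> K" "h = pt (D - X l) (D - Y l)" using h by (auto simp: H_def)
    have "t + (h - s) \<in> W" using canonical.act a(2) hs by blast
    also have "t + (h - s) = h - pt a (D - a)" using a(3) by simp
    finally have "pt (D - X l - a) (D - Y l - (D - a)) \<in> W" unfolding l by simp
    then have "X l + a - D < X ((X l + a - D) mod D)" "Y l - a < Y ((X l + a - D) mod D)"
      unfolding pt_in_W_iff by (simp_all add: algebra_simps)
    moreover have "(X l + a - D) mod D = (l + a) mod D"
      using X_mod[of l] K_subset l(1) by (metis minus_mod_self2 mod_add_left_eq subsetD)
    ultimately show False using K_maximal[OF l(1) a(1)] by auto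
  qed
qed

lemma cm_type_S: "cm_type TYPE('k::field) S = enat (card K)"
proof -
  interpret I: module_isomorphism "semigroup_ring S :: 'k laurent ring" "monomial_module W"
    "canonical_module S" dual by (rule canonical_module_isomorphism)
  show ?thesis unfolding cm_type_def I.min_num_generators_eq
    by (simp add: generators.min_num_generators_monomial_module card_H)
qed

lemma nearly_gorenstein_S: "nearly_gorenstein TYPE('k::field) S"
proof -
  interpret I: module_isomorphism "semigroup_ring S :: 'k laurent ring" "monomial_module W"
    "canonical_module S" dual by (rule canonical_module_isomorphism)
  have "graded_max_ideal S \<subseteq> trace_ideal (semigroup_ring S :: 'k laurent ring) (monomial_module W)"
  proof (rule canonical.graded_max_ideal_subset_trace[of gens])
    show "\<exists>a\<in>gens. s - a \<in> S" if "s \<in> S" "s \<noteq> 0" for s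
      using S_cases[OF that] by (metis (no_types, lifting) add_diff_cancel_left' gens_def image_eqI)
    fix g assume "g \<in> gens"
    then obtain a where a: "a \<in> A" "g = pt a (D - a)" by (auto simp: gens_def)
    obtain p q where pq: "D dvd p + q" "p - a < X ((p - a) mod D)" "q + a - D < Y ((p - a) mod D)"
      "\<And>l. l \<in> K \<Longrightarrow> in_S (p + D - X l) (q + D - Y l)"
      using trace[OF a(1)] by blast
    have "D dvd D - (p + q)" using pq(1) by (intro dvd_diff) auto
    then have "g - pt p q \<in> W" using pq(2,3) by (simp add: a(2) pt_in_W_iff algebra_simps)
    moreover have "pt p q + w \<in> S" if w: "w \<in> W" for w
    proof -
      obtain h where h: "h \<in> H" "w - h \<in> S" using generators.H_generates[OF w] by blast
      then have "pt p q + h \<in> S" using pq(4) by (auto simp: H_def algebra_simps)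
      then have "pt p q + h + (w - h) \<in> S" using h(2) by (rule add_in)
      then show ?thesis by simp
    qed
    ultimately show "\<exists>t. g - t \<in> W \<and> (\<forall>w\<in>W. t + w \<in> S)" by blast
  qed
  then show ?thesis unfolding nearly_gorenstein_def using I.trace_ideal_le by blast
qed

text \<open>
The monomials of the minimal exponents form a minimal generating system in which two degrees occur.
\<close>

lemma not_level_S: "\<not> level TYPE('k::field) S"
proof
  assume "level TYPE('k) S"
  then obtain i where i: "\<And>G :: ('k cochain \<Rightarrow> 'k) set. minimal_generating_system S G \<Longrightarrow> G \<subseteq> canonical_part S i"
    unfolding level_def by blast
  interpret I: module_isomorphism "semigroup_ring S :: 'k laurent ring" "monomial_module W"
    "canonical_module S" dual by (rule canonical_module_isomorphism)
  let ?G = "dual ` mon ` H :: ('k cochain \<Rightarrow> 'k) set"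
  have fin: "finite ?G" using generators.finite_H by simp
  have "minimal_generating_system S ?G"
    unfolding minimal_generating_system_def
  proof (intro conjI allI impI)
    show "?G \<subseteq> (\<Union>i. canonical_part S i)"
      using dual_mon_in_canonical_part generators.H_subset by blast
    show "generates_module (semigroup_ring S) (canonical_module S) ?G"
      by (rule I.generates_image[OF generators.mon_H_generates])
    fix G' assume G': "G' \<subset> ?G"
    show "\<not> generates_module (semigroup_ring S) (canonical_module S) G'"
    proof
      assume gen: "generates_module (semigroup_ring S) (canonical_module S) G'"
      have "finite G'" using G' fin finite_subset by blast
      then have "min_num_generators (semigroup_ring S :: 'k laurent ring) (canonical_module S) \<le> enat (card G')"
        unfolding min_num_generators_def using gen by (intro Inf_lower) blast
      then have "card H \<le> card G'"
        unfolding I.min_num_generators_eq generators.min_num_generators_monomial_module by simp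
      also have "\<dots> < card ?G" by (rule psubset_card_mono[OF fin G'])
      also have "\<dots> \<le> card H"
        by (rule order_trans[OF card_image_le card_image_le]) (simp_all add: generators.finite_H)
      finally show False by simp
    qed
  qed
  then have "?G \<subseteq> canonical_part S i" by (rule i)
  then have part: "i = total h div D" if "h \<in> H" for h
    using dual_mon_in_canonical_part[of h i, where ?'k = 'k] that generators.H_subset by blast
  have dvd: "D dvd total h" if "h \<in> H" for h
  proof -
    have "h \<in> S_group" using that generators.H_subset W_subset_group by blast
    then show ?thesis by (auto simp: S_group_def)
  qed
  have "total h = D * i" if "h \<in> H" for h using part[OF that] dvd[OF that] by simp
  then have "X l + Y l = 2 * D - D * i" if "l \<in> K" for l
    using that by (force simp: H_def)
  then show False using two_degrees by metis
qed

lemma exists_semigroup: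
  "\<exists>S. affine_semigroup S \<and> homogeneous_semigroup S
    \<and> cohen_macaulay (semigroup_ring S :: 'k::field laurent ring)
    \<and> cm_type TYPE('k) S = enat (card K)
    \<and> nearly_gorenstein TYPE('k) S
    \<and> \<not> level TYPE('k) S"
  using affine_semigroup_S homogeneous_semigroup_S cohen_macaulay_S cm_type_S nearly_gorenstein_S
    not_level_S by blast

end

text \<open>
The conditions of \<open>nearly_gorenstein_curve\<close> for tables \<open>xs\<close> and \<open>ys\<close> of \<open>X\<close> and \<open>Y\<close>, in executable form. The
list \<open>ts\<close> provides for each \<open>a\<close> a translation \<open>(p, q)\<close>.
\<close>

definition curve_check ::
    "int \<Rightarrow> int list \<Rightarrow> int list \<Rightarrow> int list \<Rightarrow> int list \<Rightarrow> (int \<times> int \<times> int) list \<Rightarrow> bool" where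
  "curve_check D as xs ys ks ts \<longleftrightarrow>
    (let X = (\<lambda>k. xs ! nat k); Y = (\<lambda>k. ys ! nat k);
         mem = (\<lambda>x y. (x + y) mod D = 0 \<and> X (x mod D) \<le> x \<and> Y (x mod D) \<le> y)
     in 0 < D \<and> list_all (\<lambda>a. 0 \<le> a \<and> a \<le> D) as \<and> 0 \<in> set as \<and> D \<in> set as
      \<and> X 0 = 0 \<and> Y 0 = 0
      \<and> list_all (\<lambda>k. 0 \<le> X k \<and> 0 \<le> Y k \<and> X k mod D = k \<and> (X k + Y k) mod D = 0) [0..D - 1]
      \<and> list_all (\<lambda>k. list_all (\<lambda>a. X ((k + a) mod D) \<le> X k + a \<and>
            Y ((k + a) mod D) \<le> Y k + (D - a)) as) [0..D - 1]
      \<and> list_all (\<lambda>k. list_ex (\<lambda>a. X k - a = X ((k - a) mod D) \<and>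
            Y k - (D - a) = Y ((k - a) mod D)) as) [1..D - 1]
      \<and> list_all (\<lambda>l. 0 \<le> l \<and> l < D) ks
      \<and> list_all (\<lambda>k. list_ex (\<lambda>l. mem (X l - X k) (Y l - Y k)) ks) [0..D - 1]
      \<and> list_all (\<lambda>l. list_all (\<lambda>a. X ((l + a) mod D) \<le> X l + a - D \<or>
            Y ((l + a) mod D) \<le> Y l - a) as) ks
      \<and> map fst ts = as
      \<and> list_all (\<lambda>(a, p, q). (p + q) mod D = 0 \<and> p - a < X ((p - a) mod D)
            \<and> q + a - D < Y ((p - a) mod D)
            \<and> list_all (\<lambda>l. mem (p + D - X l) (q + D - Y l)) ks) ts
      \<and> list_ex (\<lambda>l. list_ex (\<lambda>l'. X l + Y l \<noteq> X l' + Y l') ks) ks)"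

lemma nearly_gorenstein_curve_if_check:
  assumes "curve_check D as xs ys ks ts"
  shows "nearly_gorenstein_curve D (set as) (\<lambda>k. xs ! nat k) (\<lambda>k. ys ! nat k) (set ks)"
proof -
  let ?X = "\<lambda>k. xs ! nat k" and ?Y = "\<lambda>k. ys ! nat k"
  let ?mem = "\<lambda>x y. (x + y) mod D = 0 \<and> ?X (x mod D) \<le> x \<and> ?Y (x mod D) \<le> y"
  note c = assms[unfolded curve_check_def Let_def list_all_iff list_ex_iff set_upto]
  have D: "0 < D" and as: "\<forall>a\<in>set as. 0 \<le> a \<and> a \<le> D" "0 \<in> set as" "D \<in> set as"
    and zero: "?X 0 = 0" "?Y 0 = 0"
    and base: "\<forall>k\<in>{0..D - 1}. 0 \<le> ?X k \<and> 0 \<le> ?Y k \<and> ?X k mod D = k \<and> (?X k + ?Y k) mod D = 0"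
    and add: "\<forall>k\<in>{0..D - 1}. \<forall>a\<in>set as. ?X ((k + a) mod D) \<le> ?X k + a \<and>
      ?Y ((k + a) mod D) \<le> ?Y k + (D - a)"
    and pred: "\<forall>k\<in>{1..D - 1}. \<exists>a\<in>set as. ?X k - a = ?X ((k - a) mod D) \<and>
      ?Y k - (D - a) = ?Y ((k - a) mod D)"
    and ks: "\<forall>l\<in>set ks. 0 \<le> l \<and> l < D"
    and above: "\<forall>k\<in>{0..D - 1}. \<exists>l\<in>set ks. ?mem (?X l - ?X k) (?Y l - ?Y k)"
    and maximal: "\<forall>l\<in>set ks. \<forall>a\<in>set as. ?X ((l + a) mod D) \<le> ?X l + a - D \<or>
      ?Y ((l + a) mod D) \<le> ?Y l - a"
    and ts: "map fst ts = as"
    and shifts: "\<forall>t\<in>set ts. case t of (a, p, q) \<Rightarrow> (p + q) mod D = 0 \<and> p - a < ?X ((p - a) mod D)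
      \<and> q + a - D < ?Y ((p - a) mod D) \<and> (\<forall>l\<in>set ks. ?mem (p + D - ?X l) (q + D - ?Y l))"
    and two: "\<exists>l\<in>set ks. \<exists>l'\<in>set ks. ?X l + ?Y l \<noteq> ?X l' + ?Y l'"
    by (insert c) (elim conjE, assumption)+
  have curve: "monomial_curve D (set as) ?X ?Y"
  proof
    show "?X k mod D = k" "D dvd ?X k + ?Y k" "0 \<le> ?X k \<and> 0 \<le> ?Y k" if "k \<in> {0..<D}" for k
      using base that by (simp_all add: dvd_eq_mod_eq_0)
    show "?X ((k + a) mod D) \<le> ?X k + a \<and> ?Y ((k + a) mod D) \<le> ?Y k + (D - a)"
      if "a \<in> set as" "k \<in> {0..<D}" for a k
      using add that by simp
    show "\<exists>a\<in>set as. ?X k - a = ?X ((k - a) mod D) \<and> ?Y k - (D - a) = ?Y ((k - a) mod D)"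
      if "k \<in> {1..<D}" for k
      using pred that by simp
  qed (use D as zero in auto)
  have mem: "monomial_curve.in_S D ?X ?Y x y \<longleftrightarrow> ?mem x y" for x y
    unfolding monomial_curve.in_S_def[OF curve] dvd_eq_mod_eq_0 ..
  show ?thesis
  proof (intro nearly_gorenstein_curve.intro nearly_gorenstein_curve_axioms.intro curve)
    show "set ks \<subseteq> {0..<D}" using ks by auto
    show "\<exists>l\<in>set ks. monomial_curve.in_S D ?X ?Y (?X l - ?X k) (?Y l - ?Y k)"
      if "k \<in> {0..<D}" for k
      using above[rule_format, of k] that unfolding mem by simp
    show "?X ((l + a) mod D) \<le> ?X l + a - D \<or> ?Y ((l + a) mod D) \<le> ?Y l - a"
      if "l \<in> set ks" "a \<in> set as" for l a
      using maximal that by blast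
    show "\<exists>p q. D dvd p + q \<and> p - a < ?X ((p - a) mod D) \<and> q + a - D < ?Y ((p - a) mod D)
      \<and> (\<forall>l\<in>set ks. monomial_curve.in_S D ?X ?Y (p + D - ?X l) (q + D - ?Y l))"
      if a: "a \<in> set as" for a
    proof -
      obtain p q where "(a, p, q) \<in> set ts" using a ts by auto
      from shifts[rule_format, OF this] show ?thesis 
        unfolding mem dvd_eq_mod_eq_0 by (intro exI[of _ p] exI[of _ q]) simp
    qed
    show "\<exists>l\<in>set ks. \<exists>l'\<in>set ks. ?X l + ?Y l \<noteq> ?X l' + ?Y l'" by (rule two)
  qed
qed

text \<open>
The examples result from a search through the subsets of \<open>{0..D}\<close>. In each of them all but one of the
maximal corners have degree 3, and the remaining one has degree 2.
\<close>

lemma curve_check_type_3: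
  "curve_check 17 [0, 2, 4, 5, 7, 9, 12, 17]
    [0, 18, 2, 20, 4, 5, 6, 7, 8, 9, 10, 11, 12, 13, 14, 15, 16]
    [0, 16, 15, 31, 13, 12, 28, 10, 26, 8, 24, 23, 5, 21, 20, 36, 18]
    [3, 14, 15]
    [(0, 3, 31), (2, 5, 29), (4, 7, 27), (5, 3, 31), (7, 10, 24), (9, 7, 27), (12, 15, 19), (17, 15, 19)]"
  by code_simp

lemma curve_check_type_4:
  "curve_check 15 [0, 2, 6, 8, 9, 15]
    [0, 16, 2, 18, 4, 20, 6, 22, 8, 9, 10, 11, 12, 13, 14]
    [0, 14, 13, 12, 26, 25, 9, 23, 7, 6, 20, 19, 18, 32, 16]
    [5, 7, 10, 13]
    [(0, 7, 23), (2, 7, 23), (6, 13, 17), (8, 13, 17), (9, 7, 23), (15, 13, 17)]"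
  by code_simp

lemma curve_check_type_5:
  "curve_check 19 [0, 4, 6, 10, 12, 13, 19]
    [0, 20, 21, 22, 4, 24, 6, 26, 8, 28, 10, 30, 12, 13, 14, 34, 16, 17, 18]
    [0, 18, 36, 16, 15, 14, 13, 12, 30, 29, 9, 27, 7, 6, 24, 23, 22, 21, 20]
    [2, 9, 11, 14, 15]
    [(0, 15, 23), (4, 15, 23), (6, 15, 23), (10, 21, 17), (12, 21, 17), (13, 15, 23), (19, 21, 17)]"
  by code_simp

theorem theorem4p9:
  fixes d :: nat
  assumes "3 \<le> d" and "d \<le> 5"
  shows "\<exists>S. affine_semigroup S \<and> homogeneous_semigroup S
    \<and> cohen_macaulay (semigroup_ring S :: 'k::field laurent ring)
    \<and> cm_type TYPE('k) S = enat d
    \<and> nearly_gorenstein TYPE('k) S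
    \<and> \<not> level TYPE('k) S"
proof -
  note exists = nearly_gorenstein_curve.exists_semigroup[OF nearly_gorenstein_curve_if_check,
      where ?'k = 'k]
  consider "d = 3" | "d = 4" | "d = 5" using assms by linarith
  then show ?thesis
  proof cases
    case 1 then show ?thesis using exists[OF curve_check_type_3] by (simp add: numeral_eq_Suc)
  next
    case 2 then show ?thesis using exists[OF curve_check_type_4] by (simp add: numeral_eq_Suc)
  next
    case 3 then show ?thesis using exists[OF curve_check_type_5] by (simp add: numeral_eq_Suc)
  qed
qed

end
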